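(* Let $V$ be a valuation domain with quotient field $K$. Then every extension $W$ of $V$ to $K(X)$ is of the form $W=V_E$ for some pseudo-monotone sequence $E\subset K$ if and only if the completion $\widehat K$ is algebraically closed. In this case, for an extension $W=V_E$ of $V$ to $K(X)$, the following hold. (a) If $V\subset W$ is immediate, then $E$ is necessarily a pseudo-convergent sequence of transcendental type. (b) If $V\subset W$ is not immediate, then: (b1) if $\mathcal L(W)=\emptyset$, then $E$ is a pseudo-convergent Cauchy sequence of algebraic type whose limit is in $\widehat K\setminus K$; (b2) if $\mathcal L_1(W)=\alpha+I\neq\emptyset$ and $I$ is a divisorial fractional ideal, then $E$ can be taken to be pseudo-convergent of algebraic type; (b3) if $\mathcal L_1(W)=\alpha+I\neq\emptyset$ and $I$ is not a principal ideal, then $E$ can be taken to be pseudo-divergent; (b4) if $\mathcal L_2(W)=\alpha+I\neq\emptyset$, then $E$ is necessarily a pseudo-stationary sequence.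
   Context: $V$ is a valuation domain with quotient field $K$, maximal ideal $M$, valuation $v$ and value group $\Gamma_v$; $\widehat K$ is the completion of $K$ in the topology induced by $v$. An extension of $V$ to $K(X)$ is a valuation domain $W$ of $K(X)$ with $W\cap K=V$; its valuation $w$ is chosen to extend $v$, so $\Gamma_v\subseteq\Gamma_w$. The extension $V\subset W$ is immediate if $V$ and $W$ have the same value group and the same residue field. Sequences $E=\{s_\nu\}_{\nu\in\Lambda}\subset K$ are indexed by well-ordered sets $\Lambda$ without maximum. $E$ is pseudo-convergent if $v(s_\rho-s_\nu)<v(s_\sigma-s_\rho)$ for all $\nu<\rho<\sigma$; pseudo-divergent if $v(s_\rho-s_\nu)>v(s_\sigma-s_\rho)$ for all $\nu<\rho<\sigma$; pseudo-stationary if $v(s_\nu-s_\mu)=v(s_{\nu'}-s_{\mu'})$ for all $\nu\ne\mu$, $\nu'\neq\mu'$. $E$ is pseudo-monotone if it is one of these three. For a pseudo-monotone $E$ put $V_E=\{\phi\in K(X)\mid \phi(s_\nu)\in V\text{ for all sufficiently large }\nu\in\Lambda\}$; this is a valuation domain of $K(X)$ extending $V$. A pseudo-convergent sequence $E$ is of transcendental type if for every $f\in K[X]$ the values $v(f(s_\nu))$ eventually stabilize, and of algebraic type if $v(f(s_\nu))$ is eventually increasing for some $f\in K[X]$. A pseudo-convergent Cauchy sequence has a unique limit in $\widehat K$. For an extension $W$ of $V$ to $K(X)$ define $\mathcal L_1(W)=\{\alpha\in K\mid w(X-\alpha)\notin\Gamma_v\}$, $\mathcal L_2(W)=\{\alpha\in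 K\mid w(X-\alpha)\in\Gamma_v,\ \text{and } w(X-\alpha+c)=w(X-\alpha)\text{ for every } c\in K\text{ with }v(c)=w(X-\alpha)\}$, $\mathcal L(W)=\mathcal L_1(W)\cup\mathcal L_2(W)$. If $\mathcal L_1(W)$ is nonempty, it is equal to $K$ or to $\alpha+I$ for some $\alpha\in K$ and some fractional ideal $I$ of $V$; the case $\mathcal L_1(W)=K$ (that is, $I=K$) is included in (b3). If $\mathcal L_2(W)$ is nonempty, it is equal to $\alpha+I$ with $I=cV$ for some $\alpha,c\in K$ with $v(c)=w(X-\alpha)$. A fractional ideal $I$ is divisorial if it equals the intersection of all principal fractional ideals containing it.
   Formalization: V is assumed not to be a field: for V = K algebraically closed the 1/X-adic ring is an extension that is no V_E. The sequences E asserted to exist are indexed by well-ordered subsets of K, which loses nothing, as a pseudo-monotone E is essentially injective or constant. *)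

theory Defs
  imports
    "HOL-Analysis.Analysis"
    "HOL-Computational_Algebra.Polynomial_Factorial"
begin

section \<open>Valuation domains and their valuations\<close>

text \<open>
  The quotient field is the whole type; a valuation domain with this quotient field is a subring
  containing \<open>x\<close> or \<open>1/x\<close> for every \<open>x\<close>.
\<close>

definition valuation_domain :: "'f::field set \<Rightarrow> bool" where
  "valuation_domain A \<longleftrightarrow>
     1 \<in> A \<and> (\<forall>x\<in>A. \<forall>y\<in>A. x - y \<in> A \<and> x * y \<in> A) \<and>
     (\<forall>x. x \<noteq> 0 \<longrightarrow> x \<in> A \<or> inverse x \<in> A)"

definition units :: "'f::field set \<Rightarrow> 'f set" where
  "units A = {x \<in> A. x \<noteq> 0 \<and> inverse x \<in> A}"

definition max_ideal :: "'f::field set \<Rightarrow> 'f set" where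
  "max_ideal A = A - units A"

text \<open>
  The valuation of \<open>A\<close> is the canonical map onto the value group, i.e. the group of
  nonzero field elements modulo the units of \<open>A\<close>. The class \<open>val A 0 = {0}\<close> plays
  the role of \<open>\<infinity>\<close>.
\<close>

definition val :: "'f::field set \<Rightarrow> 'f \<Rightarrow> 'f set" where
  "val A x = (\<lambda>u. u * x) ` units A"

definition val_le :: "'f::field set \<Rightarrow> 'f set \<Rightarrow> 'f set \<Rightarrow> bool" where
  "val_le A g h \<longleftrightarrow> (\<exists>x\<in>g. \<exists>y\<in>h. \<exists>a\<in>A. y = a * x)"

definition val_less :: "'f::field set \<Rightarrow> 'f set \<Rightarrow> 'f set \<Rightarrow> bool" where
  "val_less A g h \<longleftrightarrow> val_le A g h \<and> \<not> val_le A h g"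

definition value_group :: "'f::field set \<Rightarrow> 'f set set" where
  "value_group A = val A ` (- {0})"

definition residue :: "'f::field set \<Rightarrow> 'f \<Rightarrow> 'f set" where
  "residue A x = {y. y - x \<in> max_ideal A}"

definition residue_field :: "'f::field set \<Rightarrow> 'f set set" where
  "residue_field A = residue A ` A"

lemma val_le_iff:
  assumes "valuation_domain A"
  shows "val_le A (val A x) (val A y) \<longleftrightarrow> (\<exists>a\<in>A. y = a * x)"
proof
  assume "val_le A (val A x) (val A y)"
  then obtain u w a where u: "u \<in> units A" and w: "w \<in> units A" and a: "a \<in> A"
    and eq: "w * y = a * (u * x)"
    unfolding val_le_def val_def by blast
  have "inverse w * a * u \<in> A"
    using u w a assms unfolding valuation_domain_def units_def by blast
  moreover have "y = (inverse w * a * u) * x"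
    using w eq unfolding units_def by (simp add: field_simps)
  ultimately show "\<exists>a\<in>A. y = a * x" by blast
next
  assume "\<exists>a\<in>A. y = a * x"
  moreover have "1 \<in> units A"
    using assms unfolding valuation_domain_def units_def by simp
  then have "x \<in> val A x" "y \<in> val A y"
    unfolding val_def by force+
  ultimately show "val_le A (val A x) (val A y)"
    unfolding val_le_def by blast
qed


section \<open>Topology and completion\<close>

definition valuation_topology :: "'f::field set \<Rightarrow> 'f topology" where
  "valuation_topology A =
     topology_generated_by {{y. val_less A (val A c) (val A (y - x))} | x c. c \<noteq> 0}"

definition cauchy_filter_val :: "'f::field set \<Rightarrow> 'f filter \<Rightarrow> bool" where
  "cauchy_filter_val A F \<longleftrightarrow> F \<noteq> bot \<and>
     (\<forall>c. c \<noteq> 0 \<longrightarrow>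
        (\<exists>P. eventually P F \<and> (\<forall>x y. P x \<and> P y \<longrightarrow> val_less A (val A c) (val A (x - y)))))"

definition complete_val :: "'f::field set \<Rightarrow> bool" where
  "complete_val A \<longleftrightarrow>
     (\<forall>F. cauchy_filter_val A F \<longrightarrow> (\<exists>l. limitin (valuation_topology A) (\<lambda>x. x) l F))"

text \<open>
  The completion of \<open>(K, V)\<close> is the complete valued field \<open>(Kh, Vh)\<close>, unique up to a unique
  isomorphism over \<open>K\<close>, which contains \<open>(K, V)\<close> (via \<open>\<iota>\<close>) as a dense valued subfield.
\<close>

definition is_completion ::
    "'a::field set \<Rightarrow> 'b::field set \<Rightarrow> ('a \<Rightarrow> 'b) \<Rightarrow> bool" where
  "is_completion V Vh \<iota> \<longleftrightarrow>
     valuation_domain Vh \<and>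
     \<iota> 1 = 1 \<and> (\<forall>x y. \<iota> (x + y) = \<iota> x + \<iota> y \<and> \<iota> (x * y) = \<iota> x * \<iota> y) \<and>
     \<iota> -` Vh = V \<and>
     valuation_topology Vh closure_of range \<iota> = UNIV \<and>
     complete_val Vh"


section \<open>Extensions to the field of rational functions\<close>

definition rconst :: "'a::field \<Rightarrow> 'a poly fract" where
  "rconst c = to_fract [:c:]"

definition rX :: "'a::field poly fract" where
  "rX = to_fract [:0, 1:]"

text \<open>
  \<open>ratfun_value \<phi> x y\<close>: the rational function \<open>\<phi>\<close> has no pole at \<open>x\<close> and takes the value \<open>y\<close> there.
\<close>

definition ratfun_value :: "'a::field poly fract \<Rightarrow> 'a \<Rightarrow> 'a \<Rightarrow> bool" where
  "ratfun_value \<phi> x y \<longleftrightarrow>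
     (\<exists>p q. \<phi> = Fract p q \<and> poly q x \<noteq> 0 \<and> y = poly p x / poly q x)"

definition is_extension :: "'a::field set \<Rightarrow> 'a poly fract set \<Rightarrow> bool" where
  "is_extension V W \<longleftrightarrow> valuation_domain W \<and> rconst -` W = V"

text \<open>
  The valuation of \<open>K\<close> is identified with the restriction to \<open>K\<close> of the valuation \<open>val W\<close> of
  \<open>K(X)\<close>, and likewise the residue field of \<open>V\<close> with its image in that of \<open>W\<close>.
\<close>

definition base_value_group :: "'a::field poly fract set \<Rightarrow> 'a poly fract set set" where
  "base_value_group W = (\<lambda>c. val W (rconst c)) ` (- {0})"

definition base_residue_field ::
    "'a::field set \<Rightarrow> 'a poly fract set \<Rightarrow> 'a poly fract set set" where
  "base_residue_field V W = (\<lambda>c. residue W (rconst c)) ` V"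

definition immediate :: "'a::field set \<Rightarrow> 'a poly fract set \<Rightarrow> bool" where
  "immediate V W \<longleftrightarrow>
     value_group W = base_value_group W \<and> residue_field W = base_residue_field V W"

definition L1 :: "'a::field poly fract set \<Rightarrow> 'a set" where
  "L1 W = {\<alpha>. val W (rX - rconst \<alpha>) \<notin> base_value_group W}"

definition L2 :: "'a::field poly fract set \<Rightarrow> 'a set" where
  "L2 W = {\<alpha>. val W (rX - rconst \<alpha>) \<in> base_value_group W \<and>
     (\<forall>c. val W (rconst c) = val W (rX - rconst \<alpha>) \<longrightarrow>
        val W (rX - rconst \<alpha> + rconst c) = val W (rX - rconst \<alpha>))}"

definition LL :: "'a::field poly fract set \<Rightarrow> 'a set" where
  "LL W = L1 W \<union> L2 W"


section \<open>Fractional ideals\<close>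

definition fractional_ideal :: "'a::field set \<Rightarrow> 'a set \<Rightarrow> bool" where
  "fractional_ideal V I \<longleftrightarrow>
     0 \<in> I \<and> (\<forall>x\<in>I. \<forall>y\<in>I. x + y \<in> I) \<and> (\<forall>a\<in>V. \<forall>x\<in>I. a * x \<in> I) \<and>
     (\<exists>d\<in>V - {0}. \<forall>x\<in>I. d * x \<in> V)"

text \<open>
  The zero ideal counts as a (principal) fractional ideal: \<open>L1 W\<close> can be a single point.
\<close>

definition principal_fractional_ideal :: "'a::field set \<Rightarrow> 'a set \<Rightarrow> bool" where
  "principal_fractional_ideal V I \<longleftrightarrow> (\<exists>c. I = (\<lambda>a. c * a) ` V)"

definition divisorial :: "'a::field set \<Rightarrow> 'a set \<Rightarrow> bool" where
  "divisorial V I \<longleftrightarrow> I = \<Inter> {J. principal_fractional_ideal V J \<and> I \<subseteq> J}"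


section \<open>Pseudo-monotone sequences\<close>

text \<open>
  A sequence is given by a well-order \<open>r\<close> on an index set \<open>Field r\<close> and a function \<open>s\<close>,
  of which only the values on \<open>Field r\<close> matter.
\<close>

definition index_order :: "'i rel \<Rightarrow> bool" where
  "index_order r \<longleftrightarrow> Well_order r \<and> Field r \<noteq> {} \<and> (\<forall>i\<in>Field r. \<exists>j. (i, j) \<in> r - Id)"

definition tails :: "'i rel \<Rightarrow> 'i filter" where
  "tails r = (INF i\<in>Field r. principal {j. (i, j) \<in> r})"

lemma eventually_tails:
  assumes "index_order r"
  shows "eventually P (tails r) \<longleftrightarrow> (\<exists>i\<in>Field r. \<forall>j. (i, j) \<in> r \<longrightarrow> P j)"
proof -
  have wo: "Well_order r" using assms by (simp add: index_order_def)
  have "\<exists>x\<in>Field r. principal {j. (x, j) \<in> r}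
          \<le> inf (principal {j. (a, j) \<in> r}) (principal {j. (b, j) \<in> r})"
    if "a \<in> Field r" "b \<in> Field r" for a b
  proof -
    have tr: "trans r" and rf: "\<And>c. c \<in> Field r \<Longrightarrow> (c, c) \<in> r"
      and tot: "\<And>c d. c \<in> Field r \<Longrightarrow> d \<in> Field r \<Longrightarrow> c \<noteq> d \<Longrightarrow> (c, d) \<in> r \<or> (d, c) \<in> r"
      using wo by (auto simp: order_on_defs refl_on_def total_on_def)
    have "(a, b) \<in> r \<or> (b, a) \<in> r" using tot rf that by blast
    then show ?thesis
      using that tr by (auto simp: trans_def inf_principal)
  qed
  then show ?thesis
    unfolding tails_def
    using assms by (subst eventually_INF_base) (auto simp: eventually_principal index_order_def)
qed

definition pseudo_convergent :: "'a::field set \<Rightarrow> 'i rel \<Rightarrow> ('i \<Rightarrow> 'a) \<Rightarrow> bool" where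
  "pseudo_convergent V r s \<longleftrightarrow> index_order r \<and>
     (\<forall>i j k. (i, j) \<in> r - Id \<and> (j, k) \<in> r - Id \<longrightarrow>
        val_less V (val V (s j - s i)) (val V (s k - s j)))"

definition pseudo_divergent :: "'a::field set \<Rightarrow> 'i rel \<Rightarrow> ('i \<Rightarrow> 'a) \<Rightarrow> bool" where
  "pseudo_divergent V r s \<longleftrightarrow> index_order r \<and>
     (\<forall>i j k. (i, j) \<in> r - Id \<and> (j, k) \<in> r - Id \<longrightarrow>
        val_less V (val V (s k - s j)) (val V (s j - s i)))"

text \<open>
  As the condition is stated, a constant sequence (all differences of value \<open>\<infinity>\<close>) is
  pseudo-stationary.
\<close>

definition pseudo_stationary :: "'a::field set \<Rightarrow> 'i rel \<Rightarrow> ('i \<Rightarrow> 'a) \<Rightarrow> bool" where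
  "pseudo_stationary V r s \<longleftrightarrow> index_order r \<and>
     (\<forall>i\<in>Field r. \<forall>j\<in>Field r. \<forall>i'\<in>Field r. \<forall>j'\<in>Field r. i \<noteq> j \<and> i' \<noteq> j' \<longrightarrow>
        val V (s i - s j) = val V (s i' - s j'))"

definition pseudo_monotone :: "'a::field set \<Rightarrow> 'i rel \<Rightarrow> ('i \<Rightarrow> 'a) \<Rightarrow> bool" where
  "pseudo_monotone V r s \<longleftrightarrow>
     pseudo_convergent V r s \<or> pseudo_divergent V r s \<or> pseudo_stationary V r s"

definition VE :: "'a::field set \<Rightarrow> 'i rel \<Rightarrow> ('i \<Rightarrow> 'a) \<Rightarrow> 'a poly fract set" where
  "VE V r s = {\<phi>. eventually (\<lambda>i. \<exists>y\<in>V. ratfun_value \<phi> (s i) y) (tails r)}"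

definition transcendental_type :: "'a::field set \<Rightarrow> 'i rel \<Rightarrow> ('i \<Rightarrow> 'a) \<Rightarrow> bool" where
  "transcendental_type V r s \<longleftrightarrow>
     (\<forall>f. \<exists>g. eventually (\<lambda>i. val V (poly f (s i)) = g) (tails r))"

definition algebraic_type :: "'a::field set \<Rightarrow> 'i rel \<Rightarrow> ('i \<Rightarrow> 'a) \<Rightarrow> bool" where
  "algebraic_type V r s \<longleftrightarrow>
     (\<exists>f. \<exists>i0\<in>Field r. \<forall>i j. (i0, i) \<in> r \<and> (i, j) \<in> r - Id \<longrightarrow>
        val_less V (val V (poly f (s i))) (val V (poly f (s j))))"

definition cauchy_seq_val :: "'a::field set \<Rightarrow> 'i rel \<Rightarrow> ('i \<Rightarrow> 'a) \<Rightarrow> bool" where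
  "cauchy_seq_val V r s \<longleftrightarrow> cauchy_filter_val V (filtermap s (tails r))"

end

theory Submission
  imports "HOL-Algebra.Algebraic_Closure_Type" Defs
begin

text \<open>
  Algebraic closedness of the completion is equivalent to a property of \<open>K\<close> itself: every
  nonconstant polynomial over \<open>K\<close> takes arbitrarily small values on \<open>K\<close>
  (\<open>small_values\<close>). If this fails for some \<open>f\<close>, Chevalley's theorem gives an extension \<open>W\<close> in
  which all constant multiples of \<open>f\<close> lie in the maximal ideal, and such a \<open>W\<close> is defined by no
  sequence in \<open>K\<close>. Conversely, dividing \<open>f\<close> by \<open>X - x\<close> at a point \<open>x\<close> where \<open>f\<close> is small replaces
  \<open>f\<close>, up to a small error, by a product of linear polynomials. So an extension is determined by
  its values on the polynomials \<open>X - x\<close>, and a sequence which is cofinal for these values defines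
  it.
\<close>

section \<open>Absolute values of a valuation domain\<close>

text \<open>The kind of the sequence reflects how well constants approximate X. A point
  \<open>\<alpha>\<close> of L(W) is a best approximation: either the value of X -
  \<open>\<alpha>\<close> is new (L1), or it is the value of some c and (X -
  \<open>\<alpha>\<close>)/c has a new residue (L2). In L1, X - \<open>\<alpha>\<close> makes a cut
  among the absolute values of K. Filling the cut from above gives pseudo-convergent sequences,
  filling it from below pseudo-divergent ones. A side can be used if it has no end point, and this
  is what the conditions on the ideal I express. In L2, points in infinitely many residue classes at
  distance |c| do the work. If L(W) is empty, better and better approximations of X form the
  sequence; a non-immediate W then has a nonzero polynomial smaller than all nonzero constants, and
  this polynomial vanishes at the limit in the completion.

  The obstacle in comparing W with V_E is that such tiny polynomials are controlled only by upper
  bounds, so two of them cannot be compared. Fractions p/q are therefore carried with a Bezout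
  identity, which forbids p and q to be tiny together.\<close>

text \<open>
  The valuation is written multiplicatively: the absolute value \<open>nrm A x\<close> is the principal
  fractional ideal of \<open>x\<close>, and absolute values are compared by inclusion, so that a large
  value \<open>v x\<close> is a small absolute value.
\<close>

datatype 'f absval = Absval (ideal: "'f set")

instantiation absval :: (type) order
begin

definition less_eq_absval :: "'a absval \<Rightarrow> 'a absval \<Rightarrow> bool" where
  "g \<le> h \<longleftrightarrow> ideal g \<subseteq> ideal h"

definition less_absval :: "'a absval \<Rightarrow> 'a absval \<Rightarrow> bool" where
  "g < h \<longleftrightarrow> ideal g \<subset> ideal h"

instance
  by standard (auto simp: less_eq_absval_def less_absval_def absval.expand)

end

definition nrm :: "'f::field set \<Rightarrow> 'f \<Rightarrow> 'f absval" where
  "nrm A x = Absval ((\<lambda>a. a * x) ` A)"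

locale val_dom =
  fixes A :: "'f::field set"
  assumes valuation_domain: "valuation_domain A"
begin

abbreviation n :: "'f \<Rightarrow> 'f absval" where "n \<equiv> nrm A"

lemma one_mem: "1 \<in> A" and diff_mem: "x \<in> A \<Longrightarrow> y \<in> A \<Longrightarrow> x - y \<in> A"
  and mult_mem: "x \<in> A \<Longrightarrow> y \<in> A \<Longrightarrow> x * y \<in> A"
  and mem_or_inverse_mem: "x \<noteq> 0 \<Longrightarrow> x \<in> A \<or> inverse x \<in> A"
  using valuation_domain by (auto simp: valuation_domain_def)

lemma zero_mem: "0 \<in> A"
  using diff_mem[OF one_mem one_mem] by simp

lemma uminus_mem: "x \<in> A \<Longrightarrow> - x \<in> A"
  using diff_mem[OF zero_mem, of x] by simp

lemma add_mem: "x \<in> A \<Longrightarrow> y \<in> A \<Longrightarrow> x + y \<in> A"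
  using diff_mem[of x "- y"] uminus_mem[of y] by simp

lemma nrm_le_iff: "n x \<le> n y \<longleftrightarrow> (\<exists>a\<in>A. x = a * y)"
proof
  assume "n x \<le> n y"
  moreover have "x \<in> ideal (n x)" using one_mem by (force simp: nrm_def)
  ultimately show "\<exists>a\<in>A. x = a * y" by (auto simp: nrm_def less_eq_absval_def)
next
  assume "\<exists>a\<in>A. x = a * y"
  then obtain a where "a \<in> A" "x = a * y" by blast
  then show "n x \<le> n y"
    by (auto simp: nrm_def less_eq_absval_def mult.assoc[symmetric] mult_mem)
qed

lemma nrm_le_iff_divide: "y \<noteq> 0 \<Longrightarrow> n x \<le> n y \<longleftrightarrow> x / y \<in> A"
  unfolding nrm_le_iff by (auto intro!: bexI[of _ "x / y"])

lemma nrm_le_one_iff: "n x \<le> n 1 \<longleftrightarrow> x \<in> A"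
  by (simp add: nrm_le_iff_divide)

lemma nrm_zero_le [simp]: "n 0 \<le> n x"
  unfolding nrm_le_iff using zero_mem by (intro bexI[of _ 0]) auto

lemma nrm_le_zero_iff [simp]: "n x \<le> n 0 \<longleftrightarrow> x = 0"
  unfolding nrm_le_iff using zero_mem by auto

lemma nrm_eq_zero_iff [simp]: "n x = n 0 \<longleftrightarrow> x = 0"
  using nrm_le_zero_iff[of x] nrm_zero_le[of x] order_eq_iff by blast

lemma nrm_zero_less_iff [simp]: "n 0 < n x \<longleftrightarrow> x \<noteq> 0"
  by (simp add: less_le_not_le)

lemma not_nrm_less_zero [simp]: "\<not> n x < n 0"
  by (simp add: less_le_not_le)

lemma nrm_linear: "n x \<le> n y \<or> n y \<le> n x"
proof (cases "x = 0 \<or> y = 0")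
  case False
  then have "x / y \<in> A \<or> inverse (x / y) \<in> A" by (intro mem_or_inverse_mem) auto
  then show ?thesis using False by (auto simp: nrm_le_iff_divide)
qed auto

lemma nrm_not_le: "\<not> n x \<le> n y \<longleftrightarrow> n y < n x"
  using nrm_linear[of x y] by (metis less_le_not_le)

lemma nrm_not_less: "\<not> n x < n y \<longleftrightarrow> n y \<le> n x"
  using nrm_not_le by blast

lemma nrm_mult_mono: "n x \<le> n y \<Longrightarrow> n x' \<le> n y' \<Longrightarrow> n (x * x') \<le> n (y * y')"
proof -
  assume "n x \<le> n y" "n x' \<le> n y'"
  then obtain a b where "a \<in> A" "b \<in> A" "x = a * y" "x' = b * y'" by (auto simp: nrm_le_iff)
  then show ?thesis
    unfolding nrm_le_iff by (intro bexI[of _ "a * b"]) (auto simp: mult_mem)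
qed

lemma nrm_mult_le_cancel: "z \<noteq> 0 \<Longrightarrow> n (x * z) \<le> n (y * z) \<longleftrightarrow> n x \<le> n y"
  unfolding nrm_le_iff by (auto simp: mult.assoc[symmetric])

lemma nrm_mult_less_cancel: "z \<noteq> 0 \<Longrightarrow> n (x * z) < n (y * z) \<longleftrightarrow> n x < n y"
  by (simp flip: nrm_not_le add: nrm_mult_le_cancel)

lemma nrm_mult_cong: "n x = n y \<Longrightarrow> n x' = n y' \<Longrightarrow> n (x * x') = n (y * y')"
  by (simp add: antisym nrm_mult_mono)

lemma nrm_mult_strict_mono: "n x < n y \<Longrightarrow> n x' \<le> n y' \<Longrightarrow> y' \<noteq> 0 \<Longrightarrow> n (x * x') < n (y * y')"
proof -
  assume *: "n x < n y" "n x' \<le> n y'" "y' \<noteq> 0"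
  have "n (x * x') \<le> n (x * y')" using * by (intro nrm_mult_mono) auto
  also have "\<dots> < n (y * y')" using * by (simp add: nrm_mult_less_cancel)
  finally show ?thesis .
qed

lemma nrm_mult_strict_mono': "n x \<le> n y \<Longrightarrow> n x' < n y' \<Longrightarrow> y \<noteq> 0 \<Longrightarrow> n (x * x') < n (y * y')"
  using nrm_mult_strict_mono[of x' y' x y] by (simp add: mult.commute)

lemma nrm_power_mono: "n x \<le> n y \<Longrightarrow> n (x ^ k) \<le> n (y ^ k)"
  by (induction k) (auto intro: nrm_mult_mono)

lemma nrm_power_strict_mono: "n x < n y \<Longrightarrow> k > 0 \<Longrightarrow> n (x ^ k) < n (y ^ k)"
proof (induction k)
  case (Suc k)
  have "y \<noteq> 0" using Suc.prems(1) by auto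
  then show ?case
    using nrm_mult_strict_mono[OF Suc.prems(1) nrm_power_mono[OF less_imp_le[OF Suc.prems(1)]]]
    by simp
qed auto

lemma nrm_power_le_iff: "k > 0 \<Longrightarrow> n (x ^ k) \<le> n (y ^ k) \<longleftrightarrow> n x \<le> n y"
  using nrm_power_mono nrm_power_strict_mono by (metis nrm_not_le)

lemma nrm_power_eq_iff: "k > 0 \<Longrightarrow> n (x ^ k) = n (y ^ k) \<longleftrightarrow> n x = n y"
  using nrm_power_le_iff by (metis order_eq_iff)

lemma nrm_uminus [simp]: "n (- x) = n x"
proof -
  have "n (- y) \<le> n y" for y
    unfolding nrm_le_iff using uminus_mem[OF one_mem] by (intro bexI[of _ "- 1"]) auto
  from this[of x] this[of "- x"] show ?thesis by simp
qed

lemma nrm_minus_commute: "n (x - y) = n (y - x)"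
  using nrm_uminus[of "x - y"] by simp

lemma nrm_add_le: "n x \<le> n z \<Longrightarrow> n y \<le> n z \<Longrightarrow> n (x + y) \<le> n z"
proof -
  assume "n x \<le> n z" "n y \<le> n z"
  then obtain a b where "a \<in> A" "b \<in> A" "x = a * z" "y = b * z" by (auto simp: nrm_le_iff)
  then show ?thesis
    unfolding nrm_le_iff by (intro bexI[of _ "a + b"]) (auto simp: add_mem distrib_right)
qed

lemma nrm_diff_le: "n x \<le> n z \<Longrightarrow> n y \<le> n z \<Longrightarrow> n (x - y) \<le> n z"
  using nrm_add_le[of x z "- y"] by simp

lemma nrm_add_less: "n x < n z \<Longrightarrow> n y < n z \<Longrightarrow> n (x + y) < n z"
  using nrm_linear[of x y] nrm_add_le[of x y y] nrm_add_le[of x x y] by force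

lemma nrm_diff_less: "n x < n z \<Longrightarrow> n y < n z \<Longrightarrow> n (x - y) < n z"
  using nrm_add_less[of x z "- y"] by simp

lemma nrm_add_eq_left: "n y < n x \<Longrightarrow> n (x + y) = n x"
proof (rule antisym)
  assume *: "n y < n x"
  then show "n (x + y) \<le> n x" by (simp add: nrm_add_le less_imp_le)
  show "n x \<le> n (x + y)"
    using nrm_diff_less[of "x + y" x y] * by (auto simp flip: nrm_not_less)
qed

lemma nrm_add_eq_right: "n x < n y \<Longrightarrow> n (x + y) = n y"
  using nrm_add_eq_left[of x y] by (simp add: add.commute)

lemma nrm_diff_eq_left: "n y < n x \<Longrightarrow> n (x - y) = n x"
  using nrm_add_eq_left[of "- y" x] by simp

lemma nrm_diff_eq_right: "n x < n y \<Longrightarrow> n (x - y) = n y"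
  using nrm_add_eq_right[of x "- y"] by simp

lemma units_iff: "u \<in> units A \<longleftrightarrow> n u = n 1"
proof -
  have "inverse u \<in> A \<longleftrightarrow> n 1 \<le> n u" if "u \<noteq> 0"
    using nrm_le_iff_divide[OF that, of 1] by (simp add: inverse_eq_divide)
  then show ?thesis
    unfolding units_def using zero_mem
    by (cases "u = 0") (auto simp: nrm_le_one_iff order_eq_iff)
qed

lemma max_ideal_iff: "x \<in> max_ideal A \<longleftrightarrow> n x < n 1"
  unfolding max_ideal_def using units_iff[of x] nrm_le_one_iff[of x] by (auto simp: order_less_le)

lemma nrm_eq_iff: "n x = n y \<longleftrightarrow> (\<exists>u\<in>units A. x = u * y)"
proof
  assume eq: "n x = n y"
  show "\<exists>u\<in>units A. x = u * y"
  proof (cases "y = 0")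
    case True
    then show ?thesis using eq by (auto simp: units_iff)
  next
    case False
    then have "n (x / y * y) = n (1 * y)" using eq by simp
    then have "n (x / y) = n 1"
      using nrm_mult_le_cancel[OF False] by (metis order_eq_iff)
    then show ?thesis using False by (intro bexI[of _ "x / y"]) (auto simp: units_iff)
  qed
next
  assume "\<exists>u\<in>units A. x = u * y"
  then obtain u where "n u = n 1" "x = u * y" by (auto simp: units_iff)
  then show "n x = n y" using nrm_mult_cong[of u 1 y y] by simp
qed

lemma val_eq_iff: "val A x = val A y \<longleftrightarrow> n x = n y"
proof -
  have 1: "1 \<in> units A" by (simp add: units_iff)
  have mult: "u * w \<in> units A" if "u \<in> units A" "w \<in> units A" for u w
    using that nrm_mult_cong[of u 1 w 1] by (simp add: units_iff)
  have sub: "val A x \<subseteq> val A y" if "n x = n y" for x y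
  proof -
    from that obtain u where u: "u \<in> units A" "x = u * y" by (auto simp: nrm_eq_iff)
    have "w * x \<in> val A y" if "w \<in> units A" for w
      unfolding val_def u(2) mult.assoc[symmetric] using mult[OF that u(1)] by blast
    then show ?thesis by (auto simp: val_def)
  qed
  have "x \<in> val A x" using 1 by (force simp: val_def)
  then have "n x = n y" if "val A x = val A y"
    using that unfolding nrm_eq_iff by (auto simp: val_def)
  then show ?thesis using sub[of x y] sub[of y x] by auto
qed

lemma val_le_iff_nrm: "val_le A (val A x) (val A y) \<longleftrightarrow> n y \<le> n x"
  by (simp add: val_le_iff[OF valuation_domain] nrm_le_iff)

lemma val_less_iff_nrm: "val_less A (val A x) (val A y) \<longleftrightarrow> n y < n x"
  by (auto simp: val_less_def val_le_iff_nrm)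

lemma exists_nrm_upper: "\<exists>B. B \<noteq> 0 \<and> n x \<le> n B \<and> n y \<le> n B \<and> n 1 \<le> n B"
proof -
  have *: "\<exists>B. B \<noteq> 0 \<and> n x \<le> n B \<and> n 1 \<le> n B" for x
    using nrm_linear[of x 1] by (metis nrm_le_zero_iff order_refl zero_neq_one)
  obtain B C where "B \<noteq> 0" "n x \<le> n B" "n 1 \<le> n B" "C \<noteq> 0" "n y \<le> n C" "n 1 \<le> n C"
    using *[of x] *[of y] by blast
  then show ?thesis
    using nrm_linear[of B C] by (metis order_trans)
qed

lemma exists_nrm_lower: "c \<noteq> 0 \<Longrightarrow> d \<noteq> 0 \<Longrightarrow> \<exists>e. e \<noteq> 0 \<and> n e \<le> n c \<and> n e \<le> n d"
  using nrm_linear[of c d] by auto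

text \<open>Nontriviality of the valuation enters here and in the next lemma: an x outside A has |x|
  > 1, and c / x is then smaller than c.\<close>

lemma exists_nrm_less:
  assumes "A \<noteq> UNIV" "c \<noteq> 0"
  shows "\<exists>e. e \<noteq> 0 \<and> n e < n c"
proof -
  obtain x where x: "x \<notin> A" using assms(1) by blast
  then have "x \<noteq> 0" "n 1 < n x" using zero_mem nrm_le_one_iff[of x] nrm_not_le by auto
  then have "n (1 * (c / x)) < n (x * (c / x))"
    using assms(2) by (subst nrm_mult_less_cancel) auto
  then show ?thesis using \<open>x \<noteq> 0\<close> assms(2) by (intro exI[of _ "c / x"]) auto
qed

lemma exists_nrm_greater:
  assumes "A \<noteq> UNIV"
  shows "\<exists>e. e \<noteq> 0 \<and> n c < n e"
proof (cases "c = 0")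
  case False
  obtain x where x: "x \<notin> A" using assms(1) by blast
  then have "x \<noteq> 0" "n 1 < n x" using zero_mem nrm_le_one_iff[of x] nrm_not_le by auto
  then have "n (1 * c) < n (x * c)"
    using False by (subst nrm_mult_less_cancel) auto
  then show ?thesis using \<open>x \<noteq> 0\<close> False by (intro exI[of _ "x * c"]) auto
qed (intro exI[of _ 1], auto)

lemma poly_bounded: "\<exists>B. B \<noteq> 0 \<and> (\<forall>x. n x \<le> n R \<longrightarrow> n (poly p x) \<le> n B)"
proof (induction p)
  case (pCons a p)
  then obtain B where B: "B \<noteq> 0" "\<And>x. n x \<le> n R \<Longrightarrow> n (poly p x) \<le> n B" by blast
  obtain C where C: "C \<noteq> 0" "n a \<le> n C" "n (R * B) \<le> n C"
    using exists_nrm_upper by blast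
  have "n (poly (pCons a p) x) \<le> n C" if "n x \<le> n R" for x
    using nrm_mult_mono[OF that B(2)[OF that]] C by (auto intro!: nrm_add_le intro: order_trans)
  then show ?case using C(1) by blast
qed (auto intro: exI[of _ 1])

text \<open>X - l divides p - p(l), and the cofactor is bounded by some B on a ball about 0. Its
  radius R dominates l and 1, so the ball contains every x at distance at most 1 from l; then d
  below both 1 and e / B works.\<close>

lemma poly_continuous:
  assumes "e \<noteq> 0"
  shows "\<exists>d. d \<noteq> 0 \<and> (\<forall>x. n (x - l) \<le> n d \<longrightarrow> n (poly p x - poly p l) \<le> n e)"
proof -
  define q where "q = p - [:poly p l:]"
  have "poly q l = 0" by (simp add: q_def)
  then obtain g where g: "q = [:- l, 1:] * g" using poly_eq_0_iff_dvd by (metis dvdE)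
  have eq: "poly p x - poly p l = (x - l) * poly g x" for x
    using arg_cong[OF g, of "\<lambda>q. poly q x"] by (simp add: q_def algebra_simps)
  obtain R where R: "R \<noteq> 0" "n l \<le> n R" "n 1 \<le> n R" using exists_nrm_upper by blast
  obtain B where B: "B \<noteq> 0" "\<And>x. n x \<le> n R \<Longrightarrow> n (poly g x) \<le> n B"
    using poly_bounded by blast
  obtain d where d: "d \<noteq> 0" "n d \<le> n (e / B)" "n d \<le> n 1"
    using exists_nrm_lower[of "e / B" 1] assms B(1) by auto
  have "n (poly p x - poly p l) \<le> n e" if x: "n (x - l) \<le> n d" for x
  proof -
    have "n (x - l + l) \<le> n R" using x d R by (intro nrm_add_le) (auto intro: order_trans)
    then have "n ((x - l) * poly g x) \<le> n (e / B * B)"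
      using x d B by (intro nrm_mult_mono) (auto intro: order_trans)
    then show ?thesis using B(1) eq by simp
  qed
  then show ?thesis using d(1) by blast
qed

end


section \<open>Chevalley's extension theorem\<close>

definition coeffs_in :: "'f::comm_ring_1 set \<Rightarrow> 'f poly set" where
  "coeffs_in N = {p. \<forall>i. coeff p i \<in> N}"

text \<open>Rings without a required unit. In the proof of Chevalley's theorem only the future
  maximal ideal is enlarged, and these sets are the candidates for it.\<close>

definition mult_add_closed :: "'f::comm_ring_1 set \<Rightarrow> bool" where
  "mult_add_closed N \<longleftrightarrow> 0 \<in> N \<and> (\<forall>x\<in>N. \<forall>y\<in>N. x - y \<in> N \<and> x * y \<in> N)"

lemma mult_add_closedD:
  assumes "mult_add_closed N"
  shows "0 \<in> N" "x \<in> N \<Longrightarrow> y \<in> N \<Longrightarrow> x - y \<in> N" "x \<in> N \<Longrightarrow> y \<in> N \<Longrightarrow> x * y \<in> N"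
    "x \<in> N \<Longrightarrow> - x \<in> N" "x \<in> N \<Longrightarrow> y \<in> N \<Longrightarrow> x + y \<in> N"
proof -
  show 1: "0 \<in> N" "x \<in> N \<Longrightarrow> y \<in> N \<Longrightarrow> x - y \<in> N" "x \<in> N \<Longrightarrow> y \<in> N \<Longrightarrow> x * y \<in> N" for x y
    using assms by (auto simp: mult_add_closed_def)
  show 2: "x \<in> N \<Longrightarrow> - x \<in> N" for x using 1(1) 1(2)[of 0 x] by simp
  show "x \<in> N \<Longrightarrow> y \<in> N \<Longrightarrow> x + y \<in> N" using 1(2)[of x "- y"] 2[of y] by simp
qed

lemma sum_mem_mult_add_closed:
  "mult_add_closed N \<Longrightarrow> (\<And>i. i \<in> S \<Longrightarrow> f i \<in> N) \<Longrightarrow> sum f S \<in> N"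
  by (induction S rule: infinite_finite_induct) (auto simp: mult_add_closedD)

lemma coeffs_in_closed:
  assumes "mult_add_closed N"
  shows "0 \<in> coeffs_in N" "p \<in> coeffs_in N \<Longrightarrow> q \<in> coeffs_in N \<Longrightarrow> p - q \<in> coeffs_in N"
    "p \<in> coeffs_in N \<Longrightarrow> q \<in> coeffs_in N \<Longrightarrow> p * q \<in> coeffs_in N"
    "p \<in> coeffs_in N \<Longrightarrow> q \<in> coeffs_in N \<Longrightarrow> p + q \<in> coeffs_in N"
    "a \<in> N \<Longrightarrow> p \<in> coeffs_in N \<Longrightarrow> smult a p \<in> coeffs_in N"
  using assms
  by (auto simp: coeffs_in_def mult_add_closedD coeff_mult intro!: sum_mem_mult_add_closed)

lemma monom_coeffs_in: "mult_add_closed N \<Longrightarrow> a \<in> N \<Longrightarrow> monom a k \<in> coeffs_in N"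
  by (auto simp: coeffs_in_def mult_add_closedD)

text \<open>
  If \<open>1 = p(x) = q(1/x)\<close> with \<open>deg q \<le> deg p = k\<close>, then multiplying the second equation by \<open>x\<^sup>k\<close>
  expresses \<open>(1 - q\<^sub>0) x\<^sup>k\<close> by lower powers of \<open>x\<close>, which lowers the degree of \<open>(1 - q\<^sub>0) p\<close>.
\<close>

lemma one_in_coeffs_reduce:
  fixes x :: "'f::field"
  assumes N: "mult_add_closed N" "1 \<notin> N" and x: "x \<noteq> 0"
    and p: "p \<in> coeffs_in N" "poly p x = 1"
    and q: "q \<in> coeffs_in N" "poly q (inverse x) = 1" and le: "degree q \<le> degree p"
  shows "\<exists>p'\<in>coeffs_in N. poly p' x = 1 \<and> degree p' < degree p"
proof -
  define k where "k = degree p"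
  define Q where "Q = (\<Sum>j=1..degree q. monom (coeff q j) (k - j))"
  have k: "k > 0"
  proof (rule ccontr)
    assume "\<not> k > 0"
    then obtain a where "p = [:a:]" unfolding k_def by (meson degree_eq_zeroE gr0I)
    then show False using p N(2) by (auto simp: coeffs_in_def dest: spec[of _ 0])
  qed
  define p1 where "p1 = p - monom (coeff p k) k"
  have deg1: "degree p1 < k"
    unfolding p1_def using k by (intro degree_lessI) (auto simp: k_def le_less coeff_eq_0)
  have degQ: "degree Q < k"
    unfolding Q_def using k
    by (intro degree_sum_less) (auto intro: le_less_trans[OF degree_monom_le])
  have Q: "Q \<in> coeffs_in N"
    unfolding Q_def
    by (auto simp: coeffs_in_def coeff_sum mult_add_closedD N q(1)[unfolded coeffs_in_def, simplified]
        intro!: sum_mem_mult_add_closed)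
  have "poly q (inverse x) = (\<Sum>j\<le>degree q. coeff q j * inverse x ^ j)"
    by (simp add: poly_altdef)
  also have "\<dots> = coeff q 0 + (\<Sum>j=1..degree q. coeff q j * inverse x ^ j)"
    by (subst sum.atMost_shift, subst sum.atLeast1_atMost_eq[symmetric]) 
       (simp add: sum.atLeast_Suc_atMost_Suc_shift sum.atLeast1_atMost_eq)
  finally have q0: "1 - coeff q 0 = (\<Sum>j=1..degree q. coeff q j * inverse x ^ j)"
    using q(2) by (metis add_diff_cancel_left')
  have shift: "x ^ k * inverse x ^ j = x ^ (k - j)" if "j \<le> degree q" for j
  proof -
    have "x ^ k = x ^ (k - j) * x ^ j" using that le by (simp add: k_def flip: power_add)
    then show ?thesis using x by (simp add: power_inverse)
  qed
  have "x ^ k * (1 - coeff q 0) = (\<Sum>j=1..degree q. coeff q j * x ^ (k - j))"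
    unfolding q0 sum_distrib_left
    by (intro sum.cong) (auto simp: mult.left_commute shift)
  also have "\<dots> = poly Q x" by (simp add: Q_def poly_sum poly_monom)
  finally have Qx: "poly Q x = x ^ k * (1 - coeff q 0)" by simp
  \<comment> \<open>At x this is q0 + (1 - q0) p1(x) + p_k (1 - q0) x^k = q0 + (1 - q0) p(x) = 1.
    The factor 1 - q0 is spelled out as a difference because it need not lie in N, whereas q0
    does.\<close>
  define p' where "p' = [:coeff q 0:] + (p1 - smult (coeff q 0) p1) + smult (coeff p k) Q"
  have cN: "coeff q 0 \<in> N" "coeff p k \<in> N" using p(1) q(1) by (auto simp: coeffs_in_def)
  have p1: "p1 \<in> coeffs_in N"
    unfolding p1_def using N(1) p(1) cN by (intro coeffs_in_closed monom_coeffs_in) auto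
  have "[:coeff q 0:] \<in> coeffs_in N"
    using monom_coeffs_in[OF N(1) cN(1), of 0] by (simp add: monom_0)
  then have "p' \<in> coeffs_in N"
    unfolding p'_def using N(1) Q p1 cN by (intro coeffs_in_closed) auto
  moreover have "poly p' x = 1"
    using p(2) by (simp add: p'_def p1_def Qx poly_monom algebra_simps)
  moreover have "degree p' < k"
    unfolding p'_def using k deg1 degQ
    by (intro degree_add_less degree_diff_less) (auto intro: le_less_trans[OF degree_smult_le])
  ultimately show ?thesis unfolding k_def by blast
qed

text \<open>Descent on the sum of the degrees: the polynomial of larger degree is replaced by one of
  smaller degree, with x and 1/x exchanged when that polynomial is q.\<close>

lemma one_not_in_both:
  fixes x :: "'f::field"
  assumes N: "mult_add_closed N" "1 \<notin> N" and x: "x \<noteq> 0"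
    and p: "p \<in> coeffs_in N" "poly p x = 1" and q: "q \<in> coeffs_in N" "poly q (inverse x) = 1"
  shows False
  using p q
proof (induction "degree p + degree q" arbitrary: p q rule: less_induct)
  case less
  show False
  proof (cases "degree q \<le> degree p")
    case True
    from one_in_coeffs_reduce[OF N x less.prems this]
    obtain p' where "p' \<in> coeffs_in N" "poly p' x = 1" "degree p' < degree p" by blast
    then show False using less.hyps[of p' q] less.prems by auto
  next
    case False
    have "inverse x \<noteq> 0" "degree p \<le> degree q" "poly p (inverse (inverse x)) = 1"
      using x False less.prems by auto
    from one_in_coeffs_reduce[OF N this(1) less.prems(3,4,1) this(3,2)]
    obtain q' where "q' \<in> coeffs_in N" "poly q' (inverse x) = 1" "degree q' < degree q" by blast
    then show False using less.hyps[of p q'] less.prems by auto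
  qed
qed

text \<open>The valuation ring is the multiplier ring B of a maximal N. If x is not in B, then the
  values at x of polynomials over N form a set that contains N and also xN, hence is strictly larger
  than N; by maximality it contains 1. This cannot happen for both x and 1/x. An element of N that
  is a unit of B would put 1 into N.\<close>

lemma Chevalley:
  fixes R :: "'f::field set"
  assumes N0: "mult_add_closed N0" "1 \<notin> N0" and R: "1 \<in> R" "\<And>a x. a \<in> R \<Longrightarrow> x \<in> N0 \<Longrightarrow> a * x \<in> N0"
  shows "\<exists>B. valuation_domain B \<and> R \<subseteq> B \<and> N0 \<subseteq> max_ideal B"
proof -
  define \<N> where "\<N> = {N. N0 \<subseteq> N \<and> mult_add_closed N \<and> 1 \<notin> N \<and> (\<forall>a\<in>R. \<forall>x\<in>N. a * x \<in> N)}"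
  have "N0 \<in> \<N>" using assms by (auto simp: \<N>_def)
  have "\<exists>N\<in>\<N>. \<forall>M\<in>\<N>. N \<subseteq> M \<longrightarrow> M = N"
  proof (rule subset_Zorn_nonempty)
    show "\<N> \<noteq> {}" using \<open>N0 \<in> \<N>\<close> by blast
    fix C assume C: "C \<noteq> {}" "subset.chain \<N> C"
    have sub: "C \<subseteq> \<N>" and lin: "\<And>M Y. M \<in> C \<Longrightarrow> Y \<in> C \<Longrightarrow> M \<subseteq> Y \<or> Y \<subseteq> M"
      using C(2) by (auto simp: subset_chain_def)
    have "x - y \<in> \<Union>C \<and> x * y \<in> \<Union>C" if "x \<in> \<Union>C" "y \<in> \<Union>C" for x y
    proof -
      from that obtain M Y where XY: "x \<in> M" "M \<in> C" "y \<in> Y" "Y \<in> C" by blast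
      then obtain Z where "Z \<in> C" "x \<in> Z" "y \<in> Z" using lin[of M Y] by blast
      then have "x - y \<in> Z" "x * y \<in> Z"
        using sub by (auto simp: \<N>_def mult_add_closed_def)
      then show ?thesis using \<open>Z \<in> C\<close> by blast
    qed
    moreover have mem: "0 \<in> Z" "N0 \<subseteq> Z" "1 \<notin> Z" "\<forall>a\<in>R. \<forall>x\<in>Z. a * x \<in> Z" if "Z \<in> C" for Z
      using subsetD[OF sub that] by (auto simp: \<N>_def mult_add_closed_def)
    have "0 \<in> \<Union>C" "N0 \<subseteq> \<Union>C" "1 \<notin> \<Union>C" "\<forall>a\<in>R. \<forall>x\<in>\<Union>C. a * x \<in> \<Union>C"
      using C(1) mem by blast+
    ultimately show "\<Union>C \<in> \<N>" by (auto simp: \<N>_def mult_add_closed_def)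
  qed
  then obtain N where N: "N \<in> \<N>" and max: "\<And>M. M \<in> \<N> \<Longrightarrow> N \<subseteq> M \<Longrightarrow> M = N" by blast
  from N have mac: "mult_add_closed N" and one: "1 \<notin> N" and NR: "\<And>a x. a \<in> R \<Longrightarrow> x \<in> N \<Longrightarrow> a * x \<in> N"
    and N0N: "N0 \<subseteq> N"
    by (auto simp: \<N>_def)
  define B where "B = {a. \<forall>x\<in>N. a * x \<in> N}"
  have key: "\<exists>p\<in>coeffs_in N. poly p x = 1" if "x \<notin> B" for x
  proof (rule ccontr)
    assume neg: "\<not> ?thesis"
    define N' where "N' = (\<lambda>p. poly p x) ` coeffs_in N"
    have const: "[:a:] \<in> coeffs_in N" if "a \<in> N" for a
      using monom_coeffs_in[OF mac that, of 0] by (simp add: monom_0)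
    have sub: "N \<subseteq> N'"
      unfolding N'_def using const by (force intro!: image_eqI[where x = "[:a:]" for a])
    have "mult_add_closed N'"
      unfolding mult_add_closed_def N'_def
      using coeffs_in_closed[OF mac]
      by (auto simp flip: poly_diff poly_mult intro: image_eqI[where x = 0])
    moreover have "a * y \<in> N'" if "a \<in> R" "y \<in> N'" for a y
      using that NR unfolding N'_def
      by (auto simp: coeffs_in_def intro!: image_eqI[where x = "smult a p" for p])
    ultimately have "N' \<in> \<N>"
      using sub N0N neg by (auto simp: \<N>_def N'_def)
    then have "N' = N" using max sub by blast
    moreover have "x * y \<in> N'" if "y \<in> N" for y
      unfolding N'_def using monom_coeffs_in[OF mac that, of 1]
      by (intro image_eqI[where x = "monom y 1"]) (auto simp: poly_monom)
    ultimately show False using that by (auto simp: B_def)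
  qed
  have "x \<in> B \<or> inverse x \<in> B" if "x \<noteq> 0" for x
    using one_not_in_both[OF mac one that] key by blast
  then have B: "valuation_domain B"
    unfolding valuation_domain_def B_def
    using mac by (auto simp: left_diff_distrib mult.assoc mult_add_closedD)
  have "N \<subseteq> max_ideal B"
  proof
    fix x assume x: "x \<in> N"
    then have "x \<in> B" using mac by (auto simp: B_def mult_add_closedD)
    moreover have "x \<notin> units B"
    proof
      assume "x \<in> units B"
      then have "x \<noteq> 0" "inverse x * x \<in> N" using x by (auto simp: units_def B_def)
      then show False using one by simp
    qed
    ultimately show "x \<in> max_ideal B" by (simp add: max_ideal_def)
  qed
  moreover have "R \<subseteq> B" using NR by (auto simp: B_def)
  ultimately show ?thesis using B N0N by blast
qed

text \<open>Chevalley's theorem is applied to h(M) + J with M the maximal ideal of A. If 1 = h(m) +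
  j, then j = h(1 - m) is the image of a nonzero element, and stability of J under the whole field
  gives 1 in J. An x outside A has its inverse in M, so h(x) cannot lie in B. The set J is {0} for
  extending a valuation to an algebraic closure, and the ideal of a polynomial for forcing that
  polynomial to be infinitely small.\<close>

lemma (in val_dom) extension_exists:
  fixes h :: "'f \<Rightarrow> 'g::field"
  assumes h: "h 1 = 1" "\<And>x y. h (x + y) = h x + h y" "\<And>x y. h (x * y) = h x * h y"
    and J: "mult_add_closed J" "\<And>a x. x \<in> J \<Longrightarrow> h a * x \<in> J" "1 \<notin> J"
  shows "\<exists>B. valuation_domain B \<and> h -` B = A \<and> J \<subseteq> max_ideal B"
proof -
  define N0 where "N0 = {h m + j | m j. n m < n 1 \<and> j \<in> J}"
  have h0: "h 0 = 0" using h(2)[of 0 0] by (metis add_0 add_cancel_left_right)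
  have hd: "h (x - y) = h x - h y" for x y using h(2)[of "x - y" y] by simp
  have memI: "h m + j \<in> N0" if "n m < n 1" "j \<in> J" for m j using that by (auto simp: N0_def)
  have N0: "mult_add_closed N0"
    unfolding mult_add_closed_def
  proof (intro conjI ballI)
    show "0 \<in> N0" using memI[of 0 0] J(1) by (simp add: h0 mult_add_closedD)
    fix x y assume "x \<in> N0" "y \<in> N0"
    then obtain m j m' j' where *: "n m < n 1" "n m' < n 1" "j \<in> J" "j' \<in> J"
      "x = h m + j" "y = h m' + j'" by (auto simp: N0_def)
    have "x - y = h (m - m') + (j - j')" "x * y = h (m * m') + (h m * j' + h m' * j + j * j')"
      using * by (auto simp: hd h algebra_simps)
    moreover have "n (m - m') < n 1" using * by (intro nrm_diff_less)
    moreover have "n (m * m') < n (1 * 1)" using * by (intro nrm_mult_strict_mono) auto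
    moreover have "j - j' \<in> J" "h m * j' + h m' * j + j * j' \<in> J"
      using * J by (auto simp: mult_add_closedD)
    ultimately show "x - y \<in> N0" "x * y \<in> N0"
      by (simp_all only: memI mult_1)
  qed
  have "1 \<notin> N0"
  proof
    assume "1 \<in> N0"
    then obtain m j where *: "n m < n 1" "j \<in> J" "1 = h m + j" by (auto simp: N0_def)
    then have j: "h (1 - m) = j" unfolding hd h(1) by (metis add_diff_cancel_left')
    have "n (1 - m) = n 1" using * by (intro nrm_diff_eq_left)
    then have "1 - m \<noteq> 0" by (metis nrm_eq_zero_iff zero_neq_one)
    then have "h (inverse (1 - m) * (1 - m)) = 1" by (simp add: h(1))
    then have "h (inverse (1 - m)) * j = 1" by (simp only: h(3) j)
    then show False using J(2)[OF *(2)] J(3) by metis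
  qed
  moreover have "a * x \<in> N0" if a: "a \<in> h ` A" and "x \<in> N0" for a x
  proof -
    from that obtain b m j where *: "b \<in> A" "a = h b" "n m < n 1" "j \<in> J" "x = h m + j"
      by (auto simp: N0_def)
    have "n (b * m) < n (1 * 1)"
      using * by (intro nrm_mult_strict_mono') (auto simp: nrm_le_one_iff)
    moreover have "a * x = h (b * m) + h b * j"
      unfolding * h(3) by (simp add: algebra_simps)
    ultimately show ?thesis using * J(2)[of j b] memI by simp
  qed
  moreover have "1 \<in> h ` A" using h(1) one_mem by force
  ultimately obtain B where B: "valuation_domain B" "h ` A \<subseteq> B" "N0 \<subseteq> max_ideal B"
    using Chevalley[OF N0, of "h ` A"] by blast
  interpret B: val_dom B by standard (rule B(1))
  have "x \<in> A" if "h x \<in> B" for x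
  proof (rule ccontr)
    assume "x \<notin> A"
    then have "x \<noteq> 0" "n 1 < n x" using zero_mem nrm_not_le by (auto simp flip: nrm_le_one_iff)
    then have "n (1 * inverse x) < n (x * inverse x)" by (subst nrm_mult_less_cancel) auto
    then have "h (inverse x) + 0 \<in> N0"
      using \<open>x \<noteq> 0\<close> J(1) by (intro memI) (auto simp: mult_add_closedD)
    then have *: "nrm B (h (inverse x)) < nrm B 1"
      using B(3) by (auto simp flip: B.max_ideal_iff)
    have "nrm B (h x * h (inverse x)) < nrm B (1 * 1)"
      using that * by (intro B.nrm_mult_strict_mono') (auto simp: B.nrm_le_one_iff)
    moreover have "h x * h (inverse x) = 1"
      using \<open>x \<noteq> 0\<close> h(3)[of x "inverse x"] by (simp add: h(1))
    ultimately show False by simp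
  qed
  then have "h -` B = A" using B(2) by auto
  moreover have "J \<subseteq> N0" using memI[of 0] by (auto simp: h0)
  ultimately show ?thesis using B by blast
qed


section \<open>Cofinal sequences\<close>

text \<open>The index set is a subset of S itself, so a sequence can be given directly by its
  indices. That no value of \<open>N\<close> on S is largest keeps the index order from
  ending.\<close>

lemma cofinal_well_order:
  fixes N :: "'a \<Rightarrow> 'o::order"
  assumes "S \<noteq> {}" and lin: "\<And>x y. x \<in> S \<Longrightarrow> y \<in> S \<Longrightarrow> N x \<le> N y \<or> N y \<le> N x"
    and nomax: "\<And>x. x \<in> S \<Longrightarrow> \<exists>y\<in>S. N x < N y"
  shows "\<exists>r :: 'a rel. index_order r \<and> Field r \<subseteq> S \<and> (\<forall>i j. (i, j) \<in> r - Id \<longrightarrow> N i < N j) \<and>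
    (\<forall>x\<in>S. \<exists>i\<in>Field r. N x \<le> N i)"
proof -
  obtain w where w: "well_order_on S w" using well_order_on by blast
  then have wf: "wf (w - Id)" and lo: "linear_order_on S w" by (auto simp: well_order_on_def)
  then have antisym: "antisym w" and tr: "trans w" and wS: "w \<subseteq> S \<times> S"
    and rf: "\<And>x. x \<in> S \<Longrightarrow> (x, x) \<in> w"
    and tot: "\<And>x y. x \<in> S \<Longrightarrow> y \<in> S \<Longrightarrow> x \<noteq> y \<Longrightarrow> (x, y) \<in> w \<or> (y, x) \<in> w"
    by (auto simp: order_on_defs refl_on_def total_on_def)
  \<comment> \<open>The records of \<open>N\<close> along a well-order of \<open>S\<close> form the sequence.\<close>
  define R where "R = {x \<in> S. \<forall>y. (y, x) \<in> w - Id \<longrightarrow> N y < N x}"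
  define r where "r = w \<inter> R \<times> R"
  have RS: "R \<subseteq> S" by (auto simp: R_def)
  have F: "Field r = R" using rf RS by (auto simp: r_def Field_def)
  have mono: "N i < N j" if "(i, j) \<in> r - Id" for i j
    using that by (auto simp: r_def R_def)
  have cof: "\<exists>i\<in>R. N x \<le> N i" if "x \<in> S" for x
  proof -
    define Q where "Q = {z \<in> S. N x \<le> N z}"
    \<comment> \<open>The \<open>w\<close>-least z whose value reaches \<open>N x\<close> is a
      record: everything before it stays below \<open>N x\<close>.\<close>
    have "x \<in> Q" using that by (simp add: Q_def)
    then obtain z where "z \<in> Q" and "\<And>y. (y, z) \<in> w - Id \<Longrightarrow> y \<notin> Q"
      by (rule wfE_min[OF wf]) blast
    then have z: "z \<in> S" "N x \<le> N z"
      and min: "\<And>y. (y, z) \<in> w - Id \<Longrightarrow> \<not> (y \<in> S \<and> N x \<le> N y)" by (auto simp: Q_def)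
    have "N y < N z" if "(y, z) \<in> w - Id" for y
    proof -
      have "y \<in> S" using that wS by blast
      then have "\<not> N x \<le> N y" using min[OF that] by blast
      then have "N y < N x" using lin[OF \<open>x \<in> S\<close> \<open>y \<in> S\<close>] by (simp add: less_le_not_le)
      then show ?thesis using z(2) by simp
    qed
    then show ?thesis using z by (auto simp: R_def)
  qed
  have "Well_order r"
    unfolding F well_order_on_def order_on_defs
  proof (intro conjI)
    show "refl_on R r" using rf RS by (auto simp: refl_on_def r_def)
    show "r \<subseteq> R \<times> R" by (auto simp: r_def)
    show "trans r" using tr by (auto simp: trans_def r_def)
    show "antisym r" using antisym by (auto simp: antisym_def r_def)
    show "total_on R r" using tot RS by (auto simp: total_on_def r_def)
    show "wf (r - Id)" using wf by (rule wf_subset) (auto simp: r_def)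
  qed
  moreover have "\<exists>j. (i, j) \<in> r - Id" if i: "i \<in> R" for i
  proof -
    obtain x where "x \<in> S" "N i < N x" using nomax[of i] i RS by blast
    then obtain z where z: "z \<in> R" "N i < N z" using cof[of x] by (meson order_less_le_trans)
    have "i \<noteq> z" using z(2) by auto
    moreover have "(z, i) \<notin> r - Id" using mono[of z i] z(2) by (meson order_less_asym)
    ultimately have "(i, z) \<in> r" using tot[of i z] i z RS by (auto simp: r_def)
    then show ?thesis using \<open>i \<noteq> z\<close> by blast
  qed
  moreover have "R \<noteq> {}" using cof \<open>S \<noteq> {}\<close> by blast
  ultimately have "index_order r" by (simp add: index_order_def F)
  then show ?thesis using RS cof mono unfolding F[symmetric] by (intro exI[of _ r] conjI) auto
qed

lemma index_order_cases:
  assumes "index_order r" "i \<in> Field r" "j \<in> Field r"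
  obtains "(i, j) \<in> r - Id" | "i = j" | "(j, i) \<in> r - Id"
  using assms by (auto simp: index_order_def order_on_defs total_on_def)

lemma index_order_trans:
  assumes "index_order r" "(i, j) \<in> r" "(j, k) \<in> r"
  shows "(i, k) \<in> r"
  using assms by (auto simp: index_order_def order_on_defs dest: transD)

lemma index_order_strict_trans:
  assumes "index_order r" "(i, j) \<in> r" "(j, k) \<in> r - Id"
  shows "(i, k) \<in> r - Id"
proof -
  have "antisym r" using assms(1) by (auto simp: index_order_def order_on_defs)
  then have "i \<noteq> k" using assms(2,3) by (auto dest: antisymD)
  then show ?thesis using index_order_trans[OF assms(1,2), of k] assms(3) by blast
qed

lemma index_order_refl: "index_order r \<Longrightarrow> i \<in> Field r \<Longrightarrow> (i, i) \<in> r"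
  by (auto simp: index_order_def order_on_defs refl_on_def)

lemma index_order_next:
  assumes "index_order r" "i \<in> Field r"
  obtains j where "(i, j) \<in> r - Id"
  using assms by (auto simp: index_order_def)

text \<open>Passing to some k strictly after i turns a condition on the indices after i into one on
  the tail that starts at k.\<close>

lemma eventually_tails_strict:
  assumes "index_order r"
  shows "eventually P (tails r) \<longleftrightarrow> (\<exists>i\<in>Field r. \<forall>j. (i, j) \<in> r - Id \<longrightarrow> P j)"
proof
  show "eventually P (tails r) \<Longrightarrow> \<exists>i\<in>Field r. \<forall>j. (i, j) \<in> r - Id \<longrightarrow> P j"
    using assms by (auto simp: eventually_tails)
  assume "\<exists>i\<in>Field r. \<forall>j. (i, j) \<in> r - Id \<longrightarrow> P j"
  then obtain i where i: "i \<in> Field r" "\<And>j. (i, j) \<in> r - Id \<Longrightarrow> P j" by blast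
  obtain k where k: "(i, k) \<in> r - Id" using index_order_next[OF assms i(1)] .
  have "P j" if "(k, j) \<in> r" for j
    using i(2) index_order_trans[OF assms _ that, of i] index_order_strict_trans[OF assms]
    by (metis DiffD1 DiffD2 DiffI assms k pair_in_Id_conv that)
  moreover have "k \<in> Field r" using k by (auto simp: Field_def)
  ultimately show "eventually P (tails r)" using assms by (auto simp: eventually_tails)
qed

lemma tails_not_bot: "index_order r \<Longrightarrow> tails r \<noteq> bot"
  unfolding trivial_limit_def
  by (metis trivial_limit_def eventually_tails index_order_refl)


section \<open>Extensions to the rational function field\<close>

lemma rconst_simps [simp]:
  "rconst 0 = 0" "rconst 1 = 1" "rconst (x + y) = rconst x + rconst y"
  "rconst (x - y) = rconst x - rconst y" "rconst (- x) = - rconst x"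
  "rconst (x * y) = rconst x * rconst y" "rconst x = rconst y \<longleftrightarrow> x = y"
proof -
  show "rconst (x + y) = rconst x + rconst y" "rconst (x - y) = rconst x - rconst y"
    "rconst (- x) = - rconst x" "rconst (x * y) = rconst x * rconst y"
    by (simp_all add: rconst_def flip: to_fract_add to_fract_diff to_fract_uminus to_fract_mult)
qed (simp_all add: rconst_def flip: one_pCons)

lemma rconst_power [simp]: "rconst (x ^ k) = rconst x ^ k"
  by (induction k) auto

lemma rconst_divide [simp]: "rconst (x / y) = rconst x / rconst y"
proof (cases "y = 0")
  case False
  have "rconst (x / y) * rconst y = rconst x" using False by (simp flip: rconst_simps(6))
  moreover have "rconst y \<noteq> 0" using False by (simp flip: rconst_simps(1))
  ultimately show ?thesis by (simp add: field_simps)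
qed simp

lemma rconst_eq_0_iff [simp]: "rconst x = 0 \<longleftrightarrow> x = 0"
  using rconst_simps(7)[of x 0] by (simp only: rconst_simps(1))

text \<open>Division with remainder by X - x, recorded both for values and inside K(X). It drives
  the inductions on the degree; x is mostly chosen so that the remainder f(x) is negligible.\<close>

lemma poly_split:
  assumes "degree f > 0"
  obtains g where "degree f = Suc (degree g)" "lead_coeff g = lead_coeff f"
    "\<And>s. poly f s = (s - x) * poly g s + poly f x"
    "to_fract f = (rX - rconst x) * to_fract g + rconst (poly f x)"
proof -
  define g where "g = synthetic_div f x"
  have eq: "f = [:- x, 1:] * g + [:poly f x:]"
    unfolding g_def by (rule synthetic_div_correct'[symmetric])
  have deg: "degree f = Suc (degree g)"
    using assms by (simp add: g_def degree_synthetic_div)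
  have "coeff f (Suc (degree g)) = coeff ([:- x, 1:] * g + [:poly f x:]) (Suc (degree g))"
    using eq by simp
  also have "\<dots> = lead_coeff g" by (simp add: coeff_pCons coeff_eq_0)
  finally have lc: "lead_coeff g = lead_coeff f" by (simp add: deg)
  have "poly f s = (s - x) * poly g s + poly f x" for s
    using arg_cong[OF eq, of "\<lambda>f. poly f s"] by (simp add: algebra_simps)
  moreover have "to_fract [:- x, 1:] = rX - rconst x"
    by (simp add: rX_def rconst_def flip: to_fract_diff)
  then have "to_fract f = (rX - rconst x) * to_fract g + rconst (poly f x)"
    using arg_cong[OF eq, of to_fract] by (simp only: to_fract_add to_fract_mult rconst_def[of "poly f x"])
  ultimately show ?thesis using that deg lc by blast
qed

text \<open>A nonzero element of least degree in the ideal (p, q) divides p and q and can be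
  cancelled. The identity itself is kept because it is evaluated at points of K and also estimated
  with the valuation.\<close>

lemma Fract_bezout:
  fixes \<phi> :: "'a::field poly fract"
  obtains p q a b where "\<phi> = Fract p q" "q \<noteq> 0" "a * p + b * q = 1"
proof -
  obtain p q where pq: "\<phi> = Fract p q" "q \<noteq> 0" by (cases \<phi>)
  define I where "I = {a * p + b * q | a b. a * p + b * q \<noteq> 0}"
  have "0 * p + 1 * q \<in> I" unfolding I_def using pq(2) by fastforce
  then obtain g where g: "g \<in> I" and min: "\<And>h. h \<in> I \<Longrightarrow> degree g \<le> degree h"
    using ex_has_least_nat[of "\<lambda>g. g \<in> I" _ degree] by blast
  then obtain a b where ab: "g = a * p + b * q" "g \<noteq> 0" by (auto simp: I_def)
  have dvd: "g dvd h" if "h = c * p + d * q" for h c d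
  proof (rule ccontr)
    assume "\<not> g dvd h"
    then have nz: "h mod g \<noteq> 0" by (simp add: dvd_eq_mod_eq_0)
    have "h mod g = (c - h div g * a) * p + (d - h div g * b) * q"
      using minus_div_mult_eq_mod[of h g, symmetric] unfolding that ab(1) by (simp add: algebra_simps)
    then have "h mod g \<in> I" using nz by (auto simp: I_def)
    moreover have "degree (h mod g) < degree g" using degree_mod_less'[OF ab(2) nz] .
    ultimately show False using min by (meson not_le)
  qed
  have "g dvd p" "g dvd q" using dvd[of p 1 0] dvd[of q 0 1] by simp_all
  then obtain p' q' where *: "p = g * p'" "q = g * q'" by (auto elim!: dvdE)
  have "g * (a * p' + b * q') = g * 1" using ab(1) * by (simp add: algebra_simps)
  then have "a * p' + b * q' = 1" using ab(2) by (simp only: mult_cancel_left) simp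
  moreover have "\<phi> = Fract p' q'" "q' \<noteq> 0" using pq * ab(2) by (auto simp: eq_fract)
  ultimately show ?thesis using that by blast
qed

text \<open>In another representation p'/q' with q'(x) nonzero, q(x) = 0 would force p(x) = 0,
  against the Bezout identity. So this one representation decides about poles.\<close>

lemma ratfun_value_bezout:
  fixes p q :: "'a::field poly"
  assumes "a * p + b * q = 1" "q \<noteq> 0"
  shows "ratfun_value (Fract p q) x y \<longleftrightarrow> poly q x \<noteq> 0 \<and> y = poly p x / poly q x"
proof
  assume "ratfun_value (Fract p q) x y"
  then obtain p' q' where *: "Fract p q = Fract p' q'" "poly q' x \<noteq> 0" "y = poly p' x / poly q' x"
    by (auto simp: ratfun_value_def)
  then have "q' \<noteq> 0" by auto
  then have eq: "p * q' = p' * q" using *(1) assms(2) by (simp add: eq_fract)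
  have eqx: "poly p x * poly q' x = poly p' x * poly q x"
    using arg_cong[OF eq, of "\<lambda>f. poly f x"] by simp
  have one: "poly a x * poly p x + poly b x * poly q x = 1"
    using arg_cong[OF assms(1), of "\<lambda>f. poly f x"] by simp
  have "poly q x \<noteq> 0"
  proof
    assume "poly q x = 0"
    then show False using eqx one *(2) by simp
  qed
  then show "poly q x \<noteq> 0 \<and> y = poly p x / poly q x"
    using eqx *(2,3) by (simp add: frac_eq_eq)
qed (auto simp: ratfun_value_def)

text \<open>V_E depends on E only through the filter of its tails in K. Stated for filters, the
  comparison with W is free of index sets.\<close>

definition VF :: "'a::field set \<Rightarrow> 'a filter \<Rightarrow> 'a poly fract set" where
  "VF V F = {\<phi>. eventually (\<lambda>x. \<exists>y\<in>V. ratfun_value \<phi> x y) F}"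

lemma VE_eq_VF: "VE V r s = VF V (filtermap s (tails r))"
  by (simp add: VE_def VF_def eventually_filtermap)

context val_dom
begin

definition small_values :: bool where
  "small_values \<longleftrightarrow> (\<forall>f c. degree f > 0 \<longrightarrow> c \<noteq> 0 \<longrightarrow> (\<exists>x. n (poly f x) < n c))"

text \<open>Poles cause no exception: where q vanishes, p does not, so both sides fail
  there.\<close>

lemma VF_Fract_iff:
  assumes "a * p + b * q = 1" "q \<noteq> 0"
  shows "Fract p q \<in> VF A F \<longleftrightarrow> eventually (\<lambda>x. n (poly p x) \<le> n (poly q x)) F"
proof -
  have "(\<exists>y\<in>A. ratfun_value (Fract p q) x y) \<longleftrightarrow> n (poly p x) \<le> n (poly q x)" for x
  proof (cases "poly q x = 0")
    case True
    have "poly p x \<noteq> 0"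
      using arg_cong[OF assms(1), of "\<lambda>f. poly f x"] True by auto
    then show ?thesis using True by (simp add: ratfun_value_bezout[OF assms])
  next
    case False
    then show ?thesis by (auto simp: ratfun_value_bezout[OF assms] nrm_le_iff_divide)
  qed
  then show ?thesis by (simp add: VF_def)
qed

end

locale val_ext = val_dom V for V :: "'a::field set" +
  fixes W :: "'a poly fract set"
  assumes is_ext: "is_extension V W"

sublocale val_ext \<subseteq> W: val_dom W
  using is_ext by unfold_locales (simp add: is_extension_def)

context val_ext
begin

abbreviation w :: "'a poly fract \<Rightarrow> 'a poly fract absval" where "w \<equiv> nrm W"

lemma rconst_mem_iff: "rconst x \<in> W \<longleftrightarrow> x \<in> V"
  using is_ext by (auto simp: is_extension_def)

lemma w_rconst_le_iff [simp]: "w (rconst x) \<le> w (rconst y) \<longleftrightarrow> n x \<le> n y"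
proof (cases "y = 0")
  case False
  then show ?thesis
    by (simp add: nrm_le_iff_divide W.nrm_le_iff_divide rconst_mem_iff flip: rconst_divide)
qed simp

lemma w_rconst_less_iff [simp]: "w (rconst x) < w (rconst y) \<longleftrightarrow> n x < n y"
  by (simp add: less_le_not_le)

lemma w_rconst_eq_iff [simp]: "w (rconst x) = w (rconst y) \<longleftrightarrow> n x = n y"
  by (simp add: order_eq_iff)

lemma w_Fract_mem_iff: "q \<noteq> 0 \<Longrightarrow> Fract p q \<in> W \<longleftrightarrow> w (to_fract p) \<le> w (to_fract q)"
  by (simp add: W.nrm_le_iff_divide Fract_conv_to_fract)

text \<open>The weak inequality puts W inside V_F. For the converse, an element p/q outside W has
  |q| < |p| in W; the strict inequality, applied to the exchanged pair, then holds along F and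
  excludes |p| \<le> |q|, as F is proper.\<close>

lemma eq_VF_if_tracked:
  assumes "F \<noteq> bot"
    and le: "\<And>p q a b. a * p + b * q = 1 \<Longrightarrow> w (to_fract p) \<le> w (to_fract q) \<Longrightarrow>
      eventually (\<lambda>x. n (poly p x) \<le> n (poly q x)) F"
    and less: "\<And>p q a b. a * p + b * q = 1 \<Longrightarrow> w (to_fract p) < w (to_fract q) \<Longrightarrow>
      eventually (\<lambda>x. n (poly p x) < n (poly q x)) F"
  shows "W = VF V F"
proof (rule Set.set_eqI)
  fix \<phi> :: "'a poly fract"
  obtain p q a b where pq: "\<phi> = Fract p q" "q \<noteq> 0" "a * p + b * q = 1"
    by (rule Fract_bezout[of \<phi>])
  show "\<phi> \<in> W \<longleftrightarrow> \<phi> \<in> VF V F"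
  proof (cases "w (to_fract p) \<le> w (to_fract q)")
    case True
    then show ?thesis using le[OF pq(3) True] pq by (simp add: VF_Fract_iff w_Fract_mem_iff)
  next
    case False
    have "b * q + a * p = 1" using pq(3) by (simp add: add.commute)
    from less[OF this] False have *: "eventually (\<lambda>x. n (poly q x) < n (poly p x)) F"
      by (simp add: W.nrm_not_le)
    have "\<not> eventually (\<lambda>x. n (poly p x) \<le> n (poly q x)) F"
    proof
      assume "eventually (\<lambda>x. n (poly p x) \<le> n (poly q x)) F"
      with * have "eventually (\<lambda>x. False) F" by eventually_elim simp
      then show False using \<open>F \<noteq> bot\<close> by (simp add: trivial_limit_def)
    qed
    then show ?thesis using False pq by (simp add: VF_Fract_iff w_Fract_mem_iff)
  qed
qed

text \<open>At a point x0 with |f(x0)| < |e|, write f = (X - x0) g + f(x0). If (X - x0) g has a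
  constant absolute value above |e|, it dominates the remainder and decides |f|; otherwise |f| \<le>
  |e|. The threshold must vary in the induction: with |X - x0| = |c|, the bound e for f needs the
  bound e / c for g.\<close>

lemma poly_constant_or_small:
  assumes small: small_values
    and lin: "\<And>x0. \<exists>c. c \<noteq> 0 \<and> w (rX - rconst x0) = w (rconst c) \<and>
      eventually (\<lambda>x. n (x - x0) = n c) F"
    and "e \<noteq> 0"
  shows "(\<exists>c. c \<noteq> 0 \<and> w (to_fract f) = w (rconst c) \<and> eventually (\<lambda>x. n (poly f x) = n c) F) \<or>
    (w (to_fract f) \<le> w (rconst e) \<and> eventually (\<lambda>x. n (poly f x) \<le> n e) F)"
  using \<open>e \<noteq> 0\<close>
proof (induction "degree f" arbitrary: f e)
  case 0
  then obtain a where f: "f = [:a:]" by (metis degree_eq_zeroE)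
  show ?case
  proof (cases "a = 0")
    case False
    then show ?thesis using f by (intro disjI1 exI[of _ a]) (auto simp: rconst_def)
  qed (simp add: f)
next
  case (Suc k)
  then have "degree f > 0" by simp
  then obtain x0 where x0: "n (poly f x0) < n e"
    using small Suc.prems by (auto simp: small_values_def)
  from poly_split[OF \<open>degree f > 0\<close>, of x0] obtain g where g: "degree f = Suc (degree g)"
    "\<And>s. poly f s = (s - x0) * poly g s + poly f x0"
    "to_fract f = (rX - rconst x0) * to_fract g + rconst (poly f x0)" by metis
  obtain c where c: "c \<noteq> 0" "w (rX - rconst x0) = w (rconst c)"
    and evc: "eventually (\<lambda>x. n (x - x0) = n c) F" using lin by blast
  have "e / c \<noteq> 0" using Suc.prems c by simp
  from Suc.hyps(1)[OF _ this, of g] g(1) Suc.hyps(2)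
  consider d where "d \<noteq> 0" "w (to_fract g) = w (rconst d)" "eventually (\<lambda>x. n (poly g x) = n d) F"
    | "w (to_fract g) \<le> w (rconst (e / c))" "eventually (\<lambda>x. n (poly g x) \<le> n (e / c)) F"
    by auto
  then show ?case
  proof cases
    case 1
    have wprod: "w ((rX - rconst x0) * to_fract g) = w (rconst (c * d))"
      using W.nrm_mult_cong[OF c(2) 1(2)] by simp
    have evprod: "eventually (\<lambda>x. n ((x - x0) * poly g x) = n (c * d)) F"
      using evc 1(3) by eventually_elim (rule nrm_mult_cong)
    show ?thesis
    proof (cases "n e < n (c * d)")
      case True
      then have less: "n (poly f x0) < n (c * d)" using x0 by simp
      have "w (to_fract f) = w (rconst (c * d))"
        unfolding g(3) wprod[symmetric] using less
        by (intro W.nrm_add_eq_left) (simp add: wprod del: rconst_simps)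
      moreover have "eventually (\<lambda>x. n (poly f x) = n (c * d)) F"
        using evprod
      proof eventually_elim
        case (elim x)
        then show ?case using nrm_add_eq_left[of "poly f x0" "(x - x0) * poly g x"] less g(2)[of x]
          by simp
      qed
      ultimately show ?thesis using c(1) 1(1) by (intro disjI1 exI[of _ "c * d"]) simp
    next
      case False
      then have le: "n (c * d) \<le> n e" by (simp add: nrm_not_less)
      have "w (to_fract f) \<le> w (rconst e)"
        unfolding g(3) using le x0 
        by (intro W.nrm_add_le) (simp_all add: wprod less_imp_le del: rconst_simps)
      moreover have "eventually (\<lambda>x. n (poly f x) \<le> n e) F"
        using evprod
      proof eventually_elim
        case (elim x)
        then show ?case unfolding g(2)[of x] using le x0 by (intro nrm_add_le) auto
      qed
      ultimately show ?thesis by blast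
    qed
  next
    case 2
    have "w ((rX - rconst x0) * to_fract g) \<le> w (rconst c * rconst (e / c))"
      using c(2) 2(1) by (intro W.nrm_mult_mono) auto
    also have "rconst c * rconst (e / c) = rconst e" using c(1) by simp
    finally have "w (to_fract f) \<le> w (rconst e)"
      unfolding g(3) using x0 by (intro W.nrm_add_le) (simp_all add: less_imp_le)
    moreover have "eventually (\<lambda>x. n (poly f x) \<le> n e) F"
      using evc 2(2)
    proof eventually_elim
      case (elim x)
      have "n ((x - x0) * poly g x) \<le> n (c * (e / c))"
        using elim by (intro nrm_mult_mono) auto
      then show ?case unfolding g(2)[of x] using x0 c(1) by (intro nrm_add_le) auto
    qed
    ultimately show ?thesis by blast
  qed
qed

text \<open>The first alternative does not mention the threshold e. If it fails, the second one
  holds for every e.\<close>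

lemma poly_constant_or_tiny:
  assumes small: small_values
    and lin: "\<And>x0. \<exists>c. c \<noteq> 0 \<and> w (rX - rconst x0) = w (rconst c) \<and>
      eventually (\<lambda>x. n (x - x0) = n c) F"
  obtains (const) c where "c \<noteq> 0" "w (to_fract f) = w (rconst c)"
      "eventually (\<lambda>x. n (poly f x) = n c) F"
    | (tiny) "\<And>e. e \<noteq> 0 \<Longrightarrow> w (to_fract f) \<le> w (rconst e)"
      "\<And>e. e \<noteq> 0 \<Longrightarrow> eventually (\<lambda>x. n (poly f x) \<le> n e) F"
  using poly_constant_or_small[OF assms, of _ f] by blast

text \<open>Every polynomial is bounded by a constant, so if p and q were both tiny, then a p + b q
  would be smaller than 1. Hence q has a constant absolute value whenever |p| \<le> |q|, and p
  either has one too or is eventually smaller than q.\<close>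

lemma eq_VF_if_linear_constant:
  assumes "V \<noteq> UNIV" and small: small_values and "F \<noteq> bot"
    and lin: "\<And>x0. \<exists>c. c \<noteq> 0 \<and> w (rX - rconst x0) = w (rconst c) \<and>
      eventually (\<lambda>x. n (x - x0) = n c) F"
  shows "W = VF V F"
proof (rule eq_VF_if_tracked[OF \<open>F \<noteq> bot\<close>])
  fix p q a b :: "'a poly"
  assume bezout: "a * p + b * q = 1"
  note cases = poly_constant_or_tiny[OF small lin]
  have bounded: "\<exists>B. B \<noteq> 0 \<and> w (to_fract f) \<le> w (rconst B)" for f
    by (rule cases[of f]) (use zero_neq_one order_refl in metis)+
  have not_tiny: False if p: "\<And>e. e \<noteq> 0 \<Longrightarrow> w (to_fract p) \<le> w (rconst e)"
    and q: "\<And>e. e \<noteq> 0 \<Longrightarrow> w (to_fract q) \<le> w (rconst e)"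
  proof -
    obtain e where e: "e \<noteq> 0" "n e < n 1" using exists_nrm_less[OF assms(1), of 1] by auto
    have tiny: "w (to_fract f * to_fract g) \<le> w (rconst e)"
      if g: "\<And>e. e \<noteq> 0 \<Longrightarrow> w (to_fract g) \<le> w (rconst e)" for f g
    proof -
      obtain B where B: "B \<noteq> 0" "w (to_fract f) \<le> w (rconst B)" using bounded by blast
      have "w (to_fract f * to_fract g) \<le> w (rconst B * rconst (e / B))"
        using B e by (intro W.nrm_mult_mono g) auto
      then show ?thesis using B(1) by simp
    qed
    have "w (to_fract a * to_fract p + to_fract b * to_fract q) \<le> w (rconst e)"
      by (intro W.nrm_add_le tiny p q)
    also have "to_fract a * to_fract p + to_fract b * to_fract q = rconst 1"
      using arg_cong[OF bezout, of to_fract] by simp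
    finally show False using e(2) by (simp del: rconst_simps)
  qed
  have ev: "eventually (\<lambda>x. n (poly p x) < n (poly q x)) F"
    if d: "d \<noteq> 0" "eventually (\<lambda>x. n (poly q x) = n d) F"
      and tiny: "\<And>e. e \<noteq> 0 \<Longrightarrow> eventually (\<lambda>x. n (poly p x) \<le> n e) F" for d
  proof -
    obtain e where e: "e \<noteq> 0" "n e < n d" using exists_nrm_less[OF assms(1) d(1)] by auto
    from d(2) tiny[OF e(1)] show ?thesis by eventually_elim (use e in auto)
  qed
  show "eventually (\<lambda>x. n (poly p x) \<le> n (poly q x)) F" if pq: "w (to_fract p) \<le> w (to_fract q)"
  proof (rule cases[of q])
    fix d assume d: "d \<noteq> 0" "w (to_fract q) = w (rconst d)" "eventually (\<lambda>x. n (poly q x) = n d) F"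
    show ?thesis
    proof (rule cases[of p])
      fix c assume c: "c \<noteq> 0" "w (to_fract p) = w (rconst c)" "eventually (\<lambda>x. n (poly p x) = n c) F"
      then have "n c \<le> n d" using pq d by simp
      from d(3) c(3) show ?thesis by eventually_elim (use \<open>n c \<le> n d\<close> in simp)
    next
      assume "\<And>e. e \<noteq> 0 \<Longrightarrow> eventually (\<lambda>x. n (poly p x) \<le> n e) F"
      from ev[OF d(1,3) this] show ?thesis by (rule eventually_mono) auto
    qed
  next
    assume q: "\<And>e. e \<noteq> 0 \<Longrightarrow> w (to_fract q) \<le> w (rconst e)"
    have False using not_tiny[OF _ q] pq q by (meson order_trans)
    then show ?thesis ..
  qed
  show "eventually (\<lambda>x. n (poly p x) < n (poly q x)) F" if pq: "w (to_fract p) < w (to_fract q)"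
  proof (rule cases[of q])
    fix d assume d: "d \<noteq> 0" "w (to_fract q) = w (rconst d)" "eventually (\<lambda>x. n (poly q x) = n d) F"
    show ?thesis
    proof (rule cases[of p])
      fix c assume c: "c \<noteq> 0" "w (to_fract p) = w (rconst c)" "eventually (\<lambda>x. n (poly p x) = n c) F"
      then have "n c < n d" using pq d by simp
      from d(3) c(3) show ?thesis by eventually_elim (use \<open>n c < n d\<close> in simp)
    next
      assume "\<And>e. e \<noteq> 0 \<Longrightarrow> eventually (\<lambda>x. n (poly p x) \<le> n e) F"
      from ev[OF d(1,3) this] show ?thesis .
    qed
  next
    assume q: "\<And>e. e \<noteq> 0 \<Longrightarrow> w (to_fract q) \<le> w (rconst e)"
    have False using not_tiny[OF _ q] pq q by (meson order_trans less_imp_le)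
    then show ?thesis ..
  qed
qed

end


section \<open>Every extension is defined by a pseudo-monotone sequence\<close>

context val_dom
begin

lemma nrm_inverse_le_iff: "x \<noteq> 0 \<Longrightarrow> y \<noteq> 0 \<Longrightarrow> n (inverse x) \<le> n (inverse y) \<longleftrightarrow> n y \<le> n x"
  by (simp add: nrm_le_iff_divide field_simps)

lemma nrm_inverse_less_iff: "x \<noteq> 0 \<Longrightarrow> y \<noteq> 0 \<Longrightarrow> n (inverse x) < n (inverse y) \<longleftrightarrow> n y < n x"
  by (simp flip: nrm_not_le add: nrm_inverse_le_iff)

text \<open>A point c where X^k - b is smaller than b satisfies |c^k| = |b|: the value group is
  divisible.\<close>

lemma exists_nrm_root:
  assumes small_values "b \<noteq> 0" "k > 0"
  shows "\<exists>c. c \<noteq> 0 \<and> n (c ^ k) = n b"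
proof -
  have deg: "degree (monom 1 k - [:b:]) = k"
    using assms(3) by (subst diff_conv_add_uminus, subst degree_add_eq_left) (auto simp: degree_monom_eq)
  then obtain c where "n (poly (monom 1 k - [:b:]) c) < n b"
    using assms by (metis small_values_def)
  then have c: "n (c ^ k - b) < n b" by (simp add: poly_monom)
  have "n (b + (c ^ k - b)) = n b" using c by (rule nrm_add_eq_left)
  then have "n (c ^ k) = n b" by simp
  moreover have "c \<noteq> 0"
  proof
    assume "c = 0"
    then have "n b = n 0" using \<open>n (c ^ k) = n b\<close> assms(3) by (simp add: power_0_left)
    then show False using assms(2) by (simp only: nrm_eq_zero_iff)
  qed
  ultimately show ?thesis by blast
qed

text \<open>The witness is a geometric mean: |e|^2 = |c d|.\<close>

lemma exists_nrm_between:
  assumes small_values "c \<noteq> 0" "n c < n d"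
  shows "\<exists>e. e \<noteq> 0 \<and> n c < n e \<and> n e < n d"
proof -
  have "d \<noteq> 0" using assms(3) by auto
  then have "c * d \<noteq> 0" using assms(2) by simp
  then obtain e where e: "e \<noteq> 0" "n (e ^ 2) = n (c * d)"
    using exists_nrm_root[OF assms(1), of "c * d" 2] by auto
  have "n c < n e"
  proof (rule ccontr)
    assume "\<not> n c < n e"
    then have "n (e * e) \<le> n (c * c)" by (intro nrm_mult_mono) (simp_all add: nrm_not_less)
    also have "n (c * c) < n (c * d)" using assms by (intro nrm_mult_strict_mono') auto
    finally show False using e by (simp add: power2_eq_square)
  qed
  moreover have "n e < n d"
  proof (rule ccontr)
    assume "\<not> n e < n d"
    then have "n (d * d) \<le> n (e * e)" by (intro nrm_mult_mono) (simp_all add: nrm_not_less)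
    moreover have "n (c * d) < n (d * d)" using assms \<open>d \<noteq> 0\<close> by (intro nrm_mult_strict_mono) auto
    ultimately show False using e by (simp add: power2_eq_square)
  qed
  ultimately show ?thesis using e(1) by blast
qed

text \<open>
  A zero of \<open>\<Prod>\<^sub>i (t - x\<^sub>i) - 1\<close> modulo the maximal ideal differs from all \<open>x\<^sub>i\<close> in the
  residue field.
\<close>

lemma exists_new_residue:
  assumes small_values "finite S" "S \<noteq> {}" "S \<subseteq> A"
  shows "\<exists>x\<in>A. \<forall>y\<in>S. n (x - y) = n 1"
proof -
  define f where "f = (\<Prod>y\<in>S. [:- y, 1:])"
  have "degree f = card S" unfolding f_def by (subst degree_prod_eq_sum_degree) auto
  then have "degree f > 0" using assms by (simp add: card_gt_0_iff)
  then have "degree (f - 1) > 0"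
    using degree_add_eq_left[of "- 1" f] by simp
  then obtain x where x: "n (poly (f - 1) x) < n 1"
    using assms(1) by (metis small_values_def zero_neq_one)
  have "n (1 + poly (f - 1) x) = n 1" using x by (rule nrm_add_eq_left)
  then have prod: "n (\<Prod>y\<in>S. x - y) = n 1"
    by (simp add: f_def poly_prod)
  have ge: "n 1 \<le> n (\<Prod>y\<in>T. g y)" if "finite T" "\<And>y. y \<in> T \<Longrightarrow> n 1 \<le> n (g y)" for T and g :: "'f \<Rightarrow> 'f"
    using that
  proof (induction T rule: finite_induct)
    case (insert y T)
    have "n (1 * 1) \<le> n (g y * prod g T)" using insert by (intro nrm_mult_mono) auto
    then show ?case using insert by simp
  qed simp
  have le: "n (\<Prod>y\<in>T. g y) \<le> n 1" if "finite T" "\<And>y. y \<in> T \<Longrightarrow> n (g y) \<le> n 1" for T and g :: "'f \<Rightarrow> 'f"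
    using that
  proof (induction T rule: finite_induct)
    case (insert y T)
    have "n (g y * prod g T) \<le> n (1 * 1)" using insert by (intro nrm_mult_mono) auto
    then show ?case using insert by simp
  qed simp
  have xA: "x \<in> A"
  proof (rule ccontr)
    assume "x \<notin> A"
    then have gt: "n 1 < n x" by (simp add: nrm_not_le flip: nrm_le_one_iff)
    have *: "n (x - y) = n x" if "y \<in> S" for y
    proof -
      have "n y \<le> n 1" using that assms(4) by (auto simp: nrm_le_one_iff)
      then show ?thesis using gt by (intro nrm_diff_eq_left) simp
    qed
    obtain y where y: "y \<in> S" using assms by blast
    have "n 1 \<le> n (\<Prod>y\<in>S - {y}. x - y)"
      using * gt assms(2) by (intro ge) (auto intro: less_imp_le)
    then have "n (1 * 1) < n ((x - y) * (\<Prod>y\<in>S - {y}. x - y))"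
      using *[OF y] gt by (intro nrm_mult_strict_mono) (auto dest: le_less_trans)
    also have "(x - y) * (\<Prod>y\<in>S - {y}. x - y) = (\<Prod>y\<in>S. x - y)"
      using assms(2) y by (simp add: prod.remove)
    finally show False using prod by simp
  qed
  have "n (x - y) = n 1" if y: "y \<in> S" for y
  proof (rule ccontr)
    have le1: "n (x - z) \<le> n 1" if "z \<in> S" for z
      using xA assms(4) that by (auto simp: nrm_le_one_iff intro: diff_mem)
    assume "n (x - y) \<noteq> n 1"
    then have "n (x - y) < n 1" using le1[OF y] by (simp add: order_less_le)
    moreover have "n (\<Prod>y\<in>S - {y}. x - y) \<le> n 1"
      using le1 assms(2) by (intro le) auto
    ultimately have "n ((x - y) * (\<Prod>y\<in>S - {y}. x - y)) < n (1 * 1)"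
      by (intro nrm_mult_strict_mono) auto
    also have "(x - y) * (\<Prod>y\<in>S - {y}. x - y) = (\<Prod>y\<in>S. x - y)"
      using assms(2) y by (simp add: prod.remove)
    finally show False using prod by simp
  qed
  then show ?thesis using xA by blast
qed

lemma exists_residue_sequence:
  assumes small_values
  shows "\<exists>u :: nat \<Rightarrow> 'f. \<forall>i j. i \<noteq> j \<longrightarrow> n (u i - u j) = n 1"
proof -
  have "\<exists>u :: nat \<Rightarrow> 'f. \<forall>i. u i \<in> A \<and> (\<forall>j<i. n (u i - u j) = n 1)"
  proof (rule dependent_wellorder_choice)
    fix i and u :: "nat \<Rightarrow> 'f"
    assume IH: "\<And>j. j < i \<Longrightarrow> u j \<in> A \<and> (\<forall>k<j. n (u j - u k) = n 1)"
    \<comment> \<open>Adding 0 keeps the set nonempty for i = 0, so that the auxiliary polynomial is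
      not constant.\<close>
    have "insert 0 (u ` {..<i}) \<subseteq> A" using IH zero_mem by auto
    from exists_new_residue[OF assms _ _ this]
    show "\<exists>y. y \<in> A \<and> (\<forall>j<i. n (y - u j) = n 1)" by auto
  qed auto
  then obtain u :: "nat \<Rightarrow> 'f" where u: "\<And>i j. j < i \<Longrightarrow> n (u i - u j) = n 1" by blast
  have "n (u i - u j) = n 1" if "i \<noteq> j" for i j
    using u[of i j] u[of j i] that nrm_minus_commute[of "u i" "u j"] by (cases "i < j") auto
  then show ?thesis by blast
qed

lemma pseudo_convergent_iff:
  "pseudo_convergent A r s \<longleftrightarrow> index_order r \<and>
     (\<forall>i j k. (i, j) \<in> r - Id \<and> (j, k) \<in> r - Id \<longrightarrow> n (s k - s j) < n (s j - s i))"
  by (simp add: pseudo_convergent_def val_less_iff_nrm)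

lemma pseudo_divergent_iff:
  "pseudo_divergent A r s \<longleftrightarrow> index_order r \<and>
     (\<forall>i j k. (i, j) \<in> r - Id \<and> (j, k) \<in> r - Id \<longrightarrow> n (s j - s i) < n (s k - s j))"
  by (simp add: pseudo_divergent_def val_less_iff_nrm)

lemma algebraic_type_iff:
  "algebraic_type A r s \<longleftrightarrow>
     (\<exists>f. \<exists>i0\<in>Field r. \<forall>i j. (i0, i) \<in> r \<and> (i, j) \<in> r - Id \<longrightarrow>
        n (poly f (s j)) < n (poly f (s i)))"
  by (simp add: algebraic_type_def val_less_iff_nrm)

text \<open>The index i is the deviation from \<open>\<alpha>\<close>, so the gap after i has
  absolute value |i|, and the polynomial X - \<open>\<alpha>\<close>, with values i, witnesses the
  algebraic type.\<close>

lemma pseudo_convergent_if_decreasing: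
  assumes "index_order r"
    and dec: "\<And>i j. (i, j) \<in> r - Id \<Longrightarrow> n j < n i"
  shows "pseudo_convergent A r (\<lambda>i. \<alpha> + i)" "algebraic_type A r (\<lambda>i. \<alpha> + i)"
proof -
  have "n ((\<alpha> + j) - (\<alpha> + i)) = n i" if "(i, j) \<in> r - Id" for i j
    using nrm_diff_eq_right[OF dec[OF that]] by simp
  then show "pseudo_convergent A r (\<lambda>i. \<alpha> + i)"
    using assms unfolding pseudo_convergent_iff by metis
  obtain i0 where "i0 \<in> Field r" using assms(1) by (auto simp: index_order_def)
  then show "algebraic_type A r (\<lambda>i. \<alpha> + i)"
    unfolding algebraic_type_iff using dec by (intro exI[of _ "[:- \<alpha>, 1:]"]) auto
qed

lemma pseudo_divergent_if_increasing:
  assumes "index_order r"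
    and inc: "\<And>i j. (i, j) \<in> r - Id \<Longrightarrow> n i < n j"
  shows "pseudo_divergent A r (\<lambda>i. \<alpha> + i)"
proof -
  have "n ((\<alpha> + j) - (\<alpha> + i)) = n j" if "(i, j) \<in> r - Id" for i j
    using nrm_diff_eq_left[OF inc[OF that]] by simp
  then show ?thesis
    using assms unfolding pseudo_divergent_iff by metis
qed

end

section \<open>Points of L1: the value of X - alpha lies outside the value group\<close>

context val_ext
begin

lemma L1_iff: "\<alpha> \<in> L1 W \<longleftrightarrow> (\<forall>c. c \<noteq> 0 \<longrightarrow> w (rX - rconst \<alpha>) \<noteq> w (rconst c))"
  by (auto simp: L1_def base_value_group_def W.val_eq_iff)

lemma L2_iff:
  "\<alpha> \<in> L2 W \<longleftrightarrow> (\<exists>c. c \<noteq> 0 \<and> w (rX - rconst \<alpha>) = w (rconst c)) \<and>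
     (\<forall>c. w (rconst c) = w (rX - rconst \<alpha>) \<longrightarrow>
        w (rX - rconst \<alpha> + rconst c) = w (rX - rconst \<alpha>))"
  by (auto simp: L2_def base_value_group_def W.val_eq_iff)

lemma rX_neq_rconst [simp]: "rX \<noteq> rconst \<alpha>"
proof -
  have "rX - rconst \<alpha> = to_fract [:- \<alpha>, 1:]"
    by (simp add: rX_def rconst_def flip: to_fract_diff)
  then show ?thesis by force
qed

end

text \<open>Along F, |x - \<open>\<alpha>\<close>| lies in the same cut as T = X -
  \<open>\<alpha>\<close>. Since the value group is divisible, no positive power of T has the value
  of a nonzero constant, and W behaves like a monomial valuation. \<open>ev_neq\<close> is a
  separate condition because \<open>ev_greater\<close> is vacuous when T is smaller than all nonzero
  constants.\<close>

locale val_ext_transcendental = val_ext V W for V :: "'a::field set" and W +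
  fixes \<alpha> :: 'a and F :: "'a filter"
  assumes small: small_values and L1: "\<alpha> \<in> L1 W"
    and ev_less: "\<And>c. c \<noteq> 0 \<Longrightarrow> w (rX - rconst \<alpha>) < w (rconst c) \<Longrightarrow>
      eventually (\<lambda>x. n (x - \<alpha>) < n c) F"
    and ev_greater: "\<And>c. c \<noteq> 0 \<Longrightarrow> w (rconst c) < w (rX - rconst \<alpha>) \<Longrightarrow>
      eventually (\<lambda>x. n c < n (x - \<alpha>)) F"
    and ev_neq: "eventually (\<lambda>x. x \<noteq> \<alpha>) F"
begin

abbreviation T :: "'a poly fract" where "T \<equiv> rX - rconst \<alpha>"

text \<open>By divisibility |d| = |u^m| for some u, and comparing T^m with d amounts to comparing T
  with u.\<close>

lemma power_tracked:
  assumes "d \<noteq> 0" "m > 0"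
  shows "w (T ^ m) \<noteq> w (rconst d)"
    and "w (T ^ m) < w (rconst d) \<Longrightarrow> eventually (\<lambda>x. n ((x - \<alpha>) ^ m) < n d) F"
    and "w (rconst d) < w (T ^ m) \<Longrightarrow> eventually (\<lambda>x. n d < n ((x - \<alpha>) ^ m)) F"
proof -
  obtain u where u: "u \<noteq> 0" "n (u ^ m) = n d"
    using exists_nrm_root[OF small assms] by blast
  have d: "w (rconst d) = w (rconst u ^ m)"
    using u(2) w_rconst_eq_iff[of "u ^ m" d] by simp
  show "w (T ^ m) \<noteq> w (rconst d)"
    unfolding d using L1 u(1) assms(2) by (simp add: W.nrm_power_eq_iff L1_iff)
  show "eventually (\<lambda>x. n ((x - \<alpha>) ^ m) < n d) F" if "w (T ^ m) < w (rconst d)"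
  proof -
    have "w T < w (rconst u)"
      using that assms(2) unfolding d by (simp add: W.nrm_power_le_iff flip: W.nrm_not_le)
    from ev_less[OF u(1) this] show ?thesis
      by (rule eventually_mono) (simp add: nrm_power_strict_mono assms flip: u(2))
  qed
  show "eventually (\<lambda>x. n d < n ((x - \<alpha>) ^ m)) F" if "w (rconst d) < w (T ^ m)"
  proof -
    have "w (rconst u) < w T"
      using that assms(2) unfolding d by (simp add: W.nrm_power_le_iff flip: W.nrm_not_le)
    from ev_greater[OF u(1) this] show ?thesis
      by (rule eventually_mono) (simp add: nrm_power_strict_mono assms flip: u(2))
  qed
qed

lemma monomial_eq:
  assumes "a \<noteq> 0" "b \<noteq> 0" "w (rconst a * T ^ k) = w (rconst b * T ^ l)"
  shows "k = l \<and> n a = n b"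
  using assms
proof (induction k l arbitrary: a b rule: linorder_wlog)
  case (le k l)
  have eq: "w (rconst a * T ^ k) = w (rconst b * T ^ (l - k) * T ^ k)"
    using le by (simp add: mult.assoc flip: power_add)
  then have *: "w (rconst a) = w (rconst b * T ^ (l - k))"
    by (simp add: order_eq_iff W.nrm_mult_le_cancel)
  show ?case
  proof (cases "k = l")
    case True
    then show ?thesis using * by simp
  next
    case False
    have "w (rconst a * rconst (1 / b)) = w (rconst b * T ^ (l - k) * rconst (1 / b))"
      using * by (rule W.nrm_mult_cong) simp
    then have "w (T ^ (l - k)) = w (rconst (a / b))" using le by simp
    then show ?thesis using power_tracked(1)[of "a / b" "l - k"] le False by simp
  qed
next
  case (sym k l)
  from sym(1)[OF sym(3,2) sym(4)[symmetric]] show ?case by simp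
qed

lemma monomial_less:
  assumes "a \<noteq> 0" "b \<noteq> 0" and less: "w (rconst a * T ^ k) < w (rconst b * T ^ l)"
  shows "eventually (\<lambda>x. n (a * (x - \<alpha>) ^ k) < n (b * (x - \<alpha>) ^ l)) F"
proof (cases k l rule: linorder_cases)
  case equal
  then have "n a < n b" using less by (simp add: W.nrm_mult_less_cancel)
  then show ?thesis
    using ev_neq by (auto elim!: eventually_mono simp: equal nrm_mult_less_cancel)
next
  case less': less
  have "w (rconst a * T ^ k) < w (rconst b * T ^ (l - k) * T ^ k)"
    using less less' by (simp add: mult.assoc flip: power_add)
  then have "w (rconst a) < w (rconst b * T ^ (l - k))" by (simp add: W.nrm_mult_less_cancel)
  then have "w (rconst a * rconst (1 / b)) < w (rconst b * T ^ (l - k) * rconst (1 / b))"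
    using assms by (subst W.nrm_mult_less_cancel) auto
  then have "w (rconst (a / b)) < w (T ^ (l - k))" using assms by simp
  then have "eventually (\<lambda>x. n (a / b) < n ((x - \<alpha>) ^ (l - k))) F"
    using assms less' by (intro power_tracked(3)) auto
  then show ?thesis
    using ev_neq
  proof eventually_elim
    case (elim x)
    have "n (a / b * (b * (x - \<alpha>) ^ k)) < n ((x - \<alpha>) ^ (l - k) * (b * (x - \<alpha>) ^ k))"
      using elim assms by (subst nrm_mult_less_cancel) auto
    also have "a / b * (b * (x - \<alpha>) ^ k) = a * (x - \<alpha>) ^ k" using assms by simp
    also have "(x - \<alpha>) ^ (l - k) * (b * (x - \<alpha>) ^ k) = b * (x - \<alpha>) ^ l"
      using less' by (simp add: mult.left_commute flip: power_add)
    finally show ?case .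
  qed
next
  case greater
  have "w (rconst a * T ^ (k - l) * T ^ l) < w (rconst b * T ^ l)"
    using less greater by (simp add: mult.assoc flip: power_add)
  then have "w (rconst a * T ^ (k - l)) < w (rconst b)" by (simp add: W.nrm_mult_less_cancel)
  then have "w (rconst a * T ^ (k - l) * rconst (1 / a)) < w (rconst b * rconst (1 / a))"
    using assms by (subst W.nrm_mult_less_cancel) auto
  then have "w (T ^ (k - l)) < w (rconst (b / a))" using assms by simp
  then have "eventually (\<lambda>x. n ((x - \<alpha>) ^ (k - l)) < n (b / a)) F"
    using assms greater by (intro power_tracked(2)) auto
  then show ?thesis
    using ev_neq
  proof eventually_elim
    case (elim x)
    have "n ((x - \<alpha>) ^ (k - l) * (a * (x - \<alpha>) ^ l)) < n (b / a * (a * (x - \<alpha>) ^ l))"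
      using elim assms by (subst nrm_mult_less_cancel) auto
    also have "b / a * (a * (x - \<alpha>) ^ l) = b * (x - \<alpha>) ^ l" using assms by simp
    also have "(x - \<alpha>) ^ (k - l) * (a * (x - \<alpha>) ^ l) = a * (x - \<alpha>) ^ k"
      using greater by (simp add: mult.left_commute flip: power_add)
    finally show ?case .
  qed
qed

text \<open>In f = T g + f(\<open>\<alpha>\<close>) the product behaves like a monomial of positive
  degree, whose value is never that of a nonzero constant. So one of the two summands strictly
  dominates, in W as well as along F.\<close>

lemma poly_monomial:
  assumes "f \<noteq> 0"
  shows "\<exists>a k. a \<noteq> 0 \<and> w (to_fract f) = w (rconst a * T ^ k) \<and>
    eventually (\<lambda>x. n (poly f x) = n (a * (x - \<alpha>) ^ k)) F"
  using assms
proof (induction "degree f" arbitrary: f)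
  case 0
  then obtain a where "f = [:a:]" by (metis degree_eq_zeroE)
  then show ?case using 0 by (intro exI[of _ a] exI[of _ 0]) (auto simp: rconst_def)
next
  case (Suc m)
  then have "degree f > 0" by simp
  define c where "c = poly f \<alpha>"
  from poly_split[OF \<open>degree f > 0\<close>, of \<alpha>] obtain g where g: "degree f = Suc (degree g)"
    "lead_coeff g = lead_coeff f" "\<And>s. poly f s = (s - \<alpha>) * poly g s + c"
    "to_fract f = T * to_fract g + rconst c" unfolding c_def by metis
  have "g \<noteq> 0" using g(2) Suc.prems by auto
  then obtain a k where ak: "a \<noteq> 0" "w (to_fract g) = w (rconst a * T ^ k)"
    "eventually (\<lambda>x. n (poly g x) = n (a * (x - \<alpha>) ^ k)) F"
    using Suc.hyps(1)[of g] Suc.hyps(2) g(1) by auto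
  have wT: "w (T * to_fract g) = w (rconst a * T ^ Suc k)"
    using W.nrm_mult_cong[OF refl ak(2), of T] by (simp add: mult.left_commute)
  have ev: "eventually (\<lambda>x. n ((x - \<alpha>) * poly g x) = n (a * (x - \<alpha>) ^ Suc k)) F"
    using ak(3)
  proof eventually_elim
    case (elim x)
    then show ?case using nrm_mult_cong[OF refl elim, of "x - \<alpha>"] by (simp add: mult.left_commute)
  qed
  show ?case
  proof (cases "c = 0")
    case True
    then show ?thesis using ak(1) wT ev g by (intro exI[of _ a] exI[of _ "Suc k"]) simp
  next
    case False
    have c0: "rconst c * T ^ 0 = rconst c" by simp
    have "w (rconst c * T ^ 0) \<noteq> w (rconst a * T ^ Suc k)"
      using monomial_eq[OF False ak(1), of 0 "Suc k"] by auto
    then consider "w (rconst c * T ^ 0) < w (rconst a * T ^ Suc k)"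
      | "w (rconst a * T ^ Suc k) < w (rconst c * T ^ 0)"
      using W.nrm_linear by (metis order_le_less)
    then show ?thesis
    proof cases
      case 1
      from monomial_less[OF False ak(1) 1] ev
      have "eventually (\<lambda>x. n (poly f x) = n (a * (x - \<alpha>) ^ Suc k)) F"
      proof eventually_elim
        case (elim x)
        then show ?case
          using g(3)[of x] nrm_add_eq_left[of c "(x - \<alpha>) * poly g x"] by simp
      qed
      moreover have "w (to_fract f) = w (rconst a * T ^ Suc k)"
        using g(4) W.nrm_add_eq_left[of "rconst c" "T * to_fract g"] 1 wT c0 by metis
      ultimately show ?thesis using ak(1) by blast
    next
      case 2
      from monomial_less[OF ak(1) False 2] ev
      have "eventually (\<lambda>x. n (poly f x) = n (c * (x - \<alpha>) ^ 0)) F"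
      proof eventually_elim
        case (elim x)
        then show ?case
          using g(3)[of x] nrm_add_eq_right[of "(x - \<alpha>) * poly g x" c] by simp
      qed
      moreover have "w (to_fract f) = w (rconst c * T ^ 0)"
        using g(4) W.nrm_add_eq_right[of "T * to_fract g" "rconst c"] 2 wT c0 by metis
      ultimately show ?thesis using False by blast
    qed
  qed
qed

lemma eq_VF:
  assumes "F \<noteq> bot"
  shows "W = VF V F"
proof (rule eq_VF_if_tracked[OF assms])
  fix p q :: "'a poly"
  show less: "eventually (\<lambda>x. n (poly p x) < n (poly q x)) F" if "w (to_fract p) < w (to_fract q)"
    for p q :: "'a poly"
  proof -
    have "q \<noteq> 0" using that by auto
    then obtain b l where q: "b \<noteq> 0" "w (to_fract q) = w (rconst b * T ^ l)"
      "eventually (\<lambda>x. n (poly q x) = n (b * (x - \<alpha>) ^ l)) F"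
      using poly_monomial by blast
    show ?thesis
    proof (cases "p = 0")
      case True
      have "eventually (\<lambda>x. n (poly q x) \<noteq> n 0) F"
        using q(3) ev_neq by eventually_elim (use q(1) in simp)
      then show ?thesis by (rule eventually_mono) (simp add: True)
    next
      case False
      then obtain a k where p: "a \<noteq> 0" "w (to_fract p) = w (rconst a * T ^ k)"
        "eventually (\<lambda>x. n (poly p x) = n (a * (x - \<alpha>) ^ k)) F"
        using poly_monomial by blast
      have "eventually (\<lambda>x. n (a * (x - \<alpha>) ^ k) < n (b * (x - \<alpha>) ^ l)) F"
        using that p q by (intro monomial_less) auto
      then show ?thesis using p(3) q(3) by eventually_elim simp
    qed
  qed
  show "eventually (\<lambda>x. n (poly p x) \<le> n (poly q x)) F" if le: "w (to_fract p) \<le> w (to_fract q)"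
  proof (cases "w (to_fract p) = w (to_fract q)")
    case False
    then have "w (to_fract p) < w (to_fract q)" using le by (simp add: order_less_le)
    from less[OF this] show ?thesis by (rule eventually_mono) auto
  next
    case True
    show ?thesis
    proof (cases "p = 0")
      case False
      then have "q \<noteq> 0" using True by auto
      then obtain b l where q: "b \<noteq> 0" "w (to_fract q) = w (rconst b * T ^ l)"
        "eventually (\<lambda>x. n (poly q x) = n (b * (x - \<alpha>) ^ l)) F"
        using poly_monomial by blast
      obtain a k where p: "a \<noteq> 0" "w (to_fract p) = w (rconst a * T ^ k)"
        "eventually (\<lambda>x. n (poly p x) = n (a * (x - \<alpha>) ^ k)) F"
        using poly_monomial[OF False] by blast
      \<comment> \<open>Equal values in W force equal exponents and |a| = |b|, so |p| and |q| even
        agree along F; tracking strict inequalities would not settle this case.\<close>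
      have "k = l" "n a = n b" using monomial_eq[OF p(1) q(1), of k l] p q True by auto
      then have "n (a * (x - \<alpha>) ^ k) = n (b * (x - \<alpha>) ^ l)" for x by (intro nrm_mult_cong) auto
      then show ?thesis using p(3) q(3) by (auto elim: eventually_elim2)
    qed simp
  qed
qed

end


lemma eventually_tails_Field: "index_order r \<Longrightarrow> eventually (\<lambda>i. i \<in> Field r) (tails r)"
  by (auto simp: eventually_tails_strict index_order_def Field_def)

lemma index_order_FieldD: "(i, j) \<in> r - Id \<Longrightarrow> i \<in> Field r \<and> j \<in> Field r"
  by (auto simp: Field_def)

section \<open>Sequences that fill the cut at a point of L1\<close>

context val_ext
begin

text \<open>The constants above the cut of X - \<open>\<alpha>\<close> have no smallest absolute
  value. Translating a family of them that descends cofinally to the cut by \<open>\<alpha>\<close>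
  fills the cut from above.\<close>

lemma exists_pseudo_convergent_L1:
  assumes small: small_values and L1: "\<alpha> \<in> L1 W"
    and ne: "c0 \<noteq> 0" "w (rX - rconst \<alpha>) < w (rconst c0)"
    and nomin: "\<And>c. c \<noteq> 0 \<Longrightarrow> w (rX - rconst \<alpha>) < w (rconst c) \<Longrightarrow>
      \<exists>d. d \<noteq> 0 \<and> w (rX - rconst \<alpha>) < w (rconst d) \<and> n d < n c"
  shows "\<exists>(r :: 'a rel) (s :: 'a \<Rightarrow> 'a).
    pseudo_convergent V r s \<and> algebraic_type V r s \<and> W = VE V r s"
proof -
  define S where "S = {c. c \<noteq> 0 \<and> w (rX - rconst \<alpha>) < w (rconst c)}"
  \<comment> \<open>Inverses turn the descent of the constants into the ascent that the construction
    of well-orders expects.\<close>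
  have "\<exists>r :: 'a rel. index_order r \<and> Field r \<subseteq> S \<and>
    (\<forall>i j. (i, j) \<in> r - Id \<longrightarrow> n (inverse i) < n (inverse j)) \<and>
    (\<forall>x\<in>S. \<exists>i\<in>Field r. n (inverse x) \<le> n (inverse i))"
  proof (rule cofinal_well_order)
    show "S \<noteq> {}" using ne by (auto simp: S_def)
    show "n (inverse x) \<le> n (inverse y) \<or> n (inverse y) \<le> n (inverse x)" for x y
      by (rule nrm_linear)
    show "\<exists>y\<in>S. n (inverse x) < n (inverse y)" if x: "x \<in> S" for x
    proof -
      obtain d where d: "d \<in> S" "n d < n x" using nomin[of x] x unfolding S_def by blast
      then have "n (inverse x) < n (inverse d)"
        using x by (subst nrm_inverse_less_iff) (auto simp: S_def)
      then show ?thesis using d(1) by blast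
    qed
  qed
  then obtain r :: "'a rel" where r: "index_order r" and RS: "Field r \<subseteq> S"
    and inc: "\<And>i j. (i, j) \<in> r - Id \<Longrightarrow> n (inverse i) < n (inverse j)"
    and cof: "\<And>x. x \<in> S \<Longrightarrow> \<exists>i\<in>Field r. n (inverse x) \<le> n (inverse i)" by metis
  have nz: "i \<noteq> 0" if "i \<in> Field r" for i using that RS by (auto simp: S_def)
  have dec: "n j < n i" if ij: "(i, j) \<in> r - Id" for i j
  proof -
    have "i \<noteq> 0" "j \<noteq> 0" using index_order_FieldD[OF ij] nz by auto
    then show ?thesis using inc[OF ij] by (simp add: nrm_inverse_less_iff)
  qed
  define F where "F = filtermap (\<lambda>i. \<alpha> + i) (tails r)"
  have ev: "eventually P F \<longleftrightarrow> eventually (\<lambda>i. P (\<alpha> + i)) (tails r)" for P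
    by (simp add: F_def eventually_filtermap)
  interpret val_ext_transcendental V W \<alpha> F
  proof
    show small_values by fact
    show "\<alpha> \<in> L1 W" by fact
    show "eventually (\<lambda>x. x \<noteq> \<alpha>) F"
      unfolding ev using eventually_tails_Field[OF r] by (rule eventually_mono) (use nz in auto)
    show "eventually (\<lambda>x. n (x - \<alpha>) < n c) F"
      if c: "c \<noteq> 0" "w (rX - rconst \<alpha>) < w (rconst c)" for c
    proof -
      have "c \<in> S" using c by (simp add: S_def)
      then obtain i where i: "i \<in> Field r" "n (inverse c) \<le> n (inverse i)" using cof by blast
      then have "n i \<le> n c" using nz c by (simp add: nrm_inverse_le_iff)
      then have "n j < n c" if "(i, j) \<in> r - Id" for j using dec[OF that] by simp
      then show ?thesis unfolding ev eventually_tails_strict[OF r] using i(1) by auto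
    qed
    show "eventually (\<lambda>x. n c < n (x - \<alpha>)) F"
      if c: "c \<noteq> 0" "w (rconst c) < w (rX - rconst \<alpha>)" for c
    proof -
      have "n c < n j" if "j \<in> Field r" for j
      proof -
        have "w (rX - rconst \<alpha>) < w (rconst j)" using that RS by (auto simp: S_def)
        with c(2) have "w (rconst c) < w (rconst j)" by (rule less_trans)
        then show ?thesis by simp
      qed
      then show ?thesis
        unfolding ev using eventually_tails_Field[OF r] by (auto elim: eventually_mono)
    qed
  qed
  have "F \<noteq> bot" using tails_not_bot[OF r] by (simp add: F_def filtermap_bot_iff)
  then have "W = VE V r (\<lambda>i. \<alpha> + i)" using eq_VF by (simp add: VE_eq_VF F_def)
  then show ?thesis using pseudo_convergent_if_decreasing[OF r dec] by blast
qed

lemma exists_pseudo_divergent_L1: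
  assumes small: small_values and L1: "\<alpha> \<in> L1 W"
    and ne: "c0 \<noteq> 0" "w (rconst c0) < w (rX - rconst \<alpha>)"
    and nomax: "\<And>c. c \<noteq> 0 \<Longrightarrow> w (rconst c) < w (rX - rconst \<alpha>) \<Longrightarrow>
      \<exists>d. d \<noteq> 0 \<and> w (rconst d) < w (rX - rconst \<alpha>) \<and> n c < n d"
  shows "\<exists>(r :: 'a rel) (s :: 'a \<Rightarrow> 'a). pseudo_divergent V r s \<and> W = VE V r s"
proof -
  define S where "S = {c. c \<noteq> 0 \<and> w (rconst c) < w (rX - rconst \<alpha>)}"
  have "\<exists>r :: 'a rel. index_order r \<and> Field r \<subseteq> S \<and>
    (\<forall>i j. (i, j) \<in> r - Id \<longrightarrow> n i < n j) \<and> (\<forall>x\<in>S. \<exists>i\<in>Field r. n x \<le> n i)"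
  proof (rule cofinal_well_order)
    show "S \<noteq> {}" using ne by (auto simp: S_def)
    show "n x \<le> n y \<or> n y \<le> n x" for x y by (rule nrm_linear)
    show "\<exists>y\<in>S. n x < n y" if "x \<in> S" for x using nomax[of x] that unfolding S_def by blast
  qed
  then obtain r :: "'a rel" where r: "index_order r" and RS: "Field r \<subseteq> S"
    and inc: "\<And>i j. (i, j) \<in> r - Id \<Longrightarrow> n i < n j"
    and cof: "\<And>x. x \<in> S \<Longrightarrow> \<exists>i\<in>Field r. n x \<le> n i" by metis
  define F where "F = filtermap (\<lambda>i. \<alpha> + i) (tails r)"
  have ev: "eventually P F \<longleftrightarrow> eventually (\<lambda>i. P (\<alpha> + i)) (tails r)" for P
    by (simp add: F_def eventually_filtermap)
  interpret val_ext_transcendental V W \<alpha> F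
  proof
    show small_values by fact
    show "\<alpha> \<in> L1 W" by fact
    show "eventually (\<lambda>x. x \<noteq> \<alpha>) F"
      unfolding ev using eventually_tails_Field[OF r]
      by (rule eventually_mono) (use RS in \<open>auto simp: S_def\<close>)
    show "eventually (\<lambda>x. n c < n (x - \<alpha>)) F"
      if c: "c \<noteq> 0" "w (rconst c) < w (rX - rconst \<alpha>)" for c
    proof -
      have "c \<in> S" using c by (simp add: S_def)
      then obtain i where i: "i \<in> Field r" "n c \<le> n i" using cof by blast
      then have "n c < n j" if "(i, j) \<in> r - Id" for j using inc[OF that] by simp
      then show ?thesis unfolding ev eventually_tails_strict[OF r] using i(1) by auto
    qed
    show "eventually (\<lambda>x. n (x - \<alpha>) < n c) F"
      if c: "c \<noteq> 0" "w (rX - rconst \<alpha>) < w (rconst c)" for c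
    proof -
      have "n j < n c" if "j \<in> Field r" for j
      proof -
        have "w (rconst j) < w (rX - rconst \<alpha>)" using that RS by (auto simp: S_def)
        then have "w (rconst j) < w (rconst c)" using c(2) by (rule less_trans)
        then show ?thesis by simp
      qed
      then show ?thesis
        unfolding ev using eventually_tails_Field[OF r] by (auto elim: eventually_mono)
    qed
  qed
  have "F \<noteq> bot" using tails_not_bot[OF r] by (simp add: F_def filtermap_bot_iff)
  then have "W = VE V r (\<lambda>i. \<alpha> + i)" using eq_VF by (simp add: VE_eq_VF F_def)
  then show ?thesis using pseudo_divergent_if_increasing[OF r inc] by blast
qed

lemma L1_dichotomy: "\<alpha> \<in> L1 W \<Longrightarrow> c \<noteq> 0 \<Longrightarrow> w (rX - rconst \<alpha>) < w (rconst c) \<or> w (rconst c) < w (rX - rconst \<alpha>)"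
  using W.nrm_linear[of "rX - rconst \<alpha>" "rconst c"] by (auto simp: L1_iff order_less_le)

text \<open>If neither side of the cut could be used, there would be a smallest absolute value d
  above it and a largest c below it; a nontrivial valuation has elements on both sides. Density of
  the value group leaves no room for such a neighbouring pair.\<close>

lemma exists_pseudo_monotone_L1:
  assumes "V \<noteq> UNIV" and small: small_values and L1: "\<alpha> \<in> L1 W"
  shows "\<exists>(r :: 'a rel) (s :: 'a \<Rightarrow> 'a). pseudo_monotone V r s \<and> W = VE V r s"
proof (rule ccontr)
  assume neg: "\<not> ?thesis"
  let ?T = "rX - rconst \<alpha>"
  note dich = L1_dichotomy[OF L1]
  have no_pc: "(\<exists>d. d \<noteq> 0 \<and> w ?T < w (rconst d) \<and> (\<forall>c. c \<noteq> 0 \<longrightarrow> w ?T < w (rconst c) \<longrightarrow> n d \<le> n c))"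
    if "c0 \<noteq> 0" "w ?T < w (rconst c0)" for c0
    using exists_pseudo_convergent_L1[OF small L1 that] neg
    unfolding pseudo_monotone_def by (meson nrm_not_less)
  have no_pd: "(\<exists>d. d \<noteq> 0 \<and> w (rconst d) < w ?T \<and> (\<forall>c. c \<noteq> 0 \<longrightarrow> w (rconst c) < w ?T \<longrightarrow> n c \<le> n d))"
    if "c0 \<noteq> 0" "w (rconst c0) < w ?T" for c0
    using exists_pseudo_divergent_L1[OF small L1 that] neg
    unfolding pseudo_monotone_def by (meson nrm_not_less)
  have "\<exists>c0. c0 \<noteq> 0 \<and> w ?T < w (rconst c0)"
  proof (rule ccontr)
    assume none: "\<not> ?thesis"
    then have "w (rconst 1) < w ?T" using dich[of 1] by (metis zero_neq_one)
    then obtain d where d: "d \<noteq> 0" "w (rconst d) < w ?T"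
      "\<And>c. c \<noteq> 0 \<Longrightarrow> w (rconst c) < w ?T \<Longrightarrow> n c \<le> n d" using no_pd[of 1] by (metis zero_neq_one)
    obtain e where e: "e \<noteq> 0" "n d < n e" using exists_nrm_greater[OF assms(1)] by blast
    then have "n e \<le> n d" using d(3) none dich by blast
    then show False using e(2) by simp
  qed
  then obtain d where d: "d \<noteq> 0" "w ?T < w (rconst d)"
    "\<And>c. c \<noteq> 0 \<Longrightarrow> w ?T < w (rconst c) \<Longrightarrow> n d \<le> n c" using no_pc by blast
  obtain e where "e \<noteq> 0" "n e < n d" using exists_nrm_less[OF assms(1) d(1)] by blast
  then have "w (rconst e) < w ?T" using d(3)[of e] dich[of e] by (auto simp: less_le_not_le)
  then obtain c where c: "c \<noteq> 0" "w (rconst c) < w ?T"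
    "\<And>c'. c' \<noteq> 0 \<Longrightarrow> w (rconst c') < w ?T \<Longrightarrow> n c' \<le> n c" using no_pd \<open>e \<noteq> 0\<close> by blast
  have "w (rconst c) < w (rconst d)" using c(2) d(2) by (rule less_trans)
  then have "n c < n d" by simp
  then obtain e where e: "e \<noteq> 0" "n c < n e" "n e < n d"
    using exists_nrm_between[OF small c(1)] by blast
  then show False using dich[OF e(1)] c(3)[OF e(1)] d(3)[OF e(1)] by (auto simp: less_le_not_le)
qed

text \<open>A nonzero constant x never has the value of X - \<open>\<alpha>\<close>, so the larger
  of the two decides the value of their difference. If X - \<open>\<alpha>\<close> dominates, the
  value stays outside the group; if x dominates, it falls into it. Thus I consists of the constants
  below the cut.\<close>

lemma L1_ball:
  assumes "\<alpha> \<in> L1 W"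
  shows "\<alpha> + x \<in> L1 W \<longleftrightarrow> w (rconst x) < w (rX - rconst \<alpha>)"
proof (cases "x = 0")
  case True
  then show ?thesis using assms by (simp add: L1_iff)
next
  case False
  have eq: "rX - rconst (\<alpha> + x) = (rX - rconst \<alpha>) - rconst x" by simp
  from L1_dichotomy[OF assms False] show ?thesis
  proof
    assume less: "w (rconst x) < w (rX - rconst \<alpha>)"
    then have "w (rX - rconst (\<alpha> + x)) = w (rX - rconst \<alpha>)"
      unfolding eq by (rule W.nrm_diff_eq_left)
    then show ?thesis using less assms by (simp add: L1_iff)
  next
    assume less: "w (rX - rconst \<alpha>) < w (rconst x)"
    then have "w (rX - rconst (\<alpha> + x)) = w (rconst x)"
      unfolding eq by (rule W.nrm_diff_eq_right)
    then show ?thesis using less False unfolding L1_iff by force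
  qed
qed

lemma L1_coset:
  assumes "L1 W = (\<lambda>x. \<alpha> + x) ` I" "0 \<in> I"
  shows "\<alpha> \<in> L1 W" "x \<in> I \<longleftrightarrow> w (rconst x) < w (rX - rconst \<alpha>)"
proof -
  show *: "\<alpha> \<in> L1 W" using assms by (auto simp: image_iff intro: bexI[of _ 0])
  show "x \<in> I \<longleftrightarrow> w (rconst x) < w (rX - rconst \<alpha>)"
    using L1_ball[OF *, of x] assms(1) by auto
qed

lemma principal_fractional_ideal_iff:
  "principal_fractional_ideal V I \<longleftrightarrow> (\<exists>c. \<forall>x. x \<in> I \<longleftrightarrow> n x \<le> n c)"
proof -
  have "I = (\<lambda>a. c * a) ` V \<longleftrightarrow> (\<forall>x. x \<in> I \<longleftrightarrow> n x \<le> n c)" for c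
    by (auto simp: nrm_le_iff mult.commute)
  then show ?thesis by (simp add: principal_fractional_ideal_def)
qed

text \<open>Suppose c were smallest above the cut. Then I is the open ball of radius |c|. By density
  every closed ball containing I contains c, and divisoriality puts c into I, a contradiction. The
  common denominator d of I only serves to find a constant above the cut, namely any e larger than
  1/d.\<close>

lemma exists_pseudo_convergent_divisorial:
  assumes "V \<noteq> UNIV" and small: small_values
    and L1: "L1 W = (\<lambda>x. \<alpha> + x) ` I" and frac: "fractional_ideal V I" and div: "divisorial V I"
  shows "\<exists>(r :: 'a rel) (s :: 'a \<Rightarrow> 'a).
    pseudo_convergent V r s \<and> algebraic_type V r s \<and> W = VE V r s"
proof -
  have "0 \<in> I" using frac by (simp add: fractional_ideal_def)
  note I = L1_coset[OF L1 this]
  let ?T = "rX - rconst \<alpha>"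
  note dich = L1_dichotomy[OF I(1)]
  obtain d where "d \<in> V - {0}" "\<forall>x\<in>I. d * x \<in> V"
    using frac unfolding fractional_ideal_def by blast
  then have d: "d \<noteq> 0" "\<And>x. x \<in> I \<Longrightarrow> d * x \<in> V" by auto
  obtain e where e: "e \<noteq> 0" "n (1 / d) < n e" using exists_nrm_greater[OF assms(1)] by blast
  have "e \<notin> I"
  proof
    assume "e \<in> I"
    then have "n (d * e) \<le> n 1" using d by (simp add: nrm_le_one_iff)
    moreover have "n (d * (1 / d)) < n (d * e)" using e d(1) by (intro nrm_mult_strict_mono') auto
    ultimately show False using d(1) by auto
  qed
  then have ne: "w ?T < w (rconst e)" using I(2) dich[OF e(1)] by blast
  show ?thesis
  proof (rule exists_pseudo_convergent_L1[OF small I(1) e(1) ne], rule ccontr)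
    fix c assume c: "c \<noteq> 0" "w ?T < w (rconst c)"
      and no: "\<not> (\<exists>d. d \<noteq> 0 \<and> w ?T < w (rconst d) \<and> n d < n c)"
    have mem: "x \<in> I" if "n x < n c" for x
    proof (cases "x = 0")
      case False
      then have "\<not> w ?T < w (rconst x)" using no that by metis
      then show ?thesis using dich[OF False] I(2)[of x] by metis
    qed (simp add: \<open>0 \<in> I\<close>)
    have "c \<in> J" if J: "principal_fractional_ideal V J" "I \<subseteq> J" for J
    proof (rule ccontr)
      assume "c \<notin> J"
      obtain b where b: "\<And>x. x \<in> J \<longleftrightarrow> n x \<le> n b" using J(1) by (auto simp: principal_fractional_ideal_iff)
      have bc: "n b < n c" using \<open>c \<notin> J\<close> b by (simp add: nrm_not_le)
      have "\<exists>x. n b < n x \<and> n x < n c"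
      proof (cases "b = 0")
        case True
        then show ?thesis using exists_nrm_less[OF assms(1) c(1)] by auto
      next
        case False
        then show ?thesis using exists_nrm_between[OF small False bc] by blast
      qed
      then obtain x where x: "n b < n x" "n x < n c" by blast
      then have "x \<in> J" using mem J(2) by blast
      then show False using b x(1) by auto
    qed
    then have "c \<in> I" using div unfolding divisorial_def by blast
    then show False using I(2) c(2) by auto
  qed
qed

text \<open>A member c of I with largest absolute value would make I = cV. So the constants below
  the cut have no largest one; starting from 0 in I, this also provides a nonzero constant below
  it.\<close>

lemma exists_pseudo_divergent_nonprincipal:
  assumes small: small_values
    and L1: "L1 W = (\<lambda>x. \<alpha> + x) ` I" and "0 \<in> I" and np: "\<not> principal_fractional_ideal V I"
  shows "\<exists>(r :: 'a rel) (s :: 'a \<Rightarrow> 'a). pseudo_divergent V r s \<and> W = VE V r s"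
proof -
  note I = L1_coset[OF L1 \<open>0 \<in> I\<close>]
  let ?T = "rX - rconst \<alpha>"
  have larger: "\<exists>d. d \<in> I \<and> n c < n d" if "c \<in> I" for c
  proof (rule ccontr)
    assume no: "\<not> ?thesis"
    have "x \<in> I \<longleftrightarrow> n x \<le> n c" for x
    proof
      assume "x \<in> I"
      then show "n x \<le> n c" using no by (auto simp: nrm_not_less)
    next
      assume "n x \<le> n c"
      then have "w (rconst x) \<le> w (rconst c)" by simp
      also have "\<dots> < w ?T" using that I(2) by blast
      finally show "x \<in> I" using I(2) by blast
    qed
    then show False using np by (auto simp: principal_fractional_ideal_iff)
  qed
  obtain c0 where c0: "c0 \<in> I" "n 0 < n c0" using larger[OF \<open>0 \<in> I\<close>] by blast
  show ?thesis
  proof (rule exists_pseudo_divergent_L1[OF small I(1)])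
    show "c0 \<noteq> 0" "w (rconst c0) < w ?T" using c0 I(2) by auto
    fix c assume "w (rconst c) < w ?T"
    then have "c \<in> I" using I(2) by blast
    then obtain d where d: "d \<in> I" "n c < n d" using larger by blast
    moreover have "d \<noteq> 0" using d(2) by auto
    ultimately show "\<exists>d. d \<noteq> 0 \<and> w (rconst d) < w ?T \<and> n c < n d" using I(2) by blast
  qed
qed

end


section \<open>Sequences for points of L2 and for empty L(W)\<close>

context val_ext
begin

text \<open>The points v i have mutual distances |c| = |X - \<open>\<alpha>\<close>|. An x0 farther
  than |c| from \<open>\<alpha>\<close> has the same distance to all of them and to X. Any other x0
  has distance |c| to X, by the condition defining L2, and is closer than |c| to at most one v i. So
  linear polynomials are eventually constant in absolute value.\<close>

lemma exists_pseudo_monotone_L2: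
  assumes "V \<noteq> UNIV" and small: small_values and L2: "\<alpha> \<in> L2 W"
  shows "\<exists>(r :: 'a rel) (s :: 'a \<Rightarrow> 'a). pseudo_monotone V r s \<and> W = VE V r s"
proof -
  let ?T = "rX - rconst \<alpha>"
  obtain c where c: "c \<noteq> 0" "w ?T = w (rconst c)"
    and L2': "\<And>d. w (rconst d) = w ?T \<Longrightarrow> w (?T + rconst d) = w ?T"
    using L2 by (auto simp: L2_iff)
  obtain u :: "nat \<Rightarrow> 'a" where u: "\<And>i j. i \<noteq> j \<Longrightarrow> n (u i - u j) = n 1"
    using exists_residue_sequence[OF small] by blast
  \<comment> \<open>Subtracting u 0 makes v 0 = \<open>\<alpha>\<close>, so the distance of v i from
    \<open>\<alpha>\<close> is a special case of the mutual distances.\<close>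
  define v where "v i = \<alpha> + c * (u i - u 0)" for i
  have v_diff: "n (v i - v j) = n c" if "i \<noteq> j" for i j
  proof -
    have "v i - v j = c * (u i - u j)" by (simp add: v_def algebra_simps)
    then show ?thesis using nrm_mult_cong[OF refl u[OF that], of c] by simp
  qed
  have v_near: "n (v i - \<alpha>) \<le> n c" for i
    using v_diff[of i 0] by (cases "i = 0") (auto simp: v_def)
  have "inj v"
  proof (rule injI, rule ccontr)
    fix i j assume "v i = v j" "i \<noteq> j"
    then show False using v_diff[of i j] c(1) by (metis cancel_comm_monoid_add_class.diff_cancel nrm_eq_zero_iff)
  qed
  \<comment> \<open>The natural numbers are carried into K by v, and the position of a point in the
    enumeration is the quantity that increases.\<close>
  have "\<exists>r :: 'a rel. index_order r \<and> Field r \<subseteq> range v \<and>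
    (\<forall>i j. (i, j) \<in> r - Id \<longrightarrow> inv_into UNIV v i < inv_into UNIV v j) \<and> (\<forall>x\<in>range v. \<exists>i\<in>Field r. inv_into UNIV v x \<le> inv_into UNIV v i)"
  proof (rule cofinal_well_order)
    show "\<exists>y\<in>range v. inv_into UNIV v x < inv_into UNIV v y" for x
      using \<open>inj v\<close> by (intro bexI[of _ "v (Suc (inv_into UNIV v x))"]) auto
  qed auto
  then obtain r :: "'a rel" where r: "index_order r" and Rv: "Field r \<subseteq> range v"
    and inc: "\<And>i j. (i, j) \<in> r - Id \<Longrightarrow> inv_into UNIV v i < inv_into UNIV v j"
    and cof: "\<And>x. x \<in> range v \<Longrightarrow> \<exists>i\<in>Field r. inv_into UNIV v x \<le> inv_into UNIV v i" by metis
  have ev: "eventually P (tails r)" if "\<And>j. j > m \<Longrightarrow> P (v j)" for P m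
  proof -
    obtain i where i: "i \<in> Field r" "m \<le> inv_into UNIV v i" using cof[of "v m"] \<open>inj v\<close> by auto
    have "P j" if "(i, j) \<in> r - Id" for j
    proof -
      have "v (inv_into UNIV v j) = j" using index_order_FieldD[OF that] Rv by (auto simp: f_inv_into_f)
      moreover have "m < inv_into UNIV v j" using i(2) inc[OF that] by simp
      ultimately show ?thesis using \<open>\<And>j. j > m \<Longrightarrow> P (v j)\<close> by metis
    qed
    then show ?thesis using i(1) by (auto simp: eventually_tails_strict[OF r])
  qed
  have diff: "n (x - y) = n c" if "x \<in> Field r" "y \<in> Field r" "x \<noteq> y" for x y
    using that Rv v_diff by (metis rangeE subsetD)
  have "pseudo_stationary V r (\<lambda>i. i)"
    unfolding pseudo_stationary_def val_eq_iff using r diff by auto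
  moreover have "W = VF V (tails r)"
  proof (rule eq_VF_if_linear_constant[OF assms(1) small])
    show "tails r \<noteq> bot" using tails_not_bot[OF r] .
    fix x0
    have eq: "rX - rconst x0 = ?T + rconst (\<alpha> - x0)" by simp
    show "\<exists>c. c \<noteq> 0 \<and> w (rX - rconst x0) = w (rconst c) \<and> eventually (\<lambda>x. n (x - x0) = n c) (tails r)"
    proof (cases "n c < n (\<alpha> - x0)")
      case True
      then have "w (rX - rconst x0) = w (rconst (\<alpha> - x0))"
        unfolding eq using c(2) by (intro W.nrm_add_eq_right) (simp del: rconst_simps)
      moreover have "n (v j - x0) = n (\<alpha> - x0)" for j
      proof -
        have "n ((v j - \<alpha>) + (\<alpha> - x0)) = n (\<alpha> - x0)"
          using v_near[of j] True by (intro nrm_add_eq_right) simp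
        then show ?thesis by simp
      qed
      moreover have "\<alpha> - x0 \<noteq> 0" using True by auto
      ultimately show ?thesis by (intro exI[of _ "\<alpha> - x0"]) (auto intro: ev)
    next
      case False
      then have le: "n (\<alpha> - x0) \<le> n c" by (simp add: nrm_not_less)
      have "w (rX - rconst x0) = w (rconst c)"
      proof (cases "n (\<alpha> - x0) = n c")
        case True
        then have "w (rconst (\<alpha> - x0)) = w ?T" unfolding c(2) by (simp del: rconst_simps)
        from L2'[OF this] show ?thesis unfolding eq c(2) .
      next
        case False
        then have "w (rconst (\<alpha> - x0)) < w ?T"
          unfolding c(2) using le by (simp add: order_less_le del: rconst_simps)
        from W.nrm_add_eq_left[OF this] show ?thesis unfolding eq c(2) .
      qed
      have near: "n (v j - x0) \<le> n c" for j
        using nrm_add_le[OF v_near[of j] le] by simp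
      have "\<exists>m. \<forall>j>m. n (v j - x0) = n c"
      proof (rule ccontr)
        assume no: "\<not> ?thesis"
        then obtain j where j: "n (v j - x0) \<noteq> n c" by blast
        from no obtain j' where j': "j' > j" "n (v j' - x0) \<noteq> n c" by blast
        have "n ((v j - x0) - (v j' - x0)) < n c"
          by (rule nrm_diff_less) (use near[of j] near[of j'] j j'(2) in \<open>simp_all add: order_less_le\<close>)
        then show False using v_diff[of j j'] j'(1) by simp
      qed
      then obtain m where "\<And>j. j > m \<Longrightarrow> n (v j - x0) = n c" by blast
      then have "eventually (\<lambda>x. n (x - x0) = n c) (tails r)" by (rule ev)
      with \<open>w (rX - rconst x0) = w (rconst c)\<close> show ?thesis using c(1) by blast
    qed
  qed
  then have "W = VE V r (\<lambda>i. i)" by (simp add: VE_eq_VF filtermap_ident)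
  ultimately show ?thesis by (auto simp: pseudo_monotone_def)
qed

text \<open>No constant is a best approximation of X: x + d improves on x. A constant violating the
  condition of L2 at x has the value of X - x, and its negative is the correction d.\<close>

lemma LL_empty_iff:
  "LL W = {} \<longleftrightarrow> (\<forall>x. \<exists>d. d \<noteq> 0 \<and> w (rX - rconst x) = w (rconst d) \<and>
    w (rX - rconst (x + d)) < w (rX - rconst x))"
proof (intro iffI allI)
  fix x assume "LL W = {}"
  then have no: "x \<notin> L1 W" "x \<notin> L2 W" by (auto simp: LL_def)
  then have "\<exists>c. c \<noteq> 0 \<and> w (rX - rconst x) = w (rconst c)" by (auto simp: L1_iff)
  then obtain d where d: "w (rconst d) = w (rX - rconst x)" "w (rX - rconst x + rconst d) \<noteq> w (rX - rconst x)"
    using no(2) unfolding L2_iff by blast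
  moreover have "w (rX - rconst x + rconst d) \<le> w (rX - rconst x)"
    using d(1) by (intro W.nrm_add_le) auto
  moreover have "rX - rconst (x + - d) = rX - rconst x + rconst d" by simp
  ultimately have "w (rX - rconst (x + - d)) < w (rX - rconst x)"
    by (metis order_less_le)
  moreover have "d \<noteq> 0"
  proof
    assume "d = 0"
    then show False using d(2) by simp
  qed
  ultimately show "\<exists>d. d \<noteq> 0 \<and> w (rX - rconst x) = w (rconst d) \<and>
      w (rX - rconst (x + d)) < w (rX - rconst x)"
    using d(1) by (intro exI[of _ "- d"]) auto
next
  assume *: "\<forall>x. \<exists>d. d \<noteq> 0 \<and> w (rX - rconst x) = w (rconst d) \<and>
    w (rX - rconst (x + d)) < w (rX - rconst x)"
  have "x \<notin> L1 W \<and> x \<notin> L2 W" for x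
  proof -
    obtain d where d: "d \<noteq> 0" "w (rX - rconst x) = w (rconst d)"
      "w (rX - rconst (x + d)) < w (rX - rconst x)" using * by blast
    have "w (rX - rconst x + rconst (- d)) \<noteq> w (rX - rconst x)" "w (rconst (- d)) = w (rX - rconst x)"
      using d(2,3) by (auto simp: algebra_simps)
    then show ?thesis using d unfolding L1_iff L2_iff by blast
  qed
  then show "LL W = {}" by (auto simp: LL_def)
qed

text \<open>Points of K that approach X cofinally form the sequence. As soon as j is closer to X
  than x0 is, |j - x0| = |X - x0|, so linear polynomials have constant absolute value along
  it.\<close>

lemma exists_pseudo_convergent_LL:
  assumes "V \<noteq> UNIV" and small: small_values and LL: "LL W = {}"
  shows "\<exists>(r :: 'a rel) (s :: 'a \<Rightarrow> 'a). pseudo_convergent V r s \<and> W = VE V r s"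
proof -
  let ?T = "\<lambda>x. rX - rconst x"
  have inv: "w (inverse (?T x)) < w (inverse (?T y)) \<longleftrightarrow> w (?T y) < w (?T x)"
    "w (inverse (?T x)) \<le> w (inverse (?T y)) \<longleftrightarrow> w (?T y) \<le> w (?T x)" for x y
    by (auto simp: W.nrm_inverse_less_iff W.nrm_inverse_le_iff)
  have "\<exists>r :: 'a rel. index_order r \<and> Field r \<subseteq> UNIV \<and>
    (\<forall>i j. (i, j) \<in> r - Id \<longrightarrow> w (inverse (?T i)) < w (inverse (?T j))) \<and>
    (\<forall>x\<in>UNIV. \<exists>i\<in>Field r. w (inverse (?T x)) \<le> w (inverse (?T i)))"
  proof (rule cofinal_well_order)
    show "w (inverse (?T x)) \<le> w (inverse (?T y)) \<or> w (inverse (?T y)) \<le> w (inverse (?T x))" for x y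
      by (rule W.nrm_linear)
    show "\<exists>y\<in>UNIV. w (inverse (?T x)) < w (inverse (?T y))" for x
      unfolding inv using LL LL_empty_iff by blast
  qed simp
  then obtain r :: "'a rel" where r: "index_order r"
    and dec: "\<And>i j. (i, j) \<in> r - Id \<Longrightarrow> w (?T j) < w (?T i)"
    and cof: "\<And>x. \<exists>i\<in>Field r. w (?T i) \<le> w (?T x)" unfolding inv by (metis UNIV_I)
  have diff: "w (rconst (j - i)) = w (?T i)" if "w (?T j) < w (?T i)" for i j
  proof -
    have "w (?T i - ?T j) = w (?T i)" using that by (rule W.nrm_diff_eq_left)
    then show ?thesis by simp
  qed
  have "n (k - j) < n (j - i)" if "(i, j) \<in> r - Id" "(j, k) \<in> r - Id" for i j k
    using dec[OF that(1)] dec[OF that(2)] diff by (metis w_rconst_less_iff)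
  then have "pseudo_convergent V r (\<lambda>i. i)"
    unfolding pseudo_convergent_iff using r by blast
  moreover have "W = VF V (tails r)"
  proof (rule eq_VF_if_linear_constant[OF assms(1) small])
    show "tails r \<noteq> bot" using tails_not_bot[OF r] .
    fix x0
    obtain c where c: "c \<noteq> 0" "w (?T x0) = w (rconst c)" using LL LL_empty_iff by blast
    obtain i where i: "i \<in> Field r" "w (?T i) \<le> w (?T x0)" using cof by blast
    have "n (j - x0) = n c" if "(i, j) \<in> r - Id" for j
    proof -
      have "w (?T j) < w (?T x0)" using dec[OF that] i(2) by (rule less_le_trans)
      from diff[OF this] show ?thesis unfolding c(2) by (simp only: w_rconst_eq_iff)
    qed
    then show "\<exists>c. c \<noteq> 0 \<and> w (?T x0) = w (rconst c) \<and> eventually (\<lambda>x. n (x - x0) = n c) (tails r)"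
      using c i(1) by (auto simp: eventually_tails_strict[OF r])
  qed
  then have "W = VE V r (\<lambda>i. i)" by (simp add: VE_eq_VF filtermap_ident)
  ultimately show ?thesis by blast
qed

lemma exists_pseudo_monotone:
  assumes "V \<noteq> UNIV" small_values
  shows "\<exists>(r :: 'a rel) (s :: 'a \<Rightarrow> 'a). pseudo_monotone V r s \<and> W = VE V r s"
proof (cases "LL W = {}")
  case True
  then show ?thesis using exists_pseudo_convergent_LL[OF assms] by (auto simp: pseudo_monotone_def)
next
  case False
  then show ?thesis
    using exists_pseudo_monotone_L1[OF assms] exists_pseudo_monotone_L2[OF assms]
    by (auto simp: LL_def)
qed

end


section \<open>The type of the defining sequence\<close>

lemma to_fract_linear: "to_fract [:- x, 1:] = rX - rconst x"
  by (simp add: rX_def rconst_def flip: to_fract_diff)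

locale val_ext_seq = val_ext V W for V :: "'a::field set" and W +
  fixes r :: "'i rel" and s :: "'i \<Rightarrow> 'a"
  assumes io: "index_order r" and W_eq: "W = VE V r s"
begin

text \<open>Membership of f / c in V_E, spelled out; the constant denominator supplies the Bezout
  identity. With its companions this moves comparisons with constants between W and the tails of the
  sequence.\<close>

lemma w_le_iff:
  assumes "c \<noteq> 0"
  shows "w (to_fract f) \<le> w (rconst c) \<longleftrightarrow> eventually (\<lambda>i. n (poly f (s i)) \<le> n c) (tails r)"
proof -
  have bez: "0 * f + [:1 / c:] * [:c:] = 1" "[:c:] \<noteq> 0" using assms by (simp_all add: one_pCons)
  then have "Fract f [:c:] \<in> W \<longleftrightarrow> eventually (\<lambda>i. n (poly f (s i)) \<le> n c) (tails r)"
    unfolding W_eq VE_eq_VF VF_Fract_iff[OF bez] by (simp add: eventually_filtermap)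
  then show ?thesis using assms by (simp add: w_Fract_mem_iff rconst_def)
qed

lemma w_ge_iff:
  assumes "c \<noteq> 0" "f \<noteq> 0"
  shows "w (rconst c) \<le> w (to_fract f) \<longleftrightarrow> eventually (\<lambda>i. n c \<le> n (poly f (s i))) (tails r)"
proof -
  have bez: "[:1 / c:] * [:c:] + 0 * f = 1" using assms by (simp_all add: one_pCons)
  then have "Fract [:c:] f \<in> W \<longleftrightarrow> eventually (\<lambda>i. n c \<le> n (poly f (s i))) (tails r)"
    unfolding W_eq VE_eq_VF VF_Fract_iff[OF bez assms(2)] by (simp add: eventually_filtermap)
  then show ?thesis using assms by (simp add: w_Fract_mem_iff rconst_def)
qed

lemma w_eq_iff:
  assumes "c \<noteq> 0" "f \<noteq> 0"
  shows "w (to_fract f) = w (rconst c) \<longleftrightarrow> eventually (\<lambda>i. n (poly f (s i)) = n c) (tails r)"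
  using w_le_iff[OF assms(1), of f] w_ge_iff[OF assms]
  by (auto simp: order_eq_iff eventually_conj_iff)

lemma w_linear_le_iff: "c \<noteq> 0 \<Longrightarrow> w (rX - rconst x) \<le> w (rconst c) \<longleftrightarrow> eventually (\<lambda>i. n (s i - x) \<le> n c) (tails r)"
  using w_le_iff[of c "[:- x, 1:]"] by (simp add: to_fract_linear)

lemma w_linear_ge_iff: "c \<noteq> 0 \<Longrightarrow> w (rconst c) \<le> w (rX - rconst x) \<longleftrightarrow> eventually (\<lambda>i. n c \<le> n (s i - x)) (tails r)"
  using w_ge_iff[of c "[:- x, 1:]"] by (simp add: to_fract_linear)

lemma w_linear_eq_iff: "c \<noteq> 0 \<Longrightarrow> w (rX - rconst x) = w (rconst c) \<longleftrightarrow> eventually (\<lambda>i. n (s i - x) = n c) (tails r)"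
  using w_eq_iff[of c "[:- x, 1:]"] by (simp add: to_fract_linear)

text \<open>For i < l < m the later gap dominates, so |s m - s i| = |s m - s l| > |s l - s i|: the
  distances from s i grow strictly and never settle on a value of the group.\<close>

lemma pseudo_divergent_L1:
  assumes pd: "pseudo_divergent V r s" and i: "i \<in> Field r"
  shows "s i \<in> L1 W"
  unfolding L1_iff
proof (intro allI impI notI)
  fix c assume "c \<noteq> 0" "w (rX - rconst (s i)) = w (rconst c)"
  then have "eventually (\<lambda>j. n (s j - s i) = n c) (tails r)" by (simp add: w_linear_eq_iff)
  then obtain k where k: "k \<in> Field r" "\<And>j. (k, j) \<in> r \<Longrightarrow> n (s j - s i) = n c"
    by (auto simp: eventually_tails[OF io])
  obtain l where l: "(k, l) \<in> r" "(i, l) \<in> r - Id"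
  proof (cases rule: index_order_cases[OF io k(1) i])
    case 1
    obtain l where "(i, l) \<in> r - Id" using index_order_next[OF io i] .
    then show ?thesis using that 1 index_order_trans[OF io, of k i l] by blast
  next
    case 2
    obtain l where "(i, l) \<in> r - Id" using index_order_next[OF io i] .
    then show ?thesis using that 2 by blast
  next
    case 3
    then show ?thesis using that[of k] index_order_refl[OF io k(1)] by blast
  qed
  obtain m where m: "(l, m) \<in> r - Id" using index_order_next[OF io] index_order_FieldD[OF l(2)] by blast
  have "n (s l - s i) < n (s m - s l)" using pd l(2) m by (auto simp: pseudo_divergent_iff)
  then have "n ((s m - s l) + (s l - s i)) = n (s m - s l)" by (rule nrm_add_eq_left)
  then have "n (s m - s i) = n (s m - s l)" by simp
  then show False
    using k(2)[OF l(1)] k(2)[of m] index_order_trans[OF io l(1), of m] m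
      \<open>n (s l - s i) < n (s m - s l)\<close> by auto
qed

text \<open>The condition of L2 with d = \<open>\<alpha>\<close> - s j gives |X - s j| = |c| for all
  late j. These terms are then outside L1, which excludes pseudo-divergence. In a pseudo-convergent
  sequence two late terms s k, s l have different eventual distances to the sequence, yet both would
  be |c|.\<close>

lemma pseudo_stationary_if_L2:
  assumes pm: "pseudo_monotone V r s" and L2: "\<alpha> \<in> L2 W"
  shows "pseudo_stationary V r s"
proof -
  obtain c where c: "c \<noteq> 0" "w (rX - rconst \<alpha>) = w (rconst c)"
    and L2': "\<And>d. w (rconst d) = w (rX - rconst \<alpha>) \<Longrightarrow>
      w (rX - rconst \<alpha> + rconst d) = w (rX - rconst \<alpha>)"
    using L2 by (auto simp: L2_iff)
  have "eventually (\<lambda>i. n (s i - \<alpha>) = n c) (tails r)" using c by (simp add: w_linear_eq_iff)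
  then obtain k where k: "k \<in> Field r" "\<And>j. (k, j) \<in> r \<Longrightarrow> n (s j - \<alpha>) = n c"
    by (auto simp: eventually_tails[OF io])
  have sj: "w (rX - rconst (s j)) = w (rconst c)" if "(k, j) \<in> r" for j
  proof -
    have "w (rconst (\<alpha> - s j)) = w (rX - rconst \<alpha>)"
      unfolding c(2) using k(2)[OF that] nrm_minus_commute[of \<alpha> "s j"] by (simp only: w_rconst_eq_iff)
    from L2'[OF this] show ?thesis unfolding c(2) by simp
  qed
  have "\<not> pseudo_divergent V r s"
  proof
    assume "pseudo_divergent V r s"
    from pseudo_divergent_L1[OF this k(1)] have "s k \<in> L1 W" .
    then show False using sj[OF index_order_refl[OF io k(1)]] c(1) by (auto simp: L1_iff)
  qed
  moreover have "\<not> pseudo_convergent V r s"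
  proof
    assume pc: "pseudo_convergent V r s"
    obtain l where l: "(k, l) \<in> r - Id" using index_order_next[OF io k(1)] .
    have "eventually (\<lambda>j. n (s j - s k) = n c) (tails r)" "eventually (\<lambda>j. n (s j - s l) = n c) (tails r)"
      using sj[of k] sj[of l] l c(1) index_order_refl[OF io k(1)] by (auto simp: w_linear_eq_iff)
    moreover have "eventually (\<lambda>j. n (s j - s l) < n (s l - s k)) (tails r)"
      using pc l index_order_FieldD[OF l]
      by (auto simp: pseudo_convergent_iff eventually_tails_strict[OF io])
    ultimately have "eventually (\<lambda>j. False) (tails r)"
    proof eventually_elim
      case (elim j)
      have "n ((s j - s l) + (s l - s k)) = n (s l - s k)" using elim(3) by (rule nrm_add_eq_right)
      then show ?case using elim by simp
    qed
    then show False using tails_not_bot[OF io] by (simp add: trivial_limit_def)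
  qed
  ultimately show ?thesis using pm by (simp add: pseudo_monotone_def)
qed

text \<open>Terms of a pseudo-divergent sequence lie in L1. For a pseudo-stationary one, s i lies in
  L2: if s i - d were closer to X than s i, two distinct late terms would be closer than |c| to s i
  - d, while their mutual distance is |c|.\<close>

lemma pseudo_convergent_if_LL_empty:
  assumes pm: "pseudo_monotone V r s" and LL: "LL W = {}"
  shows "pseudo_convergent V r s"
proof -
  obtain i where i: "i \<in> Field r" using io by (auto simp: index_order_def)
  have "\<not> pseudo_divergent V r s"
    using pseudo_divergent_L1[OF _ i] LL by (auto simp: LL_def)
  moreover have "\<not> pseudo_stationary V r s"
  proof
    assume ps: "pseudo_stationary V r s"
    obtain j where j: "(i, j) \<in> r - Id" using index_order_next[OF io i] .
    have eq: "n (s k - s l) = n (s j - s i)" if "k \<in> Field r" "l \<in> Field r" "k \<noteq> l" for k l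
      using ps that j i index_order_FieldD[OF j] unfolding pseudo_stationary_def val_eq_iff
      by (metis DiffE pair_in_Id_conv)
    have ev: "eventually (\<lambda>k. n (s k - s i) = n (s j - s i)) (tails r)"
      unfolding eventually_tails_strict[OF io] using i eq index_order_FieldD
      by (metis DiffE pair_in_Id_conv)
    obtain c where c: "c \<noteq> 0" "w (rX - rconst (s i)) = w (rconst c)"
      using LL LL_empty_iff by blast
    then have "eventually (\<lambda>k. n (s k - s i) = n c) (tails r)" by (simp add: w_linear_eq_iff)
    with ev have "eventually (\<lambda>k. n (s j - s i) = n c) (tails r)" by eventually_elim simp
    then have jc: "n (s j - s i) = n c" using tails_not_bot[OF io] by (simp add: eventually_const_iff)
    have "s i \<in> L2 W"
      unfolding L2_iff
    proof (intro conjI exI[of _ c] c allI impI)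
      fix d assume d: "w (rconst d) = w (rX - rconst (s i))"
      show "w (rX - rconst (s i) + rconst d) = w (rX - rconst (s i))"
      proof (rule ccontr)
        assume "w (rX - rconst (s i) + rconst d) \<noteq> w (rX - rconst (s i))"
        moreover have "w (rX - rconst (s i) + rconst d) \<le> w (rX - rconst (s i))"
          using d by (intro W.nrm_add_le) auto
        moreover have "rX - rconst (s i) + rconst d = rX - rconst (s i - d)" by simp
        ultimately have "w (rX - rconst (s i - d)) < w (rconst c)"
          unfolding c(2) by (metis order_less_le)
        then have "\<not> eventually (\<lambda>k. n c \<le> n (s k - (s i - d))) (tails r)"
          unfolding w_linear_ge_iff[OF c(1), symmetric] by (simp only: W.nrm_not_le)
        \<comment> \<open>The negation of an eventual bound only yields exceptions arbitrarily late,
          which is enough to pick two of them.\<close>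
        then have freq: "\<exists>k. (m, k) \<in> r \<and> n (s k - (s i - d)) < n c" if "m \<in> Field r" for m
          using that by (auto simp: eventually_tails[OF io] nrm_not_le)
        obtain k where k: "(i, k) \<in> r" "n (s k - (s i - d)) < n c" using freq[OF i] by blast
        have kF: "k \<in> Field r" using k(1) by (auto simp: Field_def)
        obtain k' where k': "(k, k') \<in> r - Id" using index_order_next[OF io kF] .
        obtain l where l: "(k', l) \<in> r" "n (s l - (s i - d)) < n c"
          using freq[of k'] index_order_FieldD[OF k'] by blast
        have "l \<noteq> k" "l \<in> Field r"
          using io k' l(1) by (auto simp: index_order_def order_on_defs Field_def dest: antisymD)
        then have "n (s l - s k) = n c" using eq[of l k] kF jc by simp
        moreover have "n ((s l - (s i - d)) - (s k - (s i - d))) < n c"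
          using l(2) k(2) by (rule nrm_diff_less)
        ultimately show False by simp
      qed
    qed
    then show False using LL by (auto simp: LL_def)
  qed
  ultimately show ?thesis using pm by (simp add: pseudo_monotone_def)
qed

lemma transcendental_type_if_immediate:
  assumes "immediate V W"
  shows "transcendental_type V r s"
  unfolding transcendental_type_def
proof
  fix f
  show "\<exists>g. eventually (\<lambda>i. val V (poly f (s i)) = g) (tails r)"
  proof (cases "f = 0")
    case False
    then have "val W (to_fract f) \<in> base_value_group W"
      using assms by (auto simp: immediate_def value_group_def)
    then obtain c where c: "c \<noteq> 0" "w (to_fract f) = w (rconst c)"
      unfolding base_value_group_def image_iff W.val_eq_iff by blast
    then have "eventually (\<lambda>i. n (poly f (s i)) = n c) (tails r)"
      using w_eq_iff[OF c(1) False] by simp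
    then show ?thesis by (intro exI[of _ "val V c"]) (simp add: val_eq_iff)
  qed (intro exI[of _ "val V 0"], simp)
qed

end

text \<open>Equal value groups empty L1. At a point x of L2 with |X - x| = |c|, the residue of (X -
  x)/c would be that of some d in K, and subtracting d c would make X - x smaller, against the
  condition of L2.\<close>

lemma (in val_ext) LL_empty_if_immediate:
  assumes imm: "immediate V W"
  shows "LL W = {}"
proof -
  have L1: "x \<notin> L1 W" for x
    using imm by (auto simp: L1_def immediate_def value_group_def)
  moreover have "x \<notin> L2 W" for x
  proof
    assume "x \<in> L2 W"
    then obtain c where c: "c \<noteq> 0" "w (rX - rconst x) = w (rconst c)"
      and L2': "\<And>d. w (rconst d) = w (rX - rconst x) \<Longrightarrow>
        w (rX - rconst x + rconst d) = w (rX - rconst x)"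
      by (auto simp: L2_iff)
    define \<phi> where "\<phi> = (rX - rconst x) / rconst c"
    have "\<phi> \<in> W" using c by (simp add: \<phi>_def flip: W.nrm_le_iff_divide)
    then have "residue W \<phi> \<in> base_residue_field V W"
      using imm by (auto simp: immediate_def residue_field_def)
    then obtain d where d: "residue W \<phi> = residue W (rconst d)" by (auto simp: base_residue_field_def)
    have "\<phi> \<in> residue W \<phi>" by (simp add: residue_def W.max_ideal_iff)
    then have "w (\<phi> - rconst d) < w 1" unfolding d by (simp add: residue_def W.max_ideal_iff)
    then have "w ((\<phi> - rconst d) * rconst c) < w (1 * rconst c)"
      using c(1) by (subst W.nrm_mult_less_cancel) auto
    also have "(\<phi> - rconst d) * rconst c = rX - rconst x - rconst (d * c)"
      using c(1) by (simp add: \<phi>_def diff_divide_distrib left_diff_distrib)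
    finally have less: "w (rX - rconst x - rconst (d * c)) < w (rX - rconst x)" using c(2) by simp
    then have "w ((rX - rconst x) - (rX - rconst x - rconst (d * c))) = w (rX - rconst x)"
      by (rule W.nrm_diff_eq_left)
    then have "w (rconst (- (d * c))) = w (rX - rconst x)" by simp
    from L2'[OF this] show False using less by simp
  qed
  ultimately show ?thesis by (auto simp: LL_def)
qed


section \<open>Necessity of small values\<close>

lemma small_values_if_pseudo_monotone:
  fixes V :: "'a::field set"
  assumes V: "valuation_domain V" "V \<noteq> UNIV"
    and all: "\<And>W. is_extension V W \<Longrightarrow>
      \<exists>(r :: 'a rel) (s :: 'a \<Rightarrow> 'a). pseudo_monotone V r s \<and> W = VE V r s"
  shows "val_dom.small_values V"
proof -
  interpret val_dom V by standard (rule V(1))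
  show ?thesis
    unfolding small_values_def
  proof (intro allI impI, rule ccontr)
    fix f and c :: 'a
    assume deg: "degree f > 0" and c: "c \<noteq> 0" and "\<nexists>x. n (poly f x) < n c"
    then have big: "n c \<le> n (poly f x)" for x by (simp add: nrm_not_less)
    \<comment> \<open>The ideal of f in K[X], inside K(X). It omits 1 since f is not constant, and
      it is stable under all constants, so it can be placed in the maximal ideal of an
      extension.\<close>
    define J where "J = range (\<lambda>g. to_fract (f * g))"
    have J: "mult_add_closed J"
      unfolding mult_add_closed_def J_def
    proof (intro conjI ballI)
      show "0 \<in> range (\<lambda>g. to_fract (f * g))" by (rule range_eqI[of _ _ 0]) simp
      fix x y assume "x \<in> range (\<lambda>g. to_fract (f * g))" "y \<in> range (\<lambda>g. to_fract (f * g))"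
      then obtain g h where "x = to_fract (f * g)" "y = to_fract (f * h)" by blast
      then show "x - y \<in> range (\<lambda>g. to_fract (f * g))" "x * y \<in> range (\<lambda>g. to_fract (f * g))"
        by (auto simp: algebra_simps intro: range_eqI[of _ _ "g - h"] range_eqI[of _ _ "g * f * h"])
    qed
    have "rconst a * x \<in> J" if "x \<in> J" for a x
    proof -
      from that obtain g where "x = to_fract (f * g)" by (auto simp: J_def)
      then have "rconst a * x = to_fract (f * ([:a:] * g))"
        unfolding rconst_def to_fract_mult by (simp only: mult.left_commute mult.assoc)
      then show ?thesis unfolding J_def by blast
    qed
    moreover have "1 \<notin> J"
    proof
      assume "1 \<in> J"
      then obtain g where "to_fract (f * g) = to_fract 1" unfolding J_def by auto
      then have "f * g = 1" by (simp only: to_fract_eq_iff)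
      moreover from this have "f \<noteq> 0" "g \<noteq> 0" by auto
      ultimately have "degree f + degree g = 0" by (metis degree_1 degree_mult_eq)
      then show False using deg by simp
    qed
    ultimately obtain W where W: "valuation_domain W" "rconst -` W = V" "J \<subseteq> max_ideal W"
      using extension_exists[of rconst J] J by auto
    then have ext: "is_extension V W" by (simp add: is_extension_def)
    then obtain r :: "'a rel" and s :: "'a \<Rightarrow> 'a" where rs: "pseudo_monotone V r s" "W = VE V r s"
      using all by blast
    then have io: "index_order r"
      by (auto simp: pseudo_monotone_def pseudo_convergent_def pseudo_divergent_def pseudo_stationary_def)
    interpret val_ext_seq V W r s
      by unfold_locales (use ext io rs in auto)
    obtain e where e: "e \<noteq> 0" "n e < n c" using exists_nrm_less[OF V(2) c] by blast
    \<comment> \<open>The multiple f / e in the maximal ideal means |f| < |e| in W, whereas |f| is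
      at least |c| > |e| at every point of K.\<close>
    have "to_fract (f * [:1 / e:]) \<in> max_ideal W" using W(3) unfolding J_def by blast
    then have "w (to_fract f * rconst (1 / e)) < w (rconst e * rconst (1 / e))"
      using e(1) by (simp only: W.max_ideal_iff to_fract_mult rconst_def[symmetric]) simp
    then have "w (to_fract f) < w (rconst e)"
      using e(1) by (subst (asm) W.nrm_mult_less_cancel) auto
    then have "eventually (\<lambda>i. n (poly f (s i)) \<le> n e) (tails r)"
      using w_le_iff[OF e(1), of f] less_imp_le by blast
    then have "eventually (\<lambda>i. False) (tails r)"
    proof eventually_elim
      case (elim i)
      then show ?case using big[of "s i"] e(2) by auto
    qed
    then show False using tails_not_bot[OF io] by (simp add: trivial_limit_def)
  qed
qed


section \<open>Polynomials over the completion\<close>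

lemma (in val_dom) limitin_eventually:
  assumes "limitin (valuation_topology A) f l F" "c \<noteq> 0"
  shows "eventually (\<lambda>x. n (f x - l) < n c) F"
proof -
  define U where "U = {y. val_less A (val A c) (val A (y - l))}"
  have "openin (valuation_topology A) U"
    unfolding valuation_topology_def U_def using assms(2) by (intro topology_generated_by_Basis) blast
  moreover have "l \<in> U" using assms(2) by (simp add: U_def val_less_iff_nrm)
  ultimately have "eventually (\<lambda>x. f x \<in> U) F"
    using assms(1) unfolding limitin_def by blast
  then show ?thesis by (simp add: U_def val_less_iff_nrm)
qed

lemma (in val_dom) cauchy_filter_val_iff:
  "cauchy_filter_val A F \<longleftrightarrow> F \<noteq> bot \<and>
     (\<forall>c. c \<noteq> 0 \<longrightarrow> (\<exists>P. eventually P F \<and> (\<forall>x y. P x \<and> P y \<longrightarrow> n (x - y) < n c)))"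
  by (simp add: cauchy_filter_val_def val_less_iff_nrm)

lemma (in val_dom) nrm_sum_le: "(\<And>i. i \<in> S \<Longrightarrow> n (f i) \<le> n z) \<Longrightarrow> n (sum f S) \<le> n z"
  by (induction S rule: infinite_finite_induct) (auto intro: nrm_add_le)

lemma (in val_dom) nrm_sum_less: "(\<And>i. i \<in> S \<Longrightarrow> n (f i) < n z) \<Longrightarrow> z \<noteq> 0 \<Longrightarrow> n (sum f S) < n z"
  by (induction S rule: infinite_finite_induct) (auto intro: nrm_add_less)

lemma (in val_dom) nrm_power_mono_exponent:
  assumes "n 1 \<le> n B" "i \<le> j"
  shows "n (B ^ i) \<le> n (B ^ j)"
proof -
  have "n (B ^ i * 1 ^ (j - i)) \<le> n (B ^ i * B ^ (j - i))"
    using assms(1) by (intro nrm_mult_mono nrm_power_mono order_refl)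
  then show ?thesis using assms(2) by (simp flip: power_add)
qed

lemma (in val_dom) nrm_poly_le:
  assumes "\<And>i. n (coeff g i) \<le> n e" "n x \<le> n B" "n 1 \<le> n B" "degree g \<le> m"
  shows "n (poly g x) \<le> n (e * B ^ m)"
  unfolding poly_altdef
proof (rule nrm_sum_le)
  fix i assume "i \<in> {..degree g}"
  then have "n (B ^ i) \<le> n (B ^ m)" using assms by (intro nrm_power_mono_exponent) auto
  then have "n (x ^ i) \<le> n (B ^ m)" using nrm_power_mono[OF assms(2), of i] by simp
  then show "n (coeff g i * x ^ i) \<le> n (e * B ^ m)" using assms(1) by (intro nrm_mult_mono)
qed

text \<open>Beyond |B| the leading term dominates all others. Read backwards, points where the
  polynomial has value at most 1 lie in a ball that depends only on the coefficient bound.\<close>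

lemma (in val_dom) nrm_monic_poly_large:
  assumes "\<And>i. n (coeff g i) \<le> n B" "degree g < m" "n 1 \<le> n B" "n B < n x"
  shows "n 1 < n (poly (monom 1 m + g) x)"
proof -
  have x1: "n 1 < n x" using assms by simp
  then have x0: "x \<noteq> 0" by auto
  have "n (poly g x) < n (x ^ m)"
    unfolding poly_altdef
  proof (rule nrm_sum_less)
    fix i assume i: "i \<in> {..degree g}"
    have "n (coeff g i * x ^ i) < n (x * x ^ i)"
      using assms(1)[of i] assms(4) x0 by (intro nrm_mult_strict_mono) auto
    also have "x * x ^ i = x ^ Suc i" by simp
    also have "n (x ^ Suc i) \<le> n (x ^ m)"
      using i assms(2) x1 by (intro nrm_power_mono_exponent) auto
    finally show "n (coeff g i * x ^ i) < n (x ^ m)" .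
  qed (use x0 in simp)
  then have "n (poly (monom 1 m + g) x) = n (x ^ m)"
    by (simp add: poly_monom nrm_add_eq_left)
  moreover have "n (1 ^ m) < n (x ^ m)" using assms(2) x1 by (intro nrm_power_strict_mono) auto
  ultimately show ?thesis by simp
qed

lemma (in val_dom) exists_coeff_bound: "\<exists>B. B \<noteq> 0 \<and> n 1 \<le> n B \<and> (\<forall>i. n (coeff f i) \<le> n B)"
proof (induction f)
  case (pCons a f)
  then obtain B where B: "B \<noteq> 0" "n 1 \<le> n B" "\<And>i. n (coeff f i) \<le> n B" by blast
  obtain C where C: "C \<noteq> 0" "n a \<le> n C" "n B \<le> n C" using exists_nrm_upper by blast
  have "n (coeff (pCons a f) i) \<le> n C" for i
    using C B(3)[of "i - 1"] by (cases i) (auto intro: order_trans)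
  then show ?case using C B(2) by (meson order_trans)
qed (auto intro: exI[of _ 1])

text \<open>Used for two embeddings: of K into its completion, and of the completion into an
  algebraic closure with an extended valuation.\<close>

locale val_hom = V: val_dom V + H: val_dom H for V :: "'a::field set" and H :: "'b::field set" +
  fixes h :: "'a \<Rightarrow> 'b"
  assumes h_one [simp]: "h 1 = 1" and h_add [simp]: "h (x + y) = h x + h y"
    and h_mult [simp]: "h (x * y) = h x * h y" and h_vimage: "h -` H = V"
begin

lemma h_zero [simp]: "h 0 = 0"
  using h_add[of 0 0] by (metis add_0 add_cancel_left_right)

lemma h_diff [simp]: "h (x - y) = h x - h y"
  using h_add[of "x - y" y] by (simp add: algebra_simps del: h_add)

lemma h_eq_zero_iff [simp]: "h x = 0 \<longleftrightarrow> x = 0"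
proof
  assume "h x = 0"
  show "x = 0"
  proof (rule ccontr)
    assume "x \<noteq> 0"
    then have "h (x * inverse x) = 1" by simp
    then show False using \<open>h x = 0\<close> by (simp only: h_mult) simp
  qed
qed simp

lemma h_divide: "h (x / y) = h x / h y"
proof (cases "y = 0")
  case False
  then have "h (x / y * y) = h x" by simp
  then have "h (x / y) * h y = h x" by (simp only: h_mult)
  then show ?thesis using False by (simp add: field_simps)
qed simp

lemma h_power [simp]: "h (x ^ k) = h x ^ k"
  by (induction k) auto

lemma nrm_h_le_iff [simp]: "nrm H (h x) \<le> nrm H (h y) \<longleftrightarrow> nrm V x \<le> nrm V y"
proof (cases "y = 0")
  case False
  then show ?thesis
    using h_vimage by (auto simp: V.nrm_le_iff_divide H.nrm_le_iff_divide simp flip: h_divide)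
qed simp

lemma nrm_h_less_iff [simp]: "nrm H (h x) < nrm H (h y) \<longleftrightarrow> nrm V x < nrm V y"
  by (simp add: less_le_not_le)

lemma poly_map_poly_h [simp]: "poly (map_poly h f) (h x) = h (poly f x)"
  by (induction f) (simp_all add: map_poly_pCons)

lemma coeff_map_poly_h [simp]: "coeff (map_poly h f) i = h (coeff f i)"
  by (simp add: coeff_map_poly)

lemma degree_map_poly_h [simp]: "degree (map_poly h f) = degree f"
  by (intro degree_map_poly) simp

end

text \<open>
  If \<open>p\<close> takes arbitrarily small values at points of the complete field, then these points come
  arbitrarily close to a root \<open>a\<close> of \<open>p\<close> in an algebraic closure, by the pigeonhole principle;
  so they accumulate at a point of the field, which is then a root of \<open>p\<close> by continuity.
\<close>

lemma root_if_small_values: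
  fixes H :: "'b::field set" and p :: "'b poly"
  assumes H: "valuation_domain H" "H \<noteq> UNIV" and complete: "complete_val H"
    and deg: "degree p > 0" and small: "\<And>c. c \<noteq> 0 \<Longrightarrow> \<exists>x. nrm H (poly p x) < nrm H c"
  shows "\<exists>x. poly p x = 0"
proof -
  interpret H: val_dom H by standard (rule H(1))
  \<comment> \<open>With the zero ideal, the extension lemma just extends the valuation to the
    algebraic closure.\<close>
  have "mult_add_closed {0 :: 'b alg_closure}" by (simp add: mult_add_closed_def)
  then obtain B where B: "valuation_domain B" "to_ac -` B = H"
    using H.extension_exists[of to_ac "{0}"] by auto
  interpret B: val_dom B by standard (rule B(1))
  interpret hom: val_hom H B to_ac
    by unfold_locales (use B in auto)
  define q where "q = map_poly to_ac p"
  have "degree q > 0" using deg by (simp only: q_def hom.degree_map_poly_h)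
  then have "q \<noteq> 0" by auto
  then obtain M where M: "size M = degree q" "q = smult (lead_coeff q) (\<Prod>a\<in>#M. [:- a, 1:])"
    using alg_closed_imp_factorization by blast
  define l where "l = lead_coeff p"
  have l: "l \<noteq> 0" "lead_coeff q = to_ac l" using deg by (auto simp: l_def q_def)
  have prod_lower: "nrm B (u ^ size N) \<le> nrm B (poly (\<Prod>a\<in>#N. [:- a, 1:]) y)"
    if "\<And>a. a \<in># N \<Longrightarrow> nrm B u \<le> nrm B (y - a)" for u y N
    using that
  proof (induction N)
    case (add a N)
    have "nrm B (u * u ^ size N) \<le> nrm B ((y - a) * poly (\<Prod>a\<in>#N. [:- a, 1:]) y)"
      using add by (intro B.nrm_mult_mono) auto
    then show ?case by (simp add: algebra_simps)
  qed simp
  have near: "\<exists>x. \<exists>a\<in>#M. nrm H (poly p x) < nrm H c \<and> nrm B (to_ac x - a) < nrm B (to_ac c)"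
    if c: "c \<noteq> 0" for c
  proof -
    \<comment> \<open>If x stayed at distance at least |c| from every root, then |p(x)| would be at
      least |l c^deg p|, with l the leading coefficient.\<close>
    obtain d where d: "d \<noteq> 0" "nrm H d \<le> nrm H c" "nrm H d \<le> nrm H (l * c ^ size M)"
      using H.exists_nrm_lower[of c "l * c ^ size M"] c l(1) by auto
    obtain x where x: "nrm H (poly p x) < nrm H d" using small[OF d(1)] by blast
    have "\<exists>a\<in>#M. nrm B (to_ac x - a) < nrm B (to_ac c)"
    proof (rule ccontr)
      assume "\<not> ?thesis"
      then have "nrm B (to_ac c) \<le> nrm B (to_ac x - a)" if "a \<in># M" for a
        using that by (auto simp flip: B.nrm_not_less)
      then have "nrm B (to_ac c ^ size M) \<le> nrm B (poly (\<Prod>a\<in>#M. [:- a, 1:]) (to_ac x))"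
        by (rule prod_lower)
      then have "nrm B (to_ac l * to_ac c ^ size M) \<le>
          nrm B (to_ac l * poly (\<Prod>a\<in>#M. [:- a, 1:]) (to_ac x))"
        by (intro B.nrm_mult_mono order_refl)
      also have "to_ac l * poly (\<Prod>a\<in>#M. [:- a, 1:]) (to_ac x) = poly q (to_ac x)"
        by (subst M(2)) (simp add: l(2))
      also have "\<dots> = to_ac (poly p x)" by (simp only: q_def hom.poly_map_poly_h)
      also have "to_ac l * to_ac c ^ size M = to_ac (l * c ^ size M)" by simp
      finally have "nrm H (l * c ^ size M) \<le> nrm H (poly p x)" by (simp only: hom.nrm_h_le_iff)
      then show False using x d(3) by auto
    qed
    then show ?thesis using x d(2) by (meson less_le_trans)
  qed
  have lower: "\<exists>c. c \<noteq> 0 \<and> (\<forall>a\<in>S. nrm H c \<le> nrm H (f a))"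
    if "finite S" "\<And>a. a \<in> S \<Longrightarrow> f a \<noteq> 0" for S :: "'b alg_closure set" and f
    using that
  proof (induction S rule: finite_induct)
    case (insert a S)
    then obtain c where c: "c \<noteq> 0" "\<And>b. b \<in> S \<Longrightarrow> nrm H c \<le> nrm H (f b)" by auto
    obtain d where "d \<noteq> 0" "nrm H d \<le> nrm H c" "nrm H d \<le> nrm H (f a)"
      using H.exists_nrm_lower[OF c(1), of "f a"] insert.prems by auto
    then show ?case using c(2) by (intro exI[of _ d]) (auto intro: order_trans)
  qed (auto intro: exI[of _ 1])
  define U where "U a c = {x. nrm H (poly p x) < nrm H c \<and> nrm B (to_ac x - a) < nrm B (to_ac c)}" for a c
  have U_mono: "U a c \<subseteq> U a d" if "nrm H c \<le> nrm H d" for a c d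
  proof -
    have "nrm B (to_ac c) \<le> nrm B (to_ac d)" using that by simp
    then show ?thesis using that by (auto simp: U_def intro: less_le_trans)
  qed
  have "\<exists>a\<in>#M. \<forall>c. c \<noteq> 0 \<longrightarrow> U a c \<noteq> {}"
  proof (rule ccontr)
    assume "\<not> ?thesis"
    \<comment> \<open>Each root a would have a radius f a at which its neighbourhood is empty. A
      radius c below all of these finitely many contradicts \<open>near\<close>.\<close>
    then obtain f where f: "\<And>a. a \<in># M \<Longrightarrow> f a \<noteq> 0 \<and> U a (f a) = {}" by metis
    then obtain c where c: "c \<noteq> 0" "\<And>a. a \<in># M \<Longrightarrow> nrm H c \<le> nrm H (f a)"
      using lower[of "set_mset M" f] by auto
    then obtain x a where "a \<in># M" "x \<in> U a c" using near[OF c(1)] by (auto simp: U_def)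
    then show False using f U_mono[OF c(2), of a] by blast
  qed
  then obtain a where ne: "\<And>c. c \<noteq> 0 \<Longrightarrow> U a c \<noteq> {}" by blast
  \<comment> \<open>The root a may lie outside the given field; the filter of its traces on that
    field is Cauchy, and completeness supplies a limit inside.\<close>
  define F where "F = (INF c\<in>{c. c \<noteq> 0}. principal (U a c))"
  have ev_F: "eventually P F \<longleftrightarrow> (\<exists>c. c \<noteq> 0 \<and> (\<forall>x\<in>U a c. P x))" for P
  proof -
    have dir: "\<exists>x\<in>{c. c \<noteq> 0}. principal (U a x) \<le> inf (principal (U a c)) (principal (U a d))"
      if cd: "c \<in> {c. c \<noteq> 0}" "d \<in> {c. c \<noteq> 0}" for c d :: 'b
    proof -
      obtain e where e: "e \<noteq> 0" "nrm H e \<le> nrm H c" "nrm H e \<le> nrm H d"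
        using H.exists_nrm_lower[of c d] cd by auto
      then have "U a e \<subseteq> U a c \<inter> U a d" using U_mono[of e c a] U_mono[of e d a] by blast
      then have "principal (U a e) \<le> inf (principal (U a c)) (principal (U a d))"
        by (simp only: inf_principal principal_le_iff)
      then show ?thesis using e(1) by blast
    qed
    have "1 \<in> {c :: 'b. c \<noteq> 0}" by simp
    then have "{c :: 'b. c \<noteq> 0} \<noteq> {}" by (metis empty_iff)
    from eventually_INF_base[OF this dir] show ?thesis
      by (simp add: F_def eventually_principal)
  qed
  have "F \<noteq> bot" unfolding trivial_limit_def ev_F using ne by blast
  moreover have "\<exists>P. eventually P F \<and> (\<forall>x y. P x \<and> P y \<longrightarrow> nrm H (x - y) < nrm H c)"
    if "c \<noteq> 0" for c
  proof (intro exI[of _ "\<lambda>x. x \<in> U a c"] conjI allI impI)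
    show "eventually (\<lambda>x. x \<in> U a c) F" unfolding ev_F using that by blast
    fix x y assume "x \<in> U a c \<and> y \<in> U a c"
    then have "nrm B (to_ac x - a) < nrm B (to_ac c)" "nrm B (to_ac y - a) < nrm B (to_ac c)"
      by (auto simp: U_def)
    then have "nrm B ((to_ac x - a) - (to_ac y - a)) < nrm B (to_ac c)"
      by (rule B.nrm_diff_less)
    moreover have "(to_ac x - a) - (to_ac y - a) = to_ac (x - y)" by simp
    ultimately show "nrm H (x - y) < nrm H c" by (metis hom.nrm_h_less_iff)
  qed
  ultimately have "cauchy_filter_val H F" unfolding H.cauchy_filter_val_iff by blast
  then obtain x0 where lim: "limitin (valuation_topology H) (\<lambda>x. x) x0 F"
    using complete by (auto simp: complete_val_def)
  have "nrm H (poly p x0) \<le> nrm H e" if e: "e \<noteq> 0" for e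
  proof -
    obtain d where d: "d \<noteq> 0" "\<And>x. nrm H (x - x0) \<le> nrm H d \<Longrightarrow> nrm H (poly p x - poly p x0) \<le> nrm H e"
      using H.poly_continuous[OF e] by blast
    have "eventually (\<lambda>x. nrm H (x - x0) < nrm H d) F" using H.limitin_eventually[OF lim d(1)] .
    moreover have "eventually (\<lambda>x. x \<in> U a e) F" unfolding ev_F using e by blast
    ultimately have "eventually (\<lambda>x. nrm H (x - x0) < nrm H d \<and> x \<in> U a e) F"
      by (rule eventually_conj)
    then obtain x where x: "nrm H (x - x0) < nrm H d" "nrm H (poly p x) < nrm H e"
      using \<open>F \<noteq> bot\<close> by (auto simp: U_def dest: eventually_happens)
    have "nrm H (poly p x - (poly p x - poly p x0)) \<le> nrm H e"
      by (rule H.nrm_diff_le) (use d(2)[of x] x in auto)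
    then show ?thesis by simp
  qed
  then have "poly p x0 = 0"
    using H.exists_nrm_less[OF H(2), of "poly p x0"] by (auto simp: H.nrm_not_less[symmetric])
  then show ?thesis by blast
qed

section \<open>Small values on K and roots in the completion\<close>

locale val_completion = val_hom V Vh \<iota> for V :: "'a::field set" and Vh :: "'b::field set" and \<iota> +
  assumes V_proper: "V \<noteq> UNIV" and closure: "valuation_topology Vh closure_of range \<iota> = UNIV"
    and complete: "complete_val Vh"
begin

lemma Vh_proper: "Vh \<noteq> UNIV"
  using h_vimage V_proper by auto

lemma dense: "c \<noteq> 0 \<Longrightarrow> \<exists>x. nrm Vh (\<iota> x - l) < nrm Vh c"
proof -
  assume c: "c \<noteq> 0"
  define U where "U = {y. val_less Vh (val Vh c) (val Vh (y - l))}"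
  have "openin (valuation_topology Vh) U"
    unfolding valuation_topology_def U_def using c by (intro topology_generated_by_Basis) blast
  moreover have "l \<in> U" using c by (simp add: U_def H.val_less_iff_nrm)
  moreover have "l \<in> valuation_topology Vh closure_of range \<iota>" by (simp add: closure)
  ultimately obtain y where "y \<in> range \<iota>" "y \<in> U" unfolding in_closure_of by blast
  then show ?thesis by (auto simp: U_def H.val_less_iff_nrm)
qed

text \<open>An element of K closer to c than |c| has the absolute value of c: the completion has no
  new values.\<close>

lemma exists_same_nrm: "c \<noteq> 0 \<Longrightarrow> \<exists>x. x \<noteq> 0 \<and> nrm Vh (\<iota> x) = nrm Vh c"
proof -
  assume c: "c \<noteq> 0"
  obtain x where x: "nrm Vh (\<iota> x - c) < nrm Vh c" using dense[OF c] by blast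
  have "nrm Vh (c + (\<iota> x - c)) = nrm Vh c" using x by (rule H.nrm_add_eq_left)
  then have eq: "nrm Vh (\<iota> x) = nrm Vh c" by simp
  moreover have "x \<noteq> 0"
  proof
    assume "x = 0"
    then have "nrm Vh c = nrm Vh 0" using eq by simp
    then show False using c by (simp only: H.nrm_eq_zero_iff)
  qed
  ultimately show ?thesis by blast
qed

lemma exists_coeff_approx:
  assumes "e \<noteq> 0"
  shows "\<exists>q. degree q \<le> degree f \<and> (\<forall>i. nrm Vh (coeff f i - \<iota> (coeff q i)) \<le> nrm Vh e)"
proof (induction f)
  case (pCons a f)
  then obtain q where q: "degree q \<le> degree f" "\<And>i. nrm Vh (coeff f i - \<iota> (coeff q i)) \<le> nrm Vh e"
    by blast
  show ?case
  proof (cases "f = 0")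
    case True
    obtain b where "nrm Vh (\<iota> b - a) < nrm Vh e" using dense[OF assms] by blast
    then have "nrm Vh (coeff (pCons a f) i - \<iota> (coeff [:b:] i)) \<le> nrm Vh e" for i
      using True H.nrm_minus_commute[of a "\<iota> b"] by (cases i) auto
    then show ?thesis by (intro exI[of _ "[:b:]"]) auto
  next
    case False
    obtain b where "nrm Vh (\<iota> b - a) < nrm Vh e" using dense[OF assms] by blast
    then have "nrm Vh (coeff (pCons a f) i - \<iota> (coeff (pCons b q) i)) \<le> nrm Vh e" for i
      using q(2)[of "i - 1"] H.nrm_minus_commute[of a "\<iota> b"] by (cases i) auto
    moreover have "degree (pCons b q) \<le> degree (pCons a f)"
      using q(1) False by (cases "q = 0") auto
    ultimately show ?thesis by blast
  qed
qed (intro exI[of _ 0], simp)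

text \<open>The lower coefficients of f are approximated from K while the leading coefficient 1 is
  kept exactly. A point x of K where the approximation is small satisfies |x| \<le> |B|, with B
  independent of the precision, so the error in passing back to f is under control.\<close>

lemma small_values_monic:
  assumes small: "V.small_values" and f: "degree f > 0" "lead_coeff f = 1" and c: "c \<noteq> 0"
  shows "\<exists>x. nrm Vh (poly f x) < nrm Vh c"
proof -
  define m where "m = degree f"
  define f0 where "f0 = f - monom 1 m"
  have f_eq: "f = monom 1 m + f0" by (simp add: f0_def)
  have "degree f0 < m"
    unfolding f0_def using f by (intro degree_lessI) (auto simp: m_def le_less coeff_eq_0)
  obtain B where B: "B \<noteq> 0" "nrm Vh 1 \<le> nrm Vh B" "\<And>i. nrm Vh (coeff f0 i) \<le> nrm Vh B"
    using H.exists_coeff_bound by blast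
  obtain c' where c': "c' \<noteq> 0" "nrm Vh c' < nrm Vh c" using H.exists_nrm_less[OF Vh_proper c] by blast
  \<comment> \<open>The error at x is at most |d B^m| \<le> |c'| < |c|; keeping d below 1 makes B
    bound the approximating coefficients as well.\<close>
  obtain d where d: "d \<noteq> 0" "nrm Vh d \<le> nrm Vh (c' / B ^ m)" "nrm Vh d \<le> nrm Vh 1"
    using H.exists_nrm_lower[of "c' / B ^ m" 1] B(1) c'(1) by auto
  obtain q0 where q0: "degree q0 \<le> degree f0" "\<And>i. nrm Vh (coeff f0 i - \<iota> (coeff q0 i)) \<le> nrm Vh d"
    using exists_coeff_approx[OF d(1)] by blast
  have dq0: "degree q0 < m" using q0(1) \<open>degree f0 < m\<close> by simp
  have q0B: "nrm Vh (coeff (map_poly \<iota> q0) i) \<le> nrm Vh B" for i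
  proof -
    have "nrm Vh (coeff f0 i - \<iota> (coeff q0 i)) \<le> nrm Vh B"
      using q0(2)[of i] d(3) B(2) by (meson order_trans)
    then have "nrm Vh (coeff f0 i - (coeff f0 i - \<iota> (coeff q0 i))) \<le> nrm Vh B"
      by (rule H.nrm_diff_le[OF B(3)])
    then show ?thesis by simp
  qed
  \<comment> \<open>The bound by 1 is what confines x to the ball of radius |B|.\<close>
  obtain e where e: "e \<noteq> 0" "nrm Vh e \<le> nrm Vh c" "nrm Vh e \<le> nrm Vh 1"
    using H.exists_nrm_lower[OF c, of 1] by auto
  obtain e' where e': "e' \<noteq> 0" "nrm Vh (\<iota> e') = nrm Vh e" using exists_same_nrm[OF e(1)] by blast
  define q where "q = monom 1 m + q0"
  have "degree q = m"
    unfolding q_def using dq0 by (subst degree_add_eq_left) (auto simp: degree_monom_eq)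
  then have "degree q > 0" using f by (simp add: m_def)
  then obtain x where "nrm V (poly q x) < nrm V e'"
    using small e'(1) by (auto simp: V.small_values_def)
  then have "nrm Vh (\<iota> (poly q x)) < nrm Vh (\<iota> e')" by (simp only: nrm_h_less_iff)
  moreover have qx: "\<iota> (poly q x) = poly (monom 1 m + map_poly \<iota> q0) (\<iota> x)"
    by (simp add: q_def poly_monom)
  ultimately have small_q: "nrm Vh (poly (monom 1 m + map_poly \<iota> q0) (\<iota> x)) < nrm Vh e"
    using e'(2) by simp
  have "nrm Vh (\<iota> x) \<le> nrm Vh B"
  proof (rule ccontr)
    assume "\<not> ?thesis"
    then have "nrm Vh 1 < nrm Vh (poly (monom 1 m + map_poly \<iota> q0) (\<iota> x))"
      using q0B dq0 B(2) by (intro H.nrm_monic_poly_large[where B = B]) (auto simp: H.nrm_not_le)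
    then show False using small_q e(3) by auto
  qed
  then have "nrm Vh (poly (f0 - map_poly \<iota> q0) (\<iota> x)) \<le> nrm Vh (d * B ^ m)"
    using q0(2) B(2) \<open>degree f0 < m\<close> dq0
    by (intro H.nrm_poly_le) (auto intro!: degree_diff_le)
  also have "\<dots> \<le> nrm Vh (c' / B ^ m * B ^ m)" using d(2) by (intro H.nrm_mult_mono) auto
  also have "\<dots> < nrm Vh c" using c'(2) B(1) by simp
  finally have "nrm Vh (poly (monom 1 m + map_poly \<iota> q0) (\<iota> x) + poly (f0 - map_poly \<iota> q0) (\<iota> x)) < nrm Vh c"
    using small_q e(2) by (intro H.nrm_add_less) auto
  also have "poly (monom 1 m + map_poly \<iota> q0) (\<iota> x) + poly (f0 - map_poly \<iota> q0) (\<iota> x) = poly f (\<iota> x)"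
    by (simp add: f_eq)
  finally show ?thesis by blast
qed

lemma alg_closed_if_small_values:
  fixes p :: "'b poly"
  assumes small: "V.small_values" and "degree p > 0"
  shows "\<exists>x. poly p x = 0"
proof (rule root_if_small_values[OF H.valuation_domain Vh_proper complete assms(2)])
  fix c :: 'b assume c: "c \<noteq> 0"
  define l where "l = lead_coeff p"
  have l: "l \<noteq> 0" using assms(2) by (auto simp: l_def)
  have "\<exists>x. nrm Vh (poly (smult (1 / l) p) x) < nrm Vh (c / l)"
    using l c assms(2) by (intro small_values_monic[OF small]) (auto simp: l_def)
  then obtain x where "nrm Vh (poly (smult (1 / l) p) x) < nrm Vh (c / l)" by blast
  then have "nrm Vh (poly (smult (1 / l) p) x * l) < nrm Vh (c / l * l)"
    using l by (subst H.nrm_mult_less_cancel)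
  then show "\<exists>x. nrm Vh (poly p x) < nrm Vh c" using l by auto
qed

text \<open>Points of K close to a root of f in the completion give small values, by density and
  continuity.\<close>

lemma small_values_if_alg_closed:
  assumes ac: "\<And>p :: 'b poly. degree p > 0 \<Longrightarrow> \<exists>x. poly p x = 0"
  shows "V.small_values"
  unfolding V.small_values_def
proof (intro allI impI)
  fix f :: "'a poly" and c :: 'a assume f: "degree f > 0" and c: "c \<noteq> 0"
  obtain e where e: "e \<noteq> 0" "nrm V e < nrm V c" using V.exists_nrm_less[OF V_proper c] by blast
  obtain l where l: "poly (map_poly \<iota> f) l = 0" using ac[of "map_poly \<iota> f"] f by auto
  obtain d where d: "d \<noteq> 0" "\<And>x. nrm Vh (x - l) \<le> nrm Vh d \<Longrightarrow>
    nrm Vh (poly (map_poly \<iota> f) x - poly (map_poly \<iota> f) l) \<le> nrm Vh (\<iota> e)"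
    using H.poly_continuous[of "\<iota> e" l "map_poly \<iota> f"] e(1) by auto
  obtain x where "nrm Vh (\<iota> x - l) < nrm Vh d" using dense[OF d(1)] by blast
  then have "nrm Vh (poly (map_poly \<iota> f) (\<iota> x)) \<le> nrm Vh (\<iota> e)" using d(2)[of "\<iota> x"] l by simp
  then have "nrm V (poly f x) \<le> nrm V e" by (simp only: poly_map_poly_h nrm_h_le_iff)
  then show "\<exists>x. nrm V (poly f x) < nrm V c" using e(2) by (meson le_less_trans)
qed

end


section \<open>Extensions with \<open>\<L>(W) = \<emptyset>\<close>\<close>

context val_ext
begin

text \<open>Call two elements close if their difference is smaller than both. As f is not tiny, some
  x makes f(x) negligible against f, so f is close to (X - x) g. Now X - x is close to a constant e
  because L(W) is empty, and g to a constant d by induction; hence f is close to e d.\<close>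

lemma poly_approx_constant:
  assumes small: small_values and LL: "LL W = {}"
    and not_tiny: "\<And>q. q \<noteq> 0 \<Longrightarrow> \<exists>c. c \<noteq> 0 \<and> w (rconst c) \<le> w (to_fract q)"
    and "f \<noteq> 0"
  shows "\<exists>d. d \<noteq> 0 \<and> w (to_fract f - rconst d) < w (to_fract f)"
  using \<open>f \<noteq> 0\<close>
proof (induction "degree f" arbitrary: f)
  case 0
  then obtain a where "f = [:a:]" by (metis degree_eq_zeroE)
  then show ?case using 0 by (intro exI[of _ a]) (auto simp: rconst_def)
next
  case (Suc k)
  then have "degree f > 0" by simp
  obtain c where c: "c \<noteq> 0" "w (rconst c) \<le> w (to_fract f)" using not_tiny Suc.prems by blast
  obtain x where x: "n (poly f x) < n c"
    using small \<open>degree f > 0\<close> c(1) by (auto simp: small_values_def)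
  then have "w (rconst (poly f x)) < w (rconst c)" by (simp only: w_rconst_less_iff)
  then have fx: "w (rconst (poly f x)) < w (to_fract f)" using c(2) by (rule less_le_trans)
  let ?T = "rX - rconst x"
  from poly_split[OF \<open>degree f > 0\<close>, of x] obtain g where g: "degree f = Suc (degree g)"
    "lead_coeff g = lead_coeff f" "to_fract f = ?T * to_fract g + rconst (poly f x)" by metis
  have "g \<noteq> 0" using g(2) Suc.prems by auto
  then obtain d where d: "d \<noteq> 0" "w (to_fract g - rconst d) < w (to_fract g)"
    using Suc.hyps(1)[of g] Suc.hyps(2) g(1) by auto
  obtain e where e: "e \<noteq> 0" "w ?T = w (rconst e)" "w (rX - rconst (x + e)) < w ?T"
    using LL LL_empty_iff by blast
  have "w (to_fract f - rconst (poly f x)) = w (to_fract f)"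
    using fx by (rule W.nrm_diff_eq_left)
  then have wf: "w (?T * to_fract g) = w (to_fract f)" by (simp add: g(3))
  have "w ((?T - rconst e) * to_fract g) < w (?T * to_fract g)"
    using e(3) \<open>g \<noteq> 0\<close> by (subst W.nrm_mult_less_cancel) (auto simp: diff_diff_eq)
  moreover have "w (rconst e * (to_fract g - rconst d)) < w (?T * to_fract g)"
    using e(2) d(2) by (intro W.nrm_mult_strict_mono') auto
  ultimately have "w ((?T - rconst e) * to_fract g + rconst e * (to_fract g - rconst d) + rconst (poly f x))
      < w (to_fract f)"
    using fx unfolding wf by (intro W.nrm_add_less)
  moreover have "(?T - rconst e) * to_fract g + rconst e * (to_fract g - rconst d) + rconst (poly f x)
      = to_fract f - rconst (e * d)"
    unfolding g(3) by (simp add: algebra_simps)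
  ultimately show ?case using d(1) e(1) by (intro exI[of _ "e * d"]) simp
qed

text \<open>Approximating numerator and denominator by constants approximates every nonzero fraction
  by a constant, with an error smaller than the fraction. This gives its value, and for a fraction
  of value 1 its residue; smaller ones have residue 0.\<close>

lemma immediate_if_not_tiny:
  assumes small: small_values and LL: "LL W = {}"
    and not_tiny: "\<And>q. q \<noteq> 0 \<Longrightarrow> \<exists>c. c \<noteq> 0 \<and> w (rconst c) \<le> w (to_fract q)"
  shows "immediate V W"
proof -
  have approx: "\<exists>d. d \<noteq> 0 \<and> w (to_fract f - rconst d) < w (to_fract f)" if "f \<noteq> 0" for f
    by (rule poly_approx_constant[OF small LL _ that]) (rule not_tiny)
  have key: "\<exists>d. d \<noteq> 0 \<and> w (\<phi> - rconst d) < w \<phi>" if \<phi>: "\<phi> \<noteq> 0" for \<phi>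
  proof -
    obtain p q a b where pq: "\<phi> = Fract p q" "q \<noteq> 0" by (rule Fract_bezout[of \<phi>])
    have "p \<noteq> 0" using \<phi> pq by (auto simp: Fract_conv_to_fract)
    obtain c where c: "c \<noteq> 0" "w (to_fract p - rconst c) < w (to_fract p)"
      using approx[OF \<open>p \<noteq> 0\<close>] by blast
    obtain d where d: "d \<noteq> 0" "w (to_fract q - rconst d) < w (to_fract q)"
      using approx[OF \<open>q \<noteq> 0\<close>] by blast
    have wd: "w (rconst d) = w (to_fract q)"
      using W.nrm_diff_eq_left[OF d(2)] by simp
    have "w ((to_fract p - rconst c) * rconst d) < w (to_fract p * rconst d)"
      using c(2) d(1) by (subst W.nrm_mult_less_cancel) auto
    moreover have "w (rconst c) = w (to_fract p)"
      using W.nrm_diff_eq_left[OF c(2)] by simp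
    then have "w (rconst c * (to_fract q - rconst d)) < w (to_fract p * rconst d)"
      by (intro W.nrm_mult_strict_mono') (use d(2) \<open>p \<noteq> 0\<close> in \<open>simp_all add: wd\<close>)
    ultimately have "w ((to_fract p - rconst c) * rconst d - rconst c * (to_fract q - rconst d))
        < w (to_fract p * rconst d)" by (rule W.nrm_diff_less)
    also have "(to_fract p - rconst c) * rconst d - rconst c * (to_fract q - rconst d)
        = (\<phi> - rconst (c / d)) * (to_fract q * rconst d)"
      using pq(2) d(1) by (simp add: pq(1) Fract_conv_to_fract field_simps)
    also have "to_fract p * rconst d = \<phi> * (to_fract q * rconst d)"
      using pq(2) by (simp add: pq(1) Fract_conv_to_fract)
    finally have "w (\<phi> - rconst (c / d)) < w \<phi>"
      using pq(2) d(1) by (subst (asm) W.nrm_mult_less_cancel) auto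
    then show ?thesis using c(1) d(1) by (intro exI[of _ "c / d"]) auto
  qed
  have eq: "w \<phi> = w (rconst d)" if "w (\<phi> - rconst d) < w \<phi>" for \<phi> d
    using W.nrm_diff_eq_left[OF that] by simp
  have "val W \<phi> \<in> base_value_group W" if "\<phi> \<noteq> 0" for \<phi>
    using key[OF that] eq unfolding base_value_group_def image_iff W.val_eq_iff by blast
  then have "value_group W = base_value_group W"
    by (auto simp: value_group_def base_value_group_def)
  moreover have residue_eq: "residue W \<phi> = residue W (rconst d)" if "w (\<phi> - rconst d) < w 1" for \<phi> d
  proof -
    have "w (\<psi> - \<phi>) < w 1 \<longleftrightarrow> w (\<psi> - rconst d) < w 1" for \<psi>
      using W.nrm_add_less[of "\<psi> - \<phi>" 1 "\<phi> - rconst d"] W.nrm_diff_less[of "\<psi> - rconst d" 1 "\<phi> - rconst d"] that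
      by auto
    then show ?thesis by (simp add: residue_def W.max_ideal_iff)
  qed
  have "residue W \<phi> \<in> base_residue_field V W" if \<phi>: "\<phi> \<in> W" for \<phi>
  proof -
    have "\<exists>d\<in>V. w (\<phi> - rconst d) < w 1"
    proof (cases "w \<phi> = w 1")
      case True
      then have "\<phi> \<noteq> 0" by (metis W.nrm_eq_zero_iff zero_neq_one)
      then obtain d where d: "w (\<phi> - rconst d) < w \<phi>" using key by blast
      then have "w (rconst d) = w (rconst 1)" using eq[OF d] True by simp
      then have "n d \<le> n 1" by (simp only: w_rconst_eq_iff)
      then show ?thesis using d True by (auto simp: nrm_le_one_iff)
    next
      case False
      then have "w \<phi> < w 1" using \<phi> by (simp add: order_less_le W.nrm_le_one_iff)
      then show ?thesis using zero_mem by (intro bexI[of _ 0]) auto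
    qed
    then show ?thesis using residue_eq by (auto simp: base_residue_field_def)
  qed
  then have "residue_field W = base_residue_field V W"
    using rconst_mem_iff by (auto simp: residue_field_def base_residue_field_def)
  ultimately show ?thesis by (simp add: immediate_def)
qed

text \<open>Were all X - x larger than c, then |f| \<ge> |lead(f) c^deg f| for every nonzero f:
  choose x with f(x) below this bound and split off X - x. A tiny q violates the estimate.\<close>

lemma linear_small_if_tiny:
  assumes small: small_values and q: "q \<noteq> 0"
    and tiny: "\<And>c. c \<noteq> 0 \<Longrightarrow> w (to_fract q) < w (rconst c)" and c: "c \<noteq> 0"
  shows "\<exists>x. w (rX - rconst x) \<le> w (rconst c)"
proof (rule ccontr)
  assume "\<not> ?thesis"
  then have large: "w (rconst c) < w (rX - rconst x)" for x by (simp add: W.nrm_not_le)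
  have "w (rconst (lead_coeff f * c ^ degree f)) \<le> w (to_fract f)" if "f \<noteq> 0" for f
    using that
  proof (induction "degree f" arbitrary: f)
    case 0
    then obtain a where "f = [:a:]" by (metis degree_eq_zeroE)
    then show ?case by (simp add: rconst_def)
  next
    case (Suc k)
    then have "degree f > 0" by simp
    define a where "a = lead_coeff f * c ^ degree f"
    have a: "a \<noteq> 0" using Suc.prems c by (simp add: a_def)
    obtain x where "n (poly f x) < n a"
      using small \<open>degree f > 0\<close> a by (auto simp: small_values_def)
    then have x: "w (rconst (poly f x)) < w (rconst a)" by (simp only: w_rconst_less_iff)
    let ?T = "rX - rconst x"
    from poly_split[OF \<open>degree f > 0\<close>, of x] obtain g where g: "degree f = Suc (degree g)"
      "lead_coeff g = lead_coeff f" "to_fract f = ?T * to_fract g + rconst (poly f x)" by metis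
    have "g \<noteq> 0" using g(2) Suc.prems by auto
    then have "w (rconst (lead_coeff g * c ^ degree g)) \<le> w (to_fract g)"
      using Suc.hyps(1)[of g] Suc.hyps(2) g(1) by simp
    then have "w (rconst c * rconst (lead_coeff g * c ^ degree g)) \<le> w (?T * to_fract g)"
      using large[of x] by (intro W.nrm_mult_mono) auto
    moreover have "rconst c * rconst (lead_coeff g * c ^ degree g) = rconst a"
      by (simp add: a_def g(1,2) mult.left_commute del: rconst_simps flip: rconst_simps(6))
    ultimately have *: "w (rconst a) \<le> w (?T * to_fract g)" by (simp only:)
    then have "w (to_fract f) = w (?T * to_fract g)"
      unfolding g(3) using less_le_trans[OF x *] by (intro W.nrm_add_eq_left)
    then show ?case using * by (simp only: a_def)
  qed
  from this[OF q] show False using tiny[of "lead_coeff q * c ^ degree q"] q c by (simp del: rconst_simps)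
qed

end

section \<open>Non-immediate extensions with empty L(W)\<close>

locale val_ext_completion = val_ext_seq V W r s + val_completion V Vh \<iota>
  for V :: "'a::field set" and W and r :: "'i rel" and s and Vh :: "'b::field set" and \<iota> +
  assumes pm: "pseudo_monotone V r s" and small: small_values
    and LL: "LL W = {}" and not_imm: "\<not> immediate V W"
begin

text \<open>Non-immediacy enters through this polynomial. Its smallness makes the sequence Cauchy,
  and it also witnesses the algebraic type.\<close>

lemma exists_tiny: "\<exists>q. q \<noteq> 0 \<and> (\<forall>c. c \<noteq> 0 \<longrightarrow> w (to_fract q) < w (rconst c))"
  using immediate_if_not_tiny[OF small LL] not_imm W.nrm_not_le by metis

lemma eventually_close: "c \<noteq> 0 \<Longrightarrow> \<exists>x. eventually (\<lambda>i. n (s i - x) \<le> n c) (tails r)"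
  using linear_small_if_tiny[OF small] exists_tiny by (metis w_linear_le_iff)

lemma cauchy: "cauchy_seq_val V r s"
  unfolding cauchy_seq_val_def cauchy_filter_val_iff
proof (intro conjI allI impI)
  show "filtermap s (tails r) \<noteq> bot" using tails_not_bot[OF io] by (simp add: filtermap_bot_iff)
  fix c :: 'a assume "c \<noteq> 0"
  then obtain d where d: "d \<noteq> 0" "n d < n c" using exists_nrm_less[OF V_proper] by blast
  obtain x where x: "eventually (\<lambda>i. n (s i - x) \<le> n d) (tails r)" using eventually_close[OF d(1)] by blast
  have "n (y - z) < n c" if "n (y - x) \<le> n d" "n (z - x) \<le> n d" for y z
    using nrm_diff_le[OF that] d(2) by simp
  then show "\<exists>P. eventually P (filtermap s (tails r)) \<and> (\<forall>x y. P x \<and> P y \<longrightarrow> n (x - y) < n c)"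
    using x by (intro exI[of _ "\<lambda>y. n (y - x) \<le> n d"]) (auto simp: eventually_filtermap)
qed

lemma exists_limit: "\<exists>l. limitin (valuation_topology Vh) (\<lambda>i. \<iota> (s i)) l (tails r)"
proof -
  have "cauchy_filter_val Vh (filtermap (\<lambda>i. \<iota> (s i)) (tails r))"
    unfolding H.cauchy_filter_val_iff
  proof (intro conjI allI impI)
    show "filtermap (\<lambda>i. \<iota> (s i)) (tails r) \<noteq> bot" using tails_not_bot[OF io] by (simp add: filtermap_bot_iff)
    fix c :: 'b assume "c \<noteq> 0"
    then obtain d where d: "d \<noteq> 0" "nrm Vh (\<iota> d) = nrm Vh c" using exists_same_nrm by blast
    obtain P where P: "eventually P (filtermap s (tails r))" "\<And>x y. P x \<Longrightarrow> P y \<Longrightarrow> n (x - y) < n d"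
      using cauchy d(1) unfolding cauchy_seq_val_def cauchy_filter_val_iff by blast
    have "nrm Vh (\<iota> x - \<iota> y) < nrm Vh c" if "P x" "P y" for x y
      using P(2)[OF that] d(2) by (metis h_diff nrm_h_less_iff)
    then show "\<exists>P. eventually P (filtermap (\<lambda>i. \<iota> (s i)) (tails r)) \<and>
        (\<forall>x y. P x \<and> P y \<longrightarrow> nrm Vh (x - y) < nrm Vh c)"
      using P(1) by (intro exI[of _ "\<lambda>y. \<exists>x. P x \<and> y = \<iota> x"])
        (auto simp: eventually_filtermap elim: eventually_mono)
  qed
  then obtain l where "limitin (valuation_topology Vh) (\<lambda>x. x) l (filtermap (\<lambda>i. \<iota> (s i)) (tails r))"
    using complete by (auto simp: complete_val_def)
  then show ?thesis by (auto simp: limitin_def eventually_filtermap)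
qed

text \<open>For a limit a in K the distances |s i - a| would become arbitrarily small, but with L(W)
  empty they are eventually equal to a fixed |c| with c nonzero.\<close>

lemma limit_not_in_range:
  assumes "limitin (valuation_topology Vh) (\<lambda>i. \<iota> (s i)) l (tails r)"
  shows "l \<notin> range \<iota>"
proof
  assume "l \<in> range \<iota>"
  then obtain a where a: "l = \<iota> a" by blast
  obtain c where c: "c \<noteq> 0" "w (rX - rconst a) = w (rconst c)" using LL LL_empty_iff by blast
  have "eventually (\<lambda>i. n (s i - a) = n c) (tails r)" using c by (simp add: w_linear_eq_iff)
  moreover have "eventually (\<lambda>i. nrm Vh (\<iota> (s i) - l) < nrm Vh (\<iota> c)) (tails r)"
    using c(1) by (intro H.limitin_eventually[OF assms]) simp
  ultimately have "eventually (\<lambda>i. False) (tails r)"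
  proof eventually_elim
    case (elim i)
    have "nrm Vh (\<iota> (s i - a)) < nrm Vh (\<iota> c)" using elim(2) by (simp add: a)
    then show ?case using elim(1) by (simp only: nrm_h_less_iff)
  qed
  then show False using tails_not_bot[OF io] by (simp add: trivial_limit_def)
qed

text \<open>
  A polynomial \<open>q\<close> which is smaller than all constants vanishes at the limit \<open>l\<close>; if \<open>k\<close> is the
  order of this zero, then \<open>q (s i)\<close> is eventually a constant times the \<open>k\<close>-th power of the
  distance from \<open>s i\<close> to \<open>l\<close>.
\<close>

lemma algebraic: "algebraic_type V r s"
proof -
  have pc: "pseudo_convergent V r s" using pseudo_convergent_if_LL_empty[OF pm LL] .
  obtain l where lim: "limitin (valuation_topology Vh) (\<lambda>i. \<iota> (s i)) l (tails r)"
    using exists_limit by blast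
  note ev_lim = H.limitin_eventually[OF lim]
  obtain q where q: "q \<noteq> 0" "\<And>c. c \<noteq> 0 \<Longrightarrow> w (to_fract q) < w (rconst c)" using exists_tiny by blast
  define Q where "Q = map_poly \<iota> q"
  have Qs: "poly Q (\<iota> x) = \<iota> (poly q x)" for x by (simp add: Q_def)
  have "coeff Q (degree q) \<noteq> 0" using q(1) by (simp add: Q_def)
  then have "Q \<noteq> 0" by auto
  have "nrm Vh (poly Q l) \<le> nrm Vh e" if e: "e \<noteq> 0" for e
  proof -
    obtain d where d: "d \<noteq> 0" "\<And>x. nrm Vh (x - l) \<le> nrm Vh d \<Longrightarrow> nrm Vh (poly Q x - poly Q l) \<le> nrm Vh e"
      using H.poly_continuous[OF e] by blast
    obtain c where c: "c \<noteq> 0" "nrm Vh (\<iota> c) = nrm Vh e" using exists_same_nrm[OF e] by blast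
    have "eventually (\<lambda>i. n (poly q (s i)) \<le> n c) (tails r)"
      using w_le_iff[OF c(1), of q] q(2)[OF c(1)] less_imp_le by blast
    with ev_lim[OF d(1)] have "eventually (\<lambda>i. nrm Vh (poly Q l) \<le> nrm Vh e) (tails r)"
    proof eventually_elim
      case (elim i)
      have "nrm Vh (poly Q (\<iota> (s i))) \<le> nrm Vh e"
        using elim(2) unfolding Qs c(2)[symmetric] by simp
      then have "nrm Vh (poly Q (\<iota> (s i)) - (poly Q (\<iota> (s i)) - poly Q l)) \<le> nrm Vh e"
        by (rule H.nrm_diff_le) (use d(2) elim(1) in auto)
      then show ?case by simp
    qed
    then show ?thesis using tails_not_bot[OF io] by (simp add: eventually_const_iff)
  qed
  then have Ql: "poly Q l = 0"
    using H.exists_nrm_less[OF Vh_proper, of "poly Q l"] by (auto simp: H.nrm_not_less[symmetric])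
  define k where "k = order l Q"
  have k: "k > 0" using Ql \<open>Q \<noteq> 0\<close> order_root[of Q l] by (simp add: k_def)
  obtain g where g: "Q = [:- l, 1:] ^ k * g" "\<not> [:- l, 1:] dvd g"
    using order_decomp[OF \<open>Q \<noteq> 0\<close>, of l] by (auto simp: k_def)
  have gl: "poly g l \<noteq> 0" using g(2) poly_eq_0_iff_dvd by blast
  obtain e where e: "e \<noteq> 0" "nrm Vh e < nrm Vh (poly g l)"
    using H.exists_nrm_less[OF Vh_proper gl] by blast
  obtain d where d: "d \<noteq> 0" "\<And>x. nrm Vh (x - l) \<le> nrm Vh d \<Longrightarrow> nrm Vh (poly g x - poly g l) \<le> nrm Vh e"
    using H.poly_continuous[OF e(1)] by blast
  obtain i0 where i0: "i0 \<in> Field r" and close: "\<And>i. (i0, i) \<in> r \<Longrightarrow> nrm Vh (\<iota> (s i) - l) < nrm Vh d"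
    using ev_lim[OF d(1)] by (auto simp: eventually_tails[OF io])
  have nrm_q: "nrm Vh (\<iota> (poly q (s i))) = nrm Vh (poly g l * (\<iota> (s i) - l) ^ k)"
    if "(i0, i) \<in> r" for i
  proof -
    have "nrm Vh (poly g (\<iota> (s i)) - poly g l) \<le> nrm Vh e"
      using close[OF that] by (intro d(2)) simp
    then have "nrm Vh (poly g (\<iota> (s i)) - poly g l) < nrm Vh (poly g l)" using e(2) by (rule le_less_trans)
    then have "nrm Vh (poly g l + (poly g (\<iota> (s i)) - poly g l)) = nrm Vh (poly g l)"
      by (rule H.nrm_add_eq_left)
    then have "nrm Vh (poly g (\<iota> (s i))) = nrm Vh (poly g l)" by simp
    then have "nrm Vh (poly g (\<iota> (s i)) * (\<iota> (s i) - l) ^ k) = nrm Vh (poly g l * (\<iota> (s i) - l) ^ k)"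
      by (rule H.nrm_mult_cong) simp
    moreover have "\<iota> (poly q (s i)) = poly g (\<iota> (s i)) * (\<iota> (s i) - l) ^ k"
      unfolding Qs[symmetric] by (simp add: g(1) mult.commute)
    ultimately show ?thesis by simp
  qed
  \<comment> \<open>The gap from s i to a later s j is already the distance from s i to l: a term s
    b far enough beyond j is closer to l than this gap and has the same distance from s i as s
    j.\<close>
  have dist: "nrm Vh (\<iota> (s i) - l) = nrm Vh (\<iota> (s j - s i))" if ij: "(i, j) \<in> r - Id" for i j
  proof -
    obtain m where m: "(j, m) \<in> r - Id" using index_order_next[OF io] index_order_FieldD[OF ij] by blast
    have "n (s m - s j) < n (s j - s i)" using pc ij m by (auto simp: pseudo_convergent_iff)
    then have "s j - s i \<noteq> 0" by auto
    then have "\<iota> (s j - s i) \<noteq> 0" by (simp only: h_eq_zero_iff) simp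
    from ev_lim[OF this] obtain a where a: "a \<in> Field r"
      "\<And>b. (a, b) \<in> r \<Longrightarrow> nrm Vh (\<iota> (s b) - l) < nrm Vh (\<iota> (s j - s i))"
      by (auto simp: eventually_tails[OF io])
    have jF: "j \<in> Field r" using index_order_FieldD[OF ij] by blast
    obtain b where b: "(a, b) \<in> r" "(j, b) \<in> r - Id"
    proof (cases rule: index_order_cases[OF io a(1) jF])
      case 1
      then show ?thesis using that[of m] m index_order_trans[OF io, of a j m] by blast
    next
      case 2
      then show ?thesis using that[of m] m by blast
    next
      case 3
      then show ?thesis using that[of a] index_order_refl[OF io a(1)] by blast
    qed
    have "n (s b - s j) < n (s j - s i)" using pc ij b(2) by (auto simp: pseudo_convergent_iff)
    then have "n ((s j - s i) + (s b - s j)) = n (s j - s i)" by (rule nrm_add_eq_left)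
    then have bi: "nrm Vh (\<iota> (s b - s i)) = nrm Vh (\<iota> (s j - s i))" by (simp add: order_eq_iff del: h_diff)
    then have "nrm Vh ((\<iota> (s b) - l) - \<iota> (s b - s i)) = nrm Vh (\<iota> (s b - s i))"
      using a(2)[OF b(1)] by (intro H.nrm_diff_eq_right) (simp del: h_diff)
    moreover have "(\<iota> (s b) - l) - \<iota> (s b - s i) = \<iota> (s i) - l" by simp
    ultimately show ?thesis using bi by (simp only:)
  qed
  have "n (poly q (s j)) < n (poly q (s i))" if i0i: "(i0, i) \<in> r" and ij: "(i, j) \<in> r - Id" for i j
  proof -
    obtain m where m: "(j, m) \<in> r - Id" using index_order_next[OF io] index_order_FieldD[OF ij] by blast
    have "n (s m - s j) < n (s j - s i)" using pc ij m by (auto simp: pseudo_convergent_iff)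
    then have "nrm Vh (\<iota> (s j) - l) < nrm Vh (\<iota> (s i) - l)"
      unfolding dist[OF ij] dist[OF m] by (simp only: nrm_h_less_iff)
    then have "nrm Vh ((\<iota> (s j) - l) ^ k) < nrm Vh ((\<iota> (s i) - l) ^ k)"
      using k by (rule H.nrm_power_strict_mono)
    then have "nrm Vh (poly g l * (\<iota> (s j) - l) ^ k) < nrm Vh (poly g l * (\<iota> (s i) - l) ^ k)"
      using gl by (intro H.nrm_mult_strict_mono') auto
    moreover have "(i0, j) \<in> r" using index_order_trans[OF io i0i] ij by blast
    ultimately have "nrm Vh (\<iota> (poly q (s j))) < nrm Vh (\<iota> (poly q (s i)))"
      using nrm_q i0i by metis
    then show ?thesis by (simp only: nrm_h_less_iff)
  qed
  then show ?thesis unfolding algebraic_type_iff using i0 by blast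
qed

end


theorem theorem6p2:
  fixes V :: "'a::field set" and Vh :: "'b::field set" and \<iota> :: "'a \<Rightarrow> 'b"
  assumes "valuation_domain V" and "V \<noteq> UNIV"
    and "is_completion V Vh \<iota>"
  shows
    "((\<forall>W. is_extension V W \<longrightarrow>
          (\<exists>(r :: 'a rel) (s :: 'a \<Rightarrow> 'a). pseudo_monotone V r s \<and> W = VE V r s))
        \<longleftrightarrow> (\<forall>p :: 'b poly. degree p > 0 \<longrightarrow> (\<exists>x. poly p x = 0)))
     \<and>
     ((\<forall>p :: 'b poly. degree p > 0 \<longrightarrow> (\<exists>x. poly p x = 0)) \<longrightarrow>
       (\<forall>W (r :: 'i rel) (s :: 'i \<Rightarrow> 'a).
          is_extension V W \<and> pseudo_monotone V r s \<and> W = VE V r s \<longrightarrow>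
          (immediate V W \<longrightarrow> pseudo_convergent V r s \<and> transcendental_type V r s) \<and>
          (\<not> immediate V W \<longrightarrow>
             (LL W = {} \<longrightarrow>
                pseudo_convergent V r s \<and> cauchy_seq_val V r s \<and> algebraic_type V r s \<and>
                (\<exists>l. limitin (valuation_topology Vh) (\<lambda>i. \<iota> (s i)) l (tails r) \<and>
                     l \<notin> range \<iota>)) \<and>
             (\<forall>\<alpha> I. L1 W = (\<lambda>x. \<alpha> + x) ` I \<and> fractional_ideal V I \<and> divisorial V I \<longrightarrow>
                (\<exists>(r' :: 'a rel) (s' :: 'a \<Rightarrow> 'a).
                   pseudo_convergent V r' s' \<and> algebraic_type V r' s' \<and> W = VE V r' s')) \<and>
             (\<forall>\<alpha> I. L1 W = (\<lambda>x. \<alpha> + x) ` I \<and> (fractional_ideal V I \<or> I = UNIV) \<and>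
                 \<not> principal_fractional_ideal V I \<longrightarrow>
                (\<exists>(r' :: 'a rel) (s' :: 'a \<Rightarrow> 'a).
                   pseudo_divergent V r' s' \<and> W = VE V r' s')) \<and>
             (L2 W \<noteq> {} \<longrightarrow> pseudo_stationary V r s))))"
proof -
  interpret V: val_dom V by standard (rule assms(1))
  have "valuation_domain Vh" using assms(3) by (simp add: is_completion_def)
  then interpret Vh: val_dom Vh by (rule val_dom.intro)
  interpret completion: val_completion V Vh \<iota>
    by unfold_locales (use assms(2,3) in \<open>simp_all add: is_completion_def\<close>)
  have ac_iff: "(\<forall>p :: 'b poly. degree p > 0 \<longrightarrow> (\<exists>x. poly p x = 0)) \<longleftrightarrow> V.small_values"
    using completion.alg_closed_if_small_values completion.small_values_if_alg_closed by blast
  have all_iff: "(\<forall>W. is_extension V W \<longrightarrow>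
      (\<exists>(r :: 'a rel) (s :: 'a \<Rightarrow> 'a). pseudo_monotone V r s \<and> W = VE V r s)) \<longleftrightarrow> V.small_values"
    (is "?all \<longleftrightarrow> _")
  proof
    assume ?all
    then show V.small_values using small_values_if_pseudo_monotone[OF assms(1,2)] by blast
  next
    assume small: V.small_values
    show ?all
    proof (intro allI impI)
      fix W assume "is_extension V W"
      then interpret W: val_ext V W by (unfold_locales)
      show "\<exists>(r :: 'a rel) (s :: 'a \<Rightarrow> 'a). pseudo_monotone V r s \<and> W = VE V r s"
        by (rule W.exists_pseudo_monotone[OF assms(2) small])
    qed
  qed
  show ?thesis
    unfolding ac_iff all_iff
  proof (intro conjI refl impI allI)
    fix W and r :: "'i rel" and s :: "'i \<Rightarrow> 'a"
    assume small: V.small_values and A: "is_extension V W \<and> pseudo_monotone V r s \<and> W = VE V r s"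
    then have pm: "pseudo_monotone V r s" by blast
    then have io: "index_order r"
      by (auto simp: pseudo_monotone_def pseudo_convergent_def pseudo_divergent_def pseudo_stationary_def)
    interpret W: val_ext_seq V W r s by unfold_locales (use A io in auto)
    {
      assume imm: "immediate V W"
      show "pseudo_convergent V r s"
        by (rule W.pseudo_convergent_if_LL_empty[OF pm W.LL_empty_if_immediate[OF imm]])
      show "transcendental_type V r s" by (rule W.transcendental_type_if_immediate[OF imm])
    next
      assume not_imm: "\<not> immediate V W" and LL: "LL W = {}"
      interpret B: val_ext_completion V W r s Vh \<iota>
        by unfold_locales (use pm small LL not_imm in auto)
      show "pseudo_convergent V r s" by (rule W.pseudo_convergent_if_LL_empty[OF pm LL])
      show "cauchy_seq_val V r s" by (rule B.cauchy)
      show "algebraic_type V r s" by (rule B.algebraic)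
      show "\<exists>l. limitin (valuation_topology Vh) (\<lambda>i. \<iota> (s i)) l (tails r) \<and> l \<notin> range \<iota>"
        using B.exists_limit B.limit_not_in_range by blast
    next
      fix \<alpha> I assume "L1 W = (\<lambda>x. \<alpha> + x) ` I \<and> fractional_ideal V I \<and> divisorial V I"
      then show "\<exists>(r' :: 'a rel) (s' :: 'a \<Rightarrow> 'a).
          pseudo_convergent V r' s' \<and> algebraic_type V r' s' \<and> W = VE V r' s'"
        using W.exists_pseudo_convergent_divisorial[OF assms(2) small] by blast
    next
      fix \<alpha> I assume L1: "L1 W = (\<lambda>x. \<alpha> + x) ` I \<and> (fractional_ideal V I \<or> I = UNIV) \<and>
        \<not> principal_fractional_ideal V I"
      \<comment> \<open>A fractional ideal and the whole field both contain 0, so the case L1 = K is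
        treated along with the others.\<close>
      then have "0 \<in> I" by (auto simp: fractional_ideal_def)
      then show "\<exists>(r' :: 'a rel) (s' :: 'a \<Rightarrow> 'a). pseudo_divergent V r' s' \<and> W = VE V r' s'"
        using W.exists_pseudo_divergent_nonprincipal[OF small] L1 by blast
    next
      assume "L2 W \<noteq> {}"
      then show "pseudo_stationary V r s" using W.pseudo_stationary_if_L2[OF pm] by blast
    }
  qed
qed

end
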